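(* Let $T>0$, $\beta\in[0,1]$, let $H\colon[0,T]\times\mathbb{R}^d\times\mathbb{R}^d\to\mathbb{R}$, and let $\mathcal{L}$ be a Lévy operator with triplet $(A,0,\mu)$ and heat kernel $p_t$. Assume: (1) $p_t\in C_b^\infty(\mathbb{R}^d)$ and there exist $\alpha\in(1,2]$ and $c_0>0$ such that $\int_{\mathbb{R}^d}|Dp_t(y)|\,dy\le c_0t^{-1/\alpha}$ for all $t\in(0,T]$; moreover $\alpha+\beta\notin\mathbb{N}$; (2) $H$ is continuous, there is $H_0>0$ with $|H(t,x,0)|\le H_0$ for all $t\in(0,T)$, $x\in\mathbb{R}^d$, and for each $R>0$ there is $L_R>0$ such that $|H(t,x,p)-H(t,x,q)|\le L_R|p-q|$ for all $t\in(0,T)$, $x\in\mathbb{R}^d$, $p,q\in B(0,R)$; (3) for each $R>0$ there is $M_R>0$ such that $|H(t,x,p)-H(t,x',p)|\le M_R|x-x'|^\beta$ for all $t\in[0,T]$, $p\in B(0,R)$ and $x,x'\in\mathbb{R}^d$ with $|x-x'|<1$; (4) $u_0\colon\mathbb{R}^d\to\mathbb{R}$ is bounded and Lipschitz. Let $u\in C_b((0,T];C_b^1(\mathbb{R}^d))$ be a mild solution of $\partial_tu-\mathcal{L}u-H(t,x,Du)=0$ in $(0,T]\times\mathbb{R}^d$, $u(0,\cdot)=u_0$. Then: (i) $u(t)\in C_b^{\alpha+\beta}(\mathbb{R}^d)$ for every $t\in(0,T]$; (ii) $[D^{\lfloor\alpha+\beta\rfloor}u(t,\cdot)]_{\{\alpha+\beta\}}=O(t^{-\frac{\alpha+\beta-1}{\alpha}})$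 as $t\to0$, where $\{\alpha+\beta\}=\alpha+\beta-\lfloor\alpha+\beta\rfloor$; (iii) if $\alpha+\beta>2$, then $\|D^2u(t,\cdot)\|_\infty=O(t^{-\frac1\alpha})$ as $t\to0$.
   Context: Lévy operator: $A$ is a nonnegative definite real symmetric $d\times d$ matrix, $\mu\ge 0$ is a Borel measure on $\mathbb{R}^d\setminus\{0\}$ with $\int(1\wedge|z|^2)\,d\mu(z)<\infty$, and $$\mathcal{L}\varphi(x)=\operatorname{div}(AD\varphi(x))+\int_{\mathbb{R}^d}\big[\varphi(x+z)-\varphi(x)-\mathbf{1}_{|z|<1}D\varphi(x)\cdot z\big]\,d\mu(z).$$ Heat kernel: $p_t$, $t>0$, are the probability measures with $\int e^{-i\xi\cdot x}p_t(dx)=e^{-t\psi(\xi)}$, where $\psi(\xi)=\xi\cdot A\xi+\int(1-e^{i\xi\cdot z}+i\xi\cdot z\mathbf{1}_{|z|<1})\,d\mu(z)$; they are assumed absolutely continuous with density again denoted $p_t$. Semigroup: $P_t\varphi=p_t*\varphi$. Hölder spaces: $C_b^n(\mathbb{R}^d)$ has norm $\sum_{j\le n}\max_{|\kappa|=j}\|\partial^\kappa\varphi\|_\infty$; for $\gamma=n+\beta'$ with $\beta'\in(0,1)$, $\|\varphi\|_{C_b^\gamma}=\|\varphi\|_{C_b^n}+\max_{|\kappa|=n}[\partial^\kappa\varphi]_{\beta'}$, where $[\varphi]_{\beta'}=\sup_{x,\,h\ne0}|\varphi(x+h)-\varphi(x)|/|h|^{\beta'}$. $D^m\varphi$ is the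 tensor of all spatial derivatives of order $m$. $C_b((0,T];X)$ denotes bounded continuous functions from $(0,T]$ to $X$. Mild solution: $u\in C((0,T];C_b^1(\mathbb{R}^d))$ such that for all $t\in(0,T]$, $x\in\mathbb{R}^d$, $$u(t,x)=P_t[u_0](x)+\int_0^tP_{t-s}\big[H(s,\cdot,Du(s,\cdot))\big](x)\,ds.$$ *)

theory Defs
  imports "HOL-Analysis.Analysis" "HOL-Library.Landau_Symbols"
begin

section \<open>Derivatives and spaces of bounded differentiable functions\<close>

definition partial :: "'n::finite \<Rightarrow> (real ^ 'n \<Rightarrow> real) \<Rightarrow> real ^ 'n \<Rightarrow> real" where
  "partial i f x = frechet_derivative f (at x) (axis i 1)"

text \<open>A derivative of order \<open>m\<close> is indexed by the list, of length \<open>m\<close>, of the successive directions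
  of differentiation. On \<open>C\<^sup>m\<close> functions the order is immaterial, so that this is the derivative
  \<open>\<partial>\<^sup>\<kappa>\<close> where the multi-index \<open>\<kappa>\<close> counts the occurrences of each direction in the list.\<close>

primrec partials :: "'n::finite list \<Rightarrow> (real ^ 'n \<Rightarrow> real) \<Rightarrow> real ^ 'n \<Rightarrow> real" where
  "partials [] f = f"
| "partials (k # ks) f = partial k (partials ks f)"

definition grad :: "(real ^ 'n::finite \<Rightarrow> real) \<Rightarrow> real ^ 'n \<Rightarrow> real ^ 'n" where
  "grad f x = (\<chi> i. partial i f x)"

definition sup_norm :: "('a \<Rightarrow> real) \<Rightarrow> real" where
  "sup_norm f = (SUP x. \<bar>f x\<bar>)"

definition Cb :: "nat \<Rightarrow> (real ^ 'n::finite \<Rightarrow> real) set" where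
  "Cb n = {f. (\<forall>ks. length ks < n \<longrightarrow> partials ks f differentiable_on UNIV) \<and>
              (\<forall>ks. length ks \<le> n \<longrightarrow>
                 continuous_on UNIV (partials ks f) \<and> bounded (range (partials ks f)))}"

text \<open>Real-valued suprema are only meaningful when finite: \<open>Cb_norm n\<close> is the norm on \<^term>\<open>Cb n\<close>.\<close>

definition Cb_norm :: "nat \<Rightarrow> (real ^ 'n::finite \<Rightarrow> real) \<Rightarrow> real" where
  "Cb_norm n f = (\<Sum>j\<le>n. Max ((\<lambda>ks. sup_norm (partials ks f)) ` {ks. length ks = j}))"

definition Cb_infinity :: "(real ^ 'n::finite \<Rightarrow> real) set" where
  "Cb_infinity = (\<Inter>n. Cb n)"

definition holder_bounded :: "real \<Rightarrow> (real ^ 'n::finite \<Rightarrow> real) \<Rightarrow> bool" where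
  "holder_bounded \<theta> f \<longleftrightarrow>
     bdd_above ((\<lambda>(x, h). \<bar>f (x + h) - f x\<bar> / norm h powr \<theta>) ` (UNIV \<times> (- {0})))"

definition Cb_holder :: "real \<Rightarrow> (real ^ 'n::finite \<Rightarrow> real) set" where
  "Cb_holder \<gamma> =
     {f \<in> Cb (nat \<lfloor>\<gamma>\<rfloor>). \<forall>ks. length ks = nat \<lfloor>\<gamma>\<rfloor> \<longrightarrow> holder_bounded (frac \<gamma>) (partials ks f)}"

text \<open>The tensor \<open>D\<^sup>m f x\<close> is the family of all \<open>partials ks f x\<close> with \<open>length ks = m\<close>, measured
  in the Euclidean norm; for \<open>m = 1\<close> this is \<open>norm (grad f x)\<close>. As for \<^const>\<open>Cb_norm\<close>, the two suprema
  below are meaningful only for functions on which they are finite.\<close>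

definition tensor_sup_norm :: "nat \<Rightarrow> (real ^ 'n::finite \<Rightarrow> real) \<Rightarrow> real" where
  "tensor_sup_norm m f = (SUP x. L2_set (\<lambda>ks. partials ks f x) {ks. length ks = m})"

definition tensor_holder_seminorm :: "nat \<Rightarrow> real \<Rightarrow> (real ^ 'n::finite \<Rightarrow> real) \<Rightarrow> real" where
  "tensor_holder_seminorm m \<theta> f =
     (SUP (x, h) \<in> UNIV \<times> (- {0}).
        L2_set (\<lambda>ks. partials ks f (x + h) - partials ks f x) {ks. length ks = m} / norm h powr \<theta>)"

definition C_Cb :: "real \<Rightarrow> nat \<Rightarrow> (real \<Rightarrow> real ^ 'n::finite \<Rightarrow> real) set" where
  "C_Cb T n = {u. (\<forall>t\<in>{0<..T}. u t \<in> Cb n) \<and>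
     (\<forall>t\<in>{0<..T}. ((\<lambda>s. Cb_norm n (\<lambda>x. u s x - u t x)) \<longlongrightarrow> 0) (at t within {0<..T}))}"

definition Cb_Cb :: "real \<Rightarrow> nat \<Rightarrow> (real \<Rightarrow> real ^ 'n::finite \<Rightarrow> real) set" where
  "Cb_Cb T n = {u \<in> C_Cb T n. bounded ((\<lambda>t. Cb_norm n (u t)) ` {0<..T})}"

section \<open>Levy operators, heat kernels and mild solutions\<close>

definition nonneg_symmetric :: "real ^ 'n ^ 'n::finite \<Rightarrow> bool" where
  "nonneg_symmetric A \<longleftrightarrow> transpose A = A \<and> (\<forall>x. 0 \<le> x \<bullet> (A *v x))"

definition levy_measure :: "(real ^ 'n::finite) measure \<Rightarrow> bool" where
  "levy_measure \<mu> \<longleftrightarrow> sets \<mu> = sets (restrict_space borel (- {0})) \<and>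
     (\<integral>\<^sup>+ z. ennreal (min 1 ((norm z)\<^sup>2)) \<partial>\<mu>) < \<infinity>"

definition levy_operator ::
  "real ^ 'n ^ 'n::finite \<Rightarrow> (real ^ 'n) measure \<Rightarrow> (real ^ 'n \<Rightarrow> real) \<Rightarrow> real ^ 'n \<Rightarrow> real" where
  "levy_operator A \<mu> \<phi> x =
     (\<Sum>i\<in>UNIV. partial i (\<lambda>y. (A *v grad \<phi> y) $ i) x) +
     (\<integral>z. \<phi> (x + z) - \<phi> x - indicator (ball 0 1) z * (grad \<phi> x \<bullet> z) \<partial>\<mu>)"

text \<open>\<open>L\<close> is the Levy operator with triplet \<open>(A, 0, \<mu>)\<close>; its formula makes sense on \<open>C\<^sub>b\<^sup>2\<close>.\<close>

definition has_levy_triplet ::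
  "((real ^ 'n \<Rightarrow> real) \<Rightarrow> real ^ 'n \<Rightarrow> real) \<Rightarrow> real ^ 'n ^ 'n::finite \<Rightarrow> (real ^ 'n) measure \<Rightarrow> bool" where
  "has_levy_triplet L A \<mu> \<longleftrightarrow> nonneg_symmetric A \<and> levy_measure \<mu> \<and>
     (\<forall>\<phi>\<in>Cb 2. \<forall>x. L \<phi> x = levy_operator A \<mu> \<phi> x)"

definition levy_symbol ::
  "real ^ 'n ^ 'n::finite \<Rightarrow> (real ^ 'n) measure \<Rightarrow> real ^ 'n \<Rightarrow> complex" where
  "levy_symbol A \<mu> \<xi> = of_real (\<xi> \<bullet> (A *v \<xi>)) +
     (\<integral>z. 1 - exp (\<i> * of_real (\<xi> \<bullet> z)) +
          \<i> * of_real (\<xi> \<bullet> z) * of_real (indicator (ball 0 1) z) \<partial>\<mu>)"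

definition heat_kernel ::
  "real ^ 'n ^ 'n::finite \<Rightarrow> (real ^ 'n) measure \<Rightarrow> (real \<Rightarrow> real ^ 'n \<Rightarrow> real) \<Rightarrow> bool" where
  "heat_kernel A \<mu> p \<longleftrightarrow> (\<forall>t>0.
     p t \<in> borel_measurable borel \<and> (\<forall>x. 0 \<le> p t x) \<and>
     emeasure (density lborel (\<lambda>x. ennreal (p t x))) UNIV = 1 \<and>
     (\<forall>\<xi>. (\<integral>x. exp (- \<i> * of_real (\<xi> \<bullet> x)) \<partial>density lborel (\<lambda>x. ennreal (p t x)))
          = exp (- of_real t * levy_symbol A \<mu> \<xi>)))"

definition semigroup_op ::
  "(real \<Rightarrow> real ^ 'n::finite \<Rightarrow> real) \<Rightarrow> real \<Rightarrow> (real ^ 'n \<Rightarrow> real) \<Rightarrow> real ^ 'n \<Rightarrow> real" where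
  "semigroup_op p t \<phi> x = (\<integral>y. p t (x - y) * \<phi> y \<partial>lborel)"

text \<open>Mild solutions of \<open>\<partial>\<^sub>t u - L u - H(t, x, Du) = 0\<close> in \<open>(0, T] \<times> \<real>\<^sup>d\<close>, \<open>u(0) = u\<^sub>0\<close>. The operator and
  the initial condition enter only through the heat kernel and the representation formula. Existence of
  the time integral is part of the formula and has to be stated, as \<open>LINT\<close> is total.\<close>

definition mild_solution ::
  "(real \<Rightarrow> real ^ 'n::finite \<Rightarrow> real) \<Rightarrow> (real \<Rightarrow> real ^ 'n \<Rightarrow> real ^ 'n \<Rightarrow> real) \<Rightarrow> real \<Rightarrow>
   (real ^ 'n \<Rightarrow> real) \<Rightarrow> (real \<Rightarrow> real ^ 'n \<Rightarrow> real) \<Rightarrow> bool" where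
  "mild_solution p H T u\<^sub>0 u \<longleftrightarrow> u \<in> C_Cb T 1 \<and>
     (\<forall>t\<in>{0<..T}. \<forall>x.
        set_integrable lborel {0<..<t}
          (\<lambda>s. semigroup_op p (t - s) (\<lambda>y. H s y (grad (u s) y)) x) \<and>
        u t x = semigroup_op p t u\<^sub>0 x +
          (LINT s:{0<..<t}|lborel. semigroup_op p (t - s) (\<lambda>y. H s y (grad (u s) y)) x))"

end

theory Submission
  imports Defs "HOL-Probability.Characteristic_Functions"
begin

text \<open>Write \<open>P\<^sub>t \<phi> = p\<^sub>t * \<phi>\<close>, \<open>f(s) = H(s, \<cdot>, Du(s, \<cdot>))\<close> and \<open>\<gamma> = \<alpha> + \<beta>\<close>. The mild formula reads
  \<open>u(t) = P\<^sub>t u\<^sub>0 + \<integral>\<^sub>0\<^sup>t P\<^sub>t\<^sub>-\<^sub>s f(s) ds\<close>, so the regularity of \<open>u(t)\<close> is decided by how many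
  derivatives of \<open>P\<^sub>t\<^sub>-\<^sub>s f(s)\<close> cost no more than an integrable power of \<open>t - s\<close>.

  \<^bold>\<open>Smoothing.\<close> The hypothesis says that one derivative of \<open>P\<^sub>\<tau> g\<close> costs \<open>\<tau> powr (-1/\<alpha>)\<close> for
  bounded \<open>g\<close>. A continuous integrable function is determined by its Fourier transform, hence
  \<open>p\<^sub>s\<^sub>+\<^sub>t = p\<^sub>s * p\<^sub>t\<close>; splitting \<open>P\<^sub>\<tau>\<close> into equal time steps, \<open>k\<close> derivatives cost \<open>\<tau> powr
  (-k/\<alpha>)\<close> (\<open>abs_partials_P_le\<close>). If \<open>g\<close> is Hoelder continuous of exponent \<open>\<theta>\<close>, write it as a
  Lipschitz function, on which the first derivative is free, plus a small remainder. With the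
  scale \<open>\<tau> powr (1/\<alpha>)\<close> for this splitting, \<open>k\<close> derivatives cost only \<open>\<tau> powr (-(k - \<theta>)/\<alpha>)\<close>
  (\<open>abs_partials_P_hoelder_le\<close>).

  \<^bold>\<open>The source is Hoelder continuous.\<close> The regularity of \<open>f(s)\<close> in space is limited by that of \<open>Du(s)\<close>, about
  which only boundedness is known. For a fixed shift \<open>h\<close> put \<open>w(t) = sup\<^sub>x |Du(t, x + h) - Du(t,
  x)|\<close>. Since translations commute with \<open>P\<close>, differentiating the mild formula once gives \<open>w(t) \<le> C
  |h|\<^sup>\<beta> t powr (-\<beta>/\<alpha>) + C \<integral>\<^sub>0\<^sup>t (t - s) powr (-1/\<alpha>) (|h|\<^sup>\<beta> + w(s)) ds\<close>, and a Gronwall argument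
  for this weakly singular kernel yields \<open>w(t) \<le> C |h|\<^sup>\<beta> t powr (-\<beta>/\<alpha>)\<close> (\<open>gradient_hoelder\<close>).
  Hence \<open>f(s)\<close> has a \<open>\<beta>\<close>-Hoelder seminorm of size \<open>s powr (-\<beta>/\<alpha>)\<close>.

  \<^bold>\<open>The highest derivatives.\<close> Let \<open>m = \<lfloor>\<gamma>\<rfloor>\<close>. Derivatives of order \<open>m\<close> of \<open>P\<^sub>t\<^sub>-\<^sub>s f(s)\<close> are of
  size \<open>s powr (-\<beta>/\<alpha>) (t - s) powr (-(m - \<beta>)/\<alpha>)\<close>, which is integrable because \<open>m < \<gamma>\<close>; so they may
  be taken under the integral, which gives the bound on \<open>D\<^sup>2u\<close> when \<open>m = 2\<close>. Their increments over
  \<open>h\<close> are also at most \<open>|h| s powr (-\<beta>/\<alpha>) (t - s) powr (-(m + 1 - \<beta>)/\<alpha>)\<close>, a power that is not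
  integrable because \<open>\<gamma> < m + 1\<close>. Using the first bound where \<open>t - s < |h|\<^sup>\<alpha>\<close> and the second one
  elsewhere produces exactly \<open>|h| powr (\<gamma> - m)\<close> (\<open>critical_integral_le\<close>). This is where \<open>\<gamma> \<notin> \<nat>\<close>
  enters. The term \<open>P\<^sub>t u\<^sub>0\<close>, with \<open>u\<^sub>0\<close> Lipschitz, accounts for the rates in \<open>t\<close>: \<open>m - 1 + (\<gamma> -
  m) = \<gamma> - 1\<close> derivatives beyond the first one.\<close>

section \<open>Partial derivatives and differentiation under the integral sign\<close>

lemma partial_has_derivative:
  assumes "(f has_derivative D) (at x)"
  shows "partial i f x = D (axis i 1)"
  using frechet_derivative_at[OF assms] by (simp add: partial_def)

lemma has_derivative_grad:
  assumes "f differentiable (at x)"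
  shows "(f has_derivative (\<lambda>h. grad f x \<bullet> h)) (at x)"
proof -
  obtain D where D: "(f has_derivative D) (at x)"
    using assms by (auto simp: differentiable_def)
  interpret D: bounded_linear D using D by (rule has_derivative_bounded_linear)
  have "D h = grad f x \<bullet> h" for h
  proof -
    have "D h = D (\<Sum>i\<in>UNIV. h $ i *\<^sub>R axis i 1)"
      by (simp flip: vector_space_over_itself.scale_scale add: basis_expansion
          scalar_mult_eq_scaleR[symmetric])
    also have "\<dots> = (\<Sum>i\<in>UNIV. h $ i * partial i f x)"
      by (simp add: D.sum D.scale partial_has_derivative[OF D])
    also have "\<dots> = grad f x \<bullet> h" by (simp add: grad_def inner_vec_def mult.commute)
    finally show ?thesis .
  qed
  then have "D = (\<lambda>h. grad f x \<bullet> h)" by auto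
  with D show ?thesis by simp
qed

lemma partial_eq_grad: "partial i f x = grad f x \<bullet> axis i 1"
  by (simp add: grad_def inner_axis)

lemma abs_partial_le_norm_grad: "\<bar>partial i f x\<bar> \<le> norm (grad f x)"
  using component_le_norm_cart[of "grad f x" i] by (simp add: grad_def)

lemma norm_grad_le:
  fixes f :: "real ^ 'n \<Rightarrow> real" and B :: real
  assumes "\<And>i. \<bar>partial i f x\<bar> \<le> B"
  shows "norm (grad f x) \<le> CARD('n) * B"
proof -
  have "norm (grad f x) \<le> (\<Sum>i\<in>UNIV. \<bar>grad f x $ i\<bar>)" by (rule norm_le_l1_cart)
  also have "\<dots> \<le> (\<Sum>i\<in>(UNIV::'n set). B)"
    by (intro sum_mono) (simp add: grad_def assms)
  finally show ?thesis by simp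
qed


lemma tendsto_partial:
  assumes "f differentiable (at x)"
  shows "((\<lambda>r. (f (x + r *\<^sub>R axis i 1) - f x) / r) \<longlongrightarrow> partial i f x) (at 0)"
proof -
  have "((\<lambda>r. f (x + r *\<^sub>R axis i 1)) has_derivative (\<lambda>r. grad f x \<bullet> (r *\<^sub>R axis i 1))) (at 0)"
    by (rule has_derivative_compose[where g=f])
       (auto intro!: derivative_eq_intros has_derivative_grad assms)
  then have "((\<lambda>r. f (x + r *\<^sub>R axis i 1)) has_real_derivative partial i f x) (at 0)"
    by (simp add: has_field_derivative_def partial_eq_grad mult_commute_abs)
  then show ?thesis by (simp add: has_field_derivative_iff)
qed

lemma abs_partial_le_lipschitz:
  assumes "f differentiable (at x)" and lip: "\<And>y z. \<bar>f y - f z\<bar> \<le> K * norm (y - z)"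
  shows "\<bar>partial i f x\<bar> \<le> K"
proof (rule tendsto_upperbound[OF tendsto_rabs[OF tendsto_partial[OF assms(1)]]])
  show "\<forall>\<^sub>F r in at 0. \<bar>(f (x + r *\<^sub>R axis i 1) - f x) / r\<bar> \<le> K"
  proof (rule eventually_mono[OF eventually_at_ball'[of 1]])
    fix r :: real assume "r \<in> ball 0 1 \<and> r \<noteq> 0 \<and> r \<in> UNIV"
    then show "\<bar>(f (x + r *\<^sub>R axis i 1) - f x) / r\<bar> \<le> K"
      using lip[of "x + r *\<^sub>R axis i 1" x] by (simp add: field_simps)
  qed simp
qed simp

lemma borel_measurable_partial:
  assumes f: "\<And>x. f differentiable (at x)"
  shows "partial i f \<in> borel_measurable borel"
proof (rule borel_measurable_LIMSEQ_real)
  have cont: "continuous_on UNIV f"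
    using f by (auto intro!: continuous_at_imp_continuous_on differentiable_imp_continuous_within)
  show "(\<lambda>x. (f (x + inverse (real (Suc n)) *\<^sub>R axis i 1) - f x) / inverse (real (Suc n)))
      \<in> borel_measurable borel" for n
    by (intro borel_measurable_continuous_onI continuous_intros continuous_on_compose2[OF cont]) auto
  fix x
  have "filterlim (\<lambda>n. inverse (real (Suc n))) (at 0) sequentially"
    by (rule filterlim_atI[OF LIMSEQ_inverse_real_of_nat]) auto
  from filterlim_compose[OF tendsto_partial[OF f] this, of x i]
  show "(\<lambda>n. (f (x + inverse (real (Suc n)) *\<^sub>R axis i 1) - f x) / inverse (real (Suc n)))
      \<longlonglongrightarrow> partial i f x" .
qed

lemma abs_diff_le_partial_bound:
  fixes f :: "real ^ 'n \<Rightarrow> real" and B :: real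
  assumes f: "\<And>x. f differentiable (at x)" and B: "\<And>i x. \<bar>partial i f x\<bar> \<le> B"
  shows "\<bar>f x - f y\<bar> \<le> CARD('n) * B * norm (x - y)"
proof -
  have "norm (f x - f y) \<le> CARD('n) * B * norm (x - y)"
  proof (rule differentiable_bound[of UNIV f "\<lambda>z h. grad f z \<bullet> h"])
    fix z
    show "(f has_derivative (\<lambda>h. grad f z \<bullet> h)) (at z within UNIV)"
      using has_derivative_grad[OF f] by simp
    show "onorm (\<lambda>h. grad f z \<bullet> h) \<le> CARD('n) * B"
    proof (rule onorm_bound)
      have "0 \<le> B" using B[of undefined z] by linarith
      then show "0 \<le> CARD('n) * B" by simp
      show "norm (grad f z \<bullet> h) \<le> CARD('n) * B * norm h" for h
        using Cauchy_Schwarz_ineq2[of "grad f z" h]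
          mult_right_mono[OF norm_grad_le[of f z B, OF B], of "norm h"] by simp
    qed
  qed auto
  then show ?thesis by simp
qed

text \<open>The derivative of an integral over a parameter, from dominated convergence applied to the
  first-order Taylor remainders; by the mean value inequality a uniform bound on the partial
  derivatives dominates them. Measurability of the derivatives in the parameter is inherited from
  the difference quotients, so that measurability of \<open>g\<close> in the parameter for each fixed point
  suffices.\<close>

lemma has_derivative_integral_dominated:
  fixes g :: "'b \<Rightarrow> real ^ 'n \<Rightarrow> real" and B :: "'b \<Rightarrow> real"
  assumes int: "\<And>x. integrable M (\<lambda>s. g s x)"
    and diff: "\<And>s x. s \<in> space M \<Longrightarrow> g s differentiable (at x)"
    and bound: "\<And>s i x. s \<in> space M \<Longrightarrow> \<bar>partial i (g s) x\<bar> \<le> B s"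
    and B: "integrable M B"
  shows integrable_partial: "integrable M (\<lambda>s. partial i (g s) x)"
    and has_derivative_integral:
      "((\<lambda>x. \<integral>s. g s x \<partial>M) has_derivative (\<lambda>h. (\<chi> i. \<integral>s. partial i (g s) x \<partial>M) \<bullet> h)) (at x)"
    and partial_integral: "partial i (\<lambda>x. \<integral>s. g s x \<partial>M) x = (\<integral>s. partial i (g s) x \<partial>M)"
proof -
  have meas: "(\<lambda>s. partial i (g s) x) \<in> borel_measurable M" for i x
  proof (rule borel_measurable_LIMSEQ_real)
    show "(\<lambda>s. (g s (x + inverse (real (Suc n)) *\<^sub>R axis i 1) - g s x) / inverse (real (Suc n)))
        \<in> borel_measurable M" for n
      using int by (intro borel_measurable_divide borel_measurable_diff) auto
    fix s assume s: "s \<in> space M"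
    have "filterlim (\<lambda>n. inverse (real (Suc n))) (at 0) sequentially"
      by (rule filterlim_atI[OF LIMSEQ_inverse_real_of_nat]) auto
    from filterlim_compose[OF tendsto_partial[OF diff[OF s]] this, of x i]
    show "(\<lambda>n. (g s (x + inverse (real (Suc n)) *\<^sub>R axis i 1) - g s x) / inverse (real (Suc n)))
        \<longlonglongrightarrow> partial i (g s) x" .
  qed
  show int': "integrable M (\<lambda>s. partial i (g s) x)" for i x
    by (rule Bochner_Integration.integrable_bound[OF B meas]) (use bound in \<open>auto intro!: AE_I2
        order_trans[OF _ abs_ge_self]\<close>)
  have int_inner: "integrable M (\<lambda>s. grad (g s) x \<bullet> h)" for h
    unfolding grad_def inner_vec_def using int' by (auto intro!: Bochner_Integration.integrable_sum)
  have inner: "(\<chi> i. \<integral>s. partial i (g s) x \<partial>M) \<bullet> h = (\<integral>s. grad (g s) x \<bullet> h \<partial>M)" for h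
    unfolding grad_def inner_vec_def using int' by (simp add: Bochner_Integration.integral_sum)
  show deriv: "((\<lambda>x. \<integral>s. g s x \<partial>M) has_derivative (\<lambda>h. (\<chi> i. \<integral>s. partial i (g s) x \<partial>M) \<bullet> h)) (at x)"
    unfolding has_derivative_at2
  proof (intro conjI bounded_linear_inner_right)
    let ?q = "\<lambda>s y. (1 / norm (y - x)) * (g s y - (g s x + grad (g s) x \<bullet> (y - x)))"
    have "((\<lambda>y. \<integral>s. ?q s y \<partial>M) \<longlongrightarrow> 0) (at x)"
      unfolding tendsto_at_iff_sequentially comp_def
    proof (intro allI impI)
      fix X assume X: "\<forall>n. X n \<in> UNIV - {x}" "X \<longlonglongrightarrow> x"
      have "(\<lambda>n. \<integral>s. ?q s (X n) \<partial>M) \<longlonglongrightarrow> (\<integral>s. 0 \<partial>M)"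
      proof (rule integral_dominated_convergence[where w = "\<lambda>s. 2 * (CARD('n) * B s)"])
        show "integrable M (\<lambda>s. 2 * (CARD('n) * B s))" using B by simp
        show "(\<lambda>s. ?q s (X n)) \<in> borel_measurable M" for n
          using int int_inner by (intro borel_measurable_times borel_measurable_diff
              borel_measurable_add) auto
        show "AE s in M. (\<lambda>n. ?q s (X n)) \<longlonglongrightarrow> 0"
        proof (rule AE_I2)
          fix s assume "s \<in> space M"
          then have "((\<lambda>y. ?q s y) \<longlongrightarrow> 0) (at x)"
            using has_derivative_grad[OF diff, of s x] by (simp add: has_derivative_at2)
          then show "(\<lambda>n. ?q s (X n)) \<longlonglongrightarrow> 0"
            using X by (simp add: tendsto_at_iff_sequentially comp_def)
        qed
        show "AE s in M. norm (?q s (X n)) \<le> 2 * (CARD('n) * B s)" for n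
        proof (rule AE_I2)
          fix s assume s: "s \<in> space M"
          let ?K = "CARD('n) * B s"
          have "\<bar>g s (X n) - g s x\<bar> \<le> ?K * norm (X n - x)"
            by (rule abs_diff_le_partial_bound) (use s diff bound in auto)
          moreover have "\<bar>grad (g s) x \<bullet> (X n - x)\<bar> \<le> ?K * norm (X n - x)"
            using Cauchy_Schwarz_ineq2[of "grad (g s) x" "X n - x"]
              mult_right_mono[OF norm_grad_le[of "g s" x "B s"], of "norm (X n - x)"] bound[OF s]
                  by simp
          ultimately have "\<bar>g s (X n) - (g s x + grad (g s) x \<bullet> (X n - x))\<bar> \<le> 2 * ?K * norm (X n - x)"
            by linarith
          moreover have "norm (X n - x) > 0" using X(1) by auto
          ultimately show "norm (?q s (X n)) \<le> 2 * ?K"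
            by (simp add: abs_mult divide_le_eq)
        qed
      qed simp
      then show "(\<lambda>n. \<integral>s. ?q s (X n) \<partial>M) \<longlonglongrightarrow> 0" by simp
    qed
    moreover have "(\<integral>s. ?q s y \<partial>M) = (1 / norm (y - x)) *\<^sub>R ((\<integral>s. g s y \<partial>M)
        - ((\<integral>s. g s x \<partial>M) + (\<chi> i. \<integral>s. partial i (g s) x \<partial>M) \<bullet> (y - x)))" for y
      unfolding inner using int int_inner
      by (subst integral_mult_right_zero) (simp add: Bochner_Integration.integral_add
          Bochner_Integration.integral_diff)
    ultimately show "((\<lambda>y. (1 / norm (y - x)) *\<^sub>R ((\<integral>s. g s y \<partial>M)
        - ((\<integral>s. g s x \<partial>M) + (\<chi> i. \<integral>s. partial i (g s) x \<partial>M) \<bullet> (y - x)))) \<longlongrightarrow> 0) (at x)"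
      by (simp only:)
  qed
  show "partial i (\<lambda>x. \<integral>s. g s x \<partial>M) x = (\<integral>s. partial i (g s) x \<partial>M)"
    using partial_has_derivative[OF deriv, of i] by (simp add: inner_axis)
qed

lemma partial_add:
  assumes "f differentiable (at x)" "g differentiable (at x)"
  shows "partial i (\<lambda>y. f y + g y) x = partial i f x + partial i g x"
  using partial_has_derivative[OF has_derivative_add[OF has_derivative_grad[OF assms(1)]
    has_derivative_grad[OF assms(2)]], of i]
  by (simp add: partial_eq_grad)

lemma partial_shift:
  assumes "f differentiable (at (x + h))"
  shows "partial i (\<lambda>y. f (y + h)) x = partial i f (x + h)"
proof -
  have "((\<lambda>y. f (y + h)) has_derivative (\<lambda>k. grad f (x + h) \<bullet> k)) (at x)"
    by (rule has_derivative_compose[where g=f])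
       (auto intro!: derivative_eq_intros has_derivative_grad assms)
  from partial_has_derivative[OF this] show ?thesis by (simp add: partial_eq_grad)
qed

text \<open>The differentiability that is part of \<^const>\<open>Cb\<close>, separated from the bounds and the continuity of
  the highest derivatives. This much makes derivatives up to order \<open>n\<close> additive and passes through
  integrals; continuity at order \<open>n\<close> comes last, from a Hoelder estimate.\<close>

definition diff_upto :: "nat \<Rightarrow> (real ^ 'n::finite \<Rightarrow> real) \<Rightarrow> bool" where
  "diff_upto n f \<longleftrightarrow> (\<forall>ks x. length ks < n \<longrightarrow> partials ks f differentiable (at x))"

lemma diff_uptoD: "diff_upto n f \<Longrightarrow> length ks < n \<Longrightarrow> partials ks f differentiable (at x)"
  by (simp add: diff_upto_def)

lemma partials_append: "partials (ks @ js) f = partials ks (partials js f)"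
  by (induction ks) simp_all

lemma partials_add:
  assumes "diff_upto n f" "diff_upto n g" "length ks \<le> n"
  shows "partials ks (\<lambda>y. f y + g y) = (\<lambda>y. partials ks f y + partials ks g y)"
  using assms(3)
proof (induction ks)
  case (Cons k ks)
  then have "partials ks (\<lambda>y. f y + g y) = (\<lambda>y. partials ks f y + partials ks g y)" "length ks < n"
    by simp_all
  then show ?case
    using partial_add[OF diff_uptoD[OF assms(1)] diff_uptoD[OF assms(2)], of ks ks] by auto
qed simp

lemma diff_upto_add:
  assumes "diff_upto n f" "diff_upto n g"
  shows "diff_upto n (\<lambda>y. f y + g y)"
  unfolding diff_upto_def
proof (intro allI impI)
  fix ks :: "'a list" and x assume "length ks < n"
  then show "partials ks (\<lambda>y. f y + g y) differentiable (at x)"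
    using partials_add[OF assms, of ks]
    by (auto intro!: differentiable_add diff_uptoD[OF assms(1)] diff_uptoD[OF assms(2)])
qed

text \<open>Iterated differentiation under the integral sign: the integrands may be differentiated as
  often as each order has its own integrable majorant.\<close>

lemma partials_under_integral:
  fixes g :: "'b \<Rightarrow> real ^ 'n::finite \<Rightarrow> real"
  assumes int: "\<And>x. integrable M (\<lambda>s. g s x)"
    and diff: "\<And>s. s \<in> space M \<Longrightarrow> diff_upto m (g s)"
    and bound: "\<And>s ks x. s \<in> space M \<Longrightarrow> 1 \<le> length ks \<Longrightarrow> length ks \<le> m \<Longrightarrow> \<bar>partials ks (g s) x\<bar> \<le>
        B (length ks) s"
    and B: "\<And>k. 1 \<le> k \<Longrightarrow> k \<le> m \<Longrightarrow> integrable M (B k)"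
  shows "length ks \<le> m \<Longrightarrow> (\<forall>x. integrable M (\<lambda>s. partials ks (g s) x)) \<and> 
    partials ks (\<lambda>x. \<integral>s. g s x \<partial>M) = (\<lambda>x. \<integral>s. partials ks (g s) x \<partial>M)"
    and "length ks < m \<Longrightarrow> (\<lambda>x. \<integral>s. partials ks (g s) x \<partial>M) differentiable (at x)"
proof -
  have step: "(\<forall>x. integrable M (\<lambda>s. partials ks (g s) x)) \<Longrightarrow> length ks < m \<Longrightarrow>
      integrable M (\<lambda>s. partial i (partials ks (g s)) x) \<and>
      partial i (\<lambda>x. \<integral>s. partials ks (g s) x \<partial>M) x = (\<integral>s. partial i (partials ks (g s)) x \<partial>M) \<and>
      (\<lambda>x. \<integral>s. partials ks (g s) x \<partial>M) differentiable (at x)" for ks i x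
    using has_derivative_integral_dominated[of M "\<lambda>s. partials ks (g s)" "B (Suc (length ks))"]
      bound[of _ "_ # ks"] B[of "Suc (length ks)"] diff
    unfolding differentiable_def diff_upto_def by simp blast
  show *: "length ks \<le> m \<Longrightarrow> (\<forall>x. integrable M (\<lambda>s. partials ks (g s) x)) \<and> 
    partials ks (\<lambda>x. \<integral>s. g s x \<partial>M) = (\<lambda>x. \<integral>s. partials ks (g s) x \<partial>M)" for ks
  proof (induction ks)
    case Nil
    then show ?case using int by simp
  next
    case (Cons k ks)
    then have "partials ks (\<lambda>x. \<integral>s. g s x \<partial>M) = (\<lambda>x. \<integral>s. partials ks (g s) x \<partial>M)" by simp
    with Cons show ?case using step[of ks k] by auto
  qed
  show "length ks < m \<Longrightarrow> (\<lambda>x. \<integral>s. partials ks (g s) x \<partial>M) differentiable (at x)"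
    using step[of ks] *[of ks] by simp
qed

section \<open>Fourier uniqueness and the Chapman-Kolmogorov equation\<close>

lemma lborel_distr_reflect:
  fixes x :: "'a::euclidean_space"
  shows "distr lborel borel (\<lambda>y. x - y) = lborel"
  by (subst (2) lborel_affine[of "-1" x]) (auto simp: density_1)

lemma integral_lborel_reflect:
  fixes F :: "'a::euclidean_space \<Rightarrow> 'b::{banach, second_countable_topology}"
  assumes [measurable]: "F \<in> borel_measurable borel"
  shows "(\<integral>y. F (x - y) \<partial>lborel) = (\<integral>y. F y \<partial>lborel)"
  by (subst (2) lborel_distr_reflect[of x, symmetric], subst integral_distr) auto

lemma integrable_lborel_reflect:
  fixes F :: "'a::euclidean_space \<Rightarrow> 'b::{banach, second_countable_topology}"
  assumes "integrable lborel F"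
  shows "integrable lborel (\<lambda>y. F (x - y))"
proof -
  have "F \<in> borel_measurable borel" using borel_measurable_integrable[OF assms] by simp
  then show ?thesis
    using assms by (subst (asm) lborel_distr_reflect[of x, symmetric], subst (asm) integrable_distr_eq)
        auto
qed

lemma integral_lborel_translate:
  fixes F :: "'a::euclidean_space \<Rightarrow> 'b::{banach, second_countable_topology}"
  assumes [measurable]: "F \<in> borel_measurable borel"
  shows "(\<integral>y. F (y - x) \<partial>lborel) = (\<integral>y. F y \<partial>lborel)"
  by (subst (2) lborel_distr_plus[of "-x", symmetric], subst integral_distr) (auto simp: algebra_simps)

lemma integrable_lborel_translate:
  fixes F :: "'a::euclidean_space \<Rightarrow> 'b::{banach, second_countable_topology}"
  assumes "integrable lborel F"
  shows "integrable lborel (\<lambda>y. F (y - x))"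
proof -
  have "F \<in> borel_measurable borel" using borel_measurable_integrable[OF assms] by simp
  then show ?thesis
    using assms by (subst (asm) lborel_distr_plus[of "-x", symmetric], subst (asm) integrable_distr_eq)
      (auto simp: algebra_simps)
qed

lemma integral_lborel_scale_eq_0:
  fixes F :: "'a::euclidean_space \<Rightarrow> 'b::{banach, second_countable_topology}"
  assumes [measurable]: "F \<in> borel_measurable borel" and c: "c \<noteq> 0" and 0: "(\<integral>y. F y \<partial>lborel) = 0"
  shows "(\<integral>z. F (y + c *\<^sub>R z) \<partial>lborel) = 0"
proof -
  have "(\<integral>y. F y \<partial>lborel) = \<bar>c\<bar> ^ DIM('a) *\<^sub>R (\<integral>z. F (y + c *\<^sub>R z) \<partial>lborel)"
    by (subst lborel_affine[OF c, of y], subst integral_density)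
       (auto simp: integral_distr integral_scaleR_right)
  then show ?thesis using 0 c by simp
qed

text \<open>Lebesgue measure on a Euclidean space is the image of a product measure, so integrals of
  products of functions of the single coordinates factorise.\<close>

lemma lborel_prod_integral:
  fixes f :: "'a::euclidean_space \<Rightarrow> real \<Rightarrow> complex"
  assumes f: "\<And>b. b \<in> Basis \<Longrightarrow> integrable lborel (f b)"
  shows "integrable lborel (\<lambda>x. \<Prod>b\<in>Basis. f b (x \<bullet> b))"
    and "(\<integral>x. (\<Prod>b\<in>Basis. f b (x \<bullet> b)) \<partial>lborel) = (\<Prod>b\<in>Basis. \<integral>x. f b x \<partial>lborel)"
proof -
  interpret product_sigma_finite "\<lambda>_::'a. lborel :: real measure" by standard
  have [measurable]: "b \<in> Basis \<Longrightarrow> f b \<in> borel_measurable borel" for b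
    using borel_measurable_integrable[OF f] by simp
  have eq: "(\<Prod>b\<in>Basis. f b ((\<Sum>c\<in>Basis. g c *\<^sub>R c) \<bullet> b)) = (\<Prod>b\<in>Basis. f b (g b))" for g :: "'a \<Rightarrow> real"
    by (auto intro!: prod.cong)
  show "integrable lborel (\<lambda>x. \<Prod>b\<in>Basis. f b (x \<bullet> b))"
    by (subst lborel_eq, subst integrable_distr_eq) (auto simp: eq intro!: product_integrable_prod f)
  show "(\<integral>x. (\<Prod>b\<in>Basis. f b (x \<bullet> b)) \<partial>lborel) = (\<Prod>b\<in>Basis. \<integral>x. f b x \<partial>lborel)"
    by (subst lborel_eq, subst integral_distr) (auto simp: eq intro!: product_integral_prod f)
qed

definition gauss :: "'a::euclidean_space \<Rightarrow> real" where
  "gauss x = (\<Prod>b\<in>Basis. std_normal_density (x \<bullet> b))"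

lemma gauss_nonneg: "0 \<le> gauss x"
  by (simp add: gauss_def prod_nonneg)

lemma borel_measurable_gauss [measurable]: "gauss \<in> borel_measurable borel"
  unfolding gauss_def by measurable

lemma
  shows integrable_gauss: "integrable lborel (gauss :: 'a::euclidean_space \<Rightarrow> real)"
    and integral_gauss: "(\<integral>x. gauss (x::'a) \<partial>lborel) = 1"
proof -
  have int: "integrable lborel (\<lambda>x. complex_of_real (std_normal_density x))"
    by (rule integrable_of_real) (rule integrable_normal_density, simp)
  have eq: "complex_of_real (gauss x) = (\<Prod>b\<in>Basis. of_real (std_normal_density (x \<bullet> b)))" for x :: 'a
    by (simp add: gauss_def)
  have "integrable lborel (\<lambda>x::'a. complex_of_real (gauss x))"
    unfolding eq using int by (rule lborel_prod_integral)
  then show "integrable lborel (gauss :: 'a \<Rightarrow> real)"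
    by (subst (asm) complex_of_real_integrable_eq)
  have "complex_of_real (\<integral>x. gauss (x::'a) \<partial>lborel) =
      (\<Prod>b\<in>(Basis::'a set). \<integral>x. complex_of_real (std_normal_density x) \<partial>lborel)"
    unfolding integral_complex_of_real[symmetric] eq using int by (rule lborel_prod_integral)
  also have "\<dots> = 1"
    by (simp add: integral_normal_density)
  finally show "(\<integral>x. gauss (x::'a) \<partial>lborel) = 1" by (metis of_real_eq_1_iff)
qed

text \<open>The standard Gaussian is a multiple of its own Fourier transform, because this holds in each
  coordinate.\<close>

lemma gauss_fourier:
  fixes x :: "'a::euclidean_space"
  shows "complex_of_real (gauss x) = (1 / sqrt (2 * pi)) ^ DIM('a) * 
    (\<integral>\<xi>. exp (\<i> * of_real (x \<bullet> \<xi>)) * of_real (gauss \<xi>) \<partial>lborel)"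
proof -
  have int: "integrable lborel (\<lambda>s. exp (\<i> * of_real (t * s)) * complex_of_real (std_normal_density s))"
      for t
    by (rule Bochner_Integration.integrable_bound[of _ std_normal_density]) 
       (auto intro!: integrable_normal_density simp: norm_mult)
  have 1: "(\<integral>s. exp (\<i> * of_real (t * s)) * complex_of_real (std_normal_density s) \<partial>lborel) =
      exp (- (t^2) / 2)" for t
    using fun_cong[OF char_std_normal_distribution, of t]
    unfolding char_def by (subst (asm) integral_density) (auto simp: scaleR_conv_of_real mult.commute)
  have eq: "exp (\<i> * of_real (x \<bullet> \<xi>)) * complex_of_real (gauss \<xi>) = 
     (\<Prod>b\<in>Basis. exp (\<i> * of_real ((x \<bullet> b) * (\<xi> \<bullet> b))) * complex_of_real (std_normal_density (\<xi> \<bullet> b)))"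
         for \<xi> :: 'a
    by (subst euclidean_inner) (simp add: gauss_def prod.distrib exp_sum sum_distrib_left)
  have "(\<integral>\<xi>. exp (\<i> * of_real (x \<bullet> \<xi>)) * complex_of_real (gauss \<xi>) \<partial>lborel) =
      (\<Prod>b\<in>Basis. complex_of_real (exp (- ((x \<bullet> b)^2) / 2)))"
    unfolding eq by (subst lborel_prod_integral(2)[OF int]) (simp only: 1)
  then show ?thesis
    by (simp add: gauss_def normal_density_def prod.distrib power_divide prod_dividef)
qed

text \<open>If the Fourier transform of \<open>q\<close> vanishes then so does every integral of \<open>q\<close> against a
  rescaled and translated Gaussian, since Gaussians are superpositions of characters. These
  integrals converge to \<open>q y\<close> when the Gaussians concentrate at \<open>y\<close>.\<close>

lemma fourier_uniqueness:
  fixes q :: "'a::euclidean_space \<Rightarrow> real"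
  assumes cont: "continuous_on UNIV q" and bdd: "\<And>x. \<bar>q x\<bar> \<le> C" and int: "integrable lborel q"
    and 0: "\<And>\<xi>. (\<integral>x. exp (- \<i> * of_real (\<xi> \<bullet> x)) * of_real (q x) \<partial>lborel) = 0"
  shows "q y = 0"
proof -
  have q_meas [measurable]: "q \<in> borel_measurable borel"
    using borel_measurable_integrable[OF int] by simp
  have zero: "(\<integral>x. gauss (c *\<^sub>R (x - y)) * q x \<partial>lborel) = 0" for c :: real
  proof -
    let ?F = "\<lambda>x \<xi>::'a. exp (\<i> * of_real (c *\<^sub>R (x - y) \<bullet> \<xi>)) * of_real (gauss \<xi>) * complex_of_real (q
        x)"
    have "integrable (lborel \<Otimes>\<^sub>M lborel) (\<lambda>(x, \<xi>). ?F x \<xi>)"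
    proof (rule lborel_pair.Fubini_integrable)
      show "(\<lambda>(x, \<xi>). ?F x \<xi>) \<in> borel_measurable (lborel \<Otimes>\<^sub>M lborel)" by measurable
      show "integrable lborel (\<lambda>x. \<integral>\<xi>. norm (case (x, \<xi>) of (x, \<xi>) \<Rightarrow> ?F x \<xi>) \<partial>lborel)"
        using int by (simp add: norm_mult gauss_nonneg integral_gauss)
      show "AE x in lborel. integrable lborel (\<lambda>\<xi>. case (x, \<xi>) of (x, \<xi>) \<Rightarrow> ?F x \<xi>)"
      proof (rule AE_I2)
        fix x
        show "integrable lborel (\<lambda>\<xi>. case (x, \<xi>) of (x, \<xi>) \<Rightarrow> ?F x \<xi>)"
          by (rule Bochner_Integration.integrable_bound[of _ "\<lambda>\<xi>. \<bar>q x\<bar> * gauss \<xi>"])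
             (auto simp: norm_mult gauss_nonneg integrable_gauss)
      qed
    qed
    then have swap: "(\<integral>\<xi>. \<integral>x. ?F x \<xi> \<partial>lborel \<partial>lborel) = (\<integral>x. \<integral>\<xi>. ?F x \<xi> \<partial>lborel \<partial>lborel)"
      by (rule lborel_pair.Fubini_integral)
    have "(\<integral>x. ?F x \<xi> \<partial>lborel) = 0" for \<xi>
    proof -
      have "?F x \<xi> = exp (- \<i> * of_real (c *\<^sub>R y \<bullet> \<xi>)) * of_real (gauss \<xi>) *
          (exp (- \<i> * of_real ((- c *\<^sub>R \<xi>) \<bullet> x)) * complex_of_real (q x))" for x
        by (simp add: mult_exp_exp algebra_simps inner_commute inner_diff_right)
      then show ?thesis by (simp only: integral_mult_right_zero 0 mult_zero_right)
    qed
    then have "0 = (1 / sqrt (2 * pi)) ^ DIM('a) * (\<integral>x. \<integral>\<xi>. ?F x \<xi> \<partial>lborel \<partial>lborel)"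
      using swap by simp
    \<comment> \<open>The Gaussian Fourier formula folds the inner integral back into a Gaussian.\<close>
    also have "\<dots> = (\<integral>x. complex_of_real (gauss (c *\<^sub>R (x - y)) * q x) \<partial>lborel)"
    proof (subst integral_mult_right_zero[symmetric], rule Bochner_Integration.integral_cong[OF refl])
      fix x
      show "(1 / sqrt (2 * pi)) ^ DIM('a) * (\<integral>\<xi>. ?F x \<xi> \<partial>lborel) =
          complex_of_real (gauss (c *\<^sub>R (x - y)) * q x)"
        unfolding of_real_mult gauss_fourier[of "c *\<^sub>R (x - y)"] by simp
    qed
    also have "\<dots> = of_real (\<integral>x. gauss (c *\<^sub>R (x - y)) * q x \<partial>lborel)" by (rule integral_complex_of_real)
    finally show ?thesis by simp
  qed
  have zero': "(\<integral>z. gauss z * q (y + inverse (real (Suc n)) *\<^sub>R z) \<partial>lborel) = 0" for n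
    using integral_lborel_scale_eq_0[OF _ _ zero[of "real (Suc n)"], of "inverse (real (Suc n))" y]
        by simp
  have "(\<lambda>n. \<integral>z. gauss z * q (y + inverse (real (Suc n)) *\<^sub>R z) \<partial>lborel) \<longlonglongrightarrow>
      (\<integral>z. gauss (z::'a) * q y \<partial>lborel)"
  proof (rule integral_dominated_convergence[where w = "\<lambda>z. C * gauss z"])
    show "integrable lborel (\<lambda>z::'a. C * gauss z)" using integrable_gauss[where 'a='a] by simp
    show "AE z in lborel. (\<lambda>n. gauss z * q (y + inverse (real (Suc n)) *\<^sub>R z)) \<longlonglongrightarrow> gauss z * q y"
    proof (rule AE_I2)
      fix z :: 'a
      have "(\<lambda>n. y + inverse (real (Suc n)) *\<^sub>R z) \<longlonglongrightarrow> y + 0 *\<^sub>R z"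
        by (rule tendsto_add[OF tendsto_const tendsto_scaleR[OF LIMSEQ_inverse_real_of_nat
            tendsto_const]])
      then have "(\<lambda>n. q (y + inverse (real (Suc n)) *\<^sub>R z)) \<longlonglongrightarrow> q y"
        using continuous_on_tendsto_compose[OF cont, of "\<lambda>n. y + inverse (real (Suc n)) *\<^sub>R z" y]
            by simp
      then show "(\<lambda>n. gauss z * q (y + inverse (real (Suc n)) *\<^sub>R z)) \<longlonglongrightarrow> gauss z * q y"
        by (rule tendsto_mult[OF tendsto_const])
    qed
    show "AE z in lborel. norm (gauss z * q (y + inverse (real (Suc n)) *\<^sub>R z)) \<le> C * gauss z" for n
    proof (rule AE_I2)
      fix z :: 'a
      show "norm (gauss z * q (y + inverse (real (Suc n)) *\<^sub>R z)) \<le> C * gauss z"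
        using mult_right_mono[OF bdd gauss_nonneg, of "y + inverse (real (Suc n)) *\<^sub>R z" z]
        by (simp add: abs_mult gauss_nonneg mult.commute)
    qed
    have "(\<lambda>z. q (y + inverse (real (Suc n)) *\<^sub>R z)) \<in> borel_measurable borel" for n
      by (intro borel_measurable_continuous_onI continuous_intros continuous_on_compose2[OF cont]) auto
    then show "(\<lambda>z. gauss z * q (y + inverse (real (Suc n)) *\<^sub>R z)) \<in> borel_measurable lborel" for n
      by simp
    show "(\<lambda>z::'a. gauss z * q y) \<in> borel_measurable lborel" by simp
  qed
  then have "(\<lambda>n::nat. 0) \<longlonglongrightarrow> (\<integral>z. gauss (z::'a) * q y \<partial>lborel)" by (simp only: zero')
  then have "(\<integral>z. gauss (z::'a) * q y \<partial>lborel) = 0" by (simp only: LIMSEQ_const_iff)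
  then show ?thesis by (simp add: integral_gauss)
qed

text \<open>The convolution of two densities turns into the product of their Fourier transforms. If that
  product is the Fourier transform of \<open>r\<close>, then \<open>r\<close> is the convolution, by uniqueness. Continuity
  of \<open>p\<close> and \<open>r\<close> makes the equality hold at every point rather than almost everywhere.\<close>

lemma convolution_eqI:
  fixes p q r :: "'a::euclidean_space \<Rightarrow> real"
  assumes p: "continuous_on UNIV p" "integrable lborel p" "\<And>x. \<bar>p x\<bar> \<le> C\<^sub>p"
    and q: "integrable lborel q"
    and r: "continuous_on UNIV r" "integrable lborel r" "\<And>x. \<bar>r x\<bar> \<le> C\<^sub>r"
    and char: "\<And>\<xi>. (\<integral>x. exp (- \<i> * of_real (\<xi> \<bullet> x)) * of_real (r x) \<partial>lborel) = 
      (\<integral>x. exp (- \<i> * of_real (\<xi> \<bullet> x)) * of_real (p x) \<partial>lborel) *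
      (\<integral>x. exp (- \<i> * of_real (\<xi> \<bullet> x)) * of_real (q x) \<partial>lborel)"
  shows "r x = (\<integral>y. p (x - y) * q y \<partial>lborel)"
proof -
  have [measurable]: "p \<in> borel_measurable borel" "q \<in> borel_measurable borel" "r \<in> borel_measurable
      borel"
    using p(2) q(1) r(2) by (auto dest: borel_measurable_integrable)
  define v where "v x = (\<integral>y. p (x - y) * q y \<partial>lborel)" for x
  have int_pq: "integrable lborel (\<lambda>y. p (x - y) * q y)" for x
  proof (rule Bochner_Integration.integrable_bound[of _ "\<lambda>y. C\<^sub>p * \<bar>q y\<bar>"])
    show "AE y in lborel. norm (p (x - y) * q y) \<le> norm (C\<^sub>p * \<bar>q y\<bar>)"
      using order_trans[OF p(3) abs_ge_self] by (auto simp: abs_mult intro!: mult_right_mono)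
  qed (use q in auto)
  have v_bdd: "\<bar>v x\<bar> \<le> C\<^sub>p * (\<integral>y. \<bar>q y\<bar> \<partial>lborel)" for x
  proof -
    have "\<bar>v x\<bar> \<le> (\<integral>y. \<bar>p (x - y) * q y\<bar> \<partial>lborel)" unfolding v_def by (rule integral_abs_bound)
    also have "\<dots> \<le> (\<integral>y. C\<^sub>p * \<bar>q y\<bar> \<partial>lborel)"
      by (rule integral_mono[OF integrable_abs[OF int_pq]]) (use q p(3) in \<open>auto simp: abs_mult intro!:
          mult_right_mono\<close>)
    finally show ?thesis by simp
  qed
  have v_cont: "continuous_on UNIV v"
    unfolding continuous_on_sequentially comp_def
  proof (intro allI ballI impI)
    fix X and x :: 'a assume X: "(\<forall>n. X n \<in> UNIV) \<and> X \<longlonglongrightarrow> x"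
    show "(\<lambda>n. v (X n)) \<longlonglongrightarrow> v x" unfolding v_def
    proof (rule integral_dominated_convergence[where w = "\<lambda>y. C\<^sub>p * \<bar>q y\<bar>"])
      show "AE y in lborel. (\<lambda>n. p (X n - y) * q y) \<longlonglongrightarrow> p (x - y) * q y"
      proof (rule AE_I2)
        fix y 
        have "(\<lambda>n. p (X n - y)) \<longlonglongrightarrow> p (x - y)"
          by (rule continuous_on_tendsto_compose[OF p(1)]) (use X in \<open>auto intro!: tendsto_intros\<close>)
        then show "(\<lambda>n. p (X n - y) * q y) \<longlonglongrightarrow> p (x - y) * q y"
          by (rule tendsto_mult[OF _ tendsto_const])
      qed
      show "AE y in lborel. norm (p (X n - y) * q y) \<le> C\<^sub>p * \<bar>q y\<bar>" for n
        using p(3) by (auto simp: abs_mult intro!: mult_right_mono)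
    qed (use q in auto)
  qed
  have Fub: "integrable lborel (\<lambda>x. \<integral>y. g x * complex_of_real (p (x - y) * q y) \<partial>lborel) \<and>
      (\<integral>x. \<integral>y. g x * complex_of_real (p (x - y) * q y) \<partial>lborel \<partial>lborel) = 
      (\<integral>y. \<integral>x. g x * complex_of_real (p (x - y) * q y) \<partial>lborel \<partial>lborel)"
    if g: "g \<in> borel_measurable borel" "\<And>x. norm (g x) = 1" for g
  proof -
    note [measurable] = g(1)
    let ?F = "\<lambda>y x. g x * complex_of_real (p (x - y) * q y)"
    have int: "integrable (lborel \<Otimes>\<^sub>M lborel) (\<lambda>(y, x). ?F y x)"
    proof (rule lborel_pair.Fubini_integrable)
      show "(\<lambda>(y, x). ?F y x) \<in> borel_measurable (lborel \<Otimes>\<^sub>M lborel)" by measurable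
      have "(\<integral>x. norm (case (y, x) of (y, x) \<Rightarrow> ?F y x) \<partial>lborel) = (\<integral>x. \<bar>p x\<bar> \<partial>lborel) * \<bar>q y\<bar>" for y
        using integral_lborel_translate[of "\<lambda>x. \<bar>p x\<bar>" y] by (simp add: norm_mult g abs_mult)
      then show "integrable lborel (\<lambda>y. \<integral>x. norm (case (y, x) of (y, x) \<Rightarrow> ?F y x) \<partial>lborel)"
        using q by simp
      show "AE y in lborel. integrable lborel (\<lambda>x. case (y, x) of (y, x) \<Rightarrow> ?F y x)"
      proof (rule AE_I2)
        fix y
        have "integrable lborel (\<lambda>x. p (x - y) * q y)" using integrable_lborel_translate[OF p(2)]
            by simp
        then show "integrable lborel (\<lambda>x. case (y, x) of (y, x) \<Rightarrow> ?F y x)"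
          by (rule Bochner_Integration.integrable_bound) (auto simp: norm_mult g abs_mult)
      qed
    qed
    from lborel_pair.Fubini_integral[OF int] lborel_pair.integrable_snd[OF int] show ?thesis by simp
  qed
  have eq: "(\<integral>y. g * complex_of_real (p (x - y) * q y) \<partial>lborel) = g * of_real (v x)" for x g
    unfolding v_def integral_mult_right_zero integral_complex_of_real ..
  have v_int: "integrable lborel v"
  proof -
    have "integrable lborel (\<lambda>x. complex_of_real (v x))"
      using conjunct1[OF Fub[of "\<lambda>_. 1"]] by (simp only: eq) simp
    then show ?thesis by (subst (asm) complex_of_real_integrable_eq)
  qed
  have v_char: "(\<integral>x. exp (- \<i> * of_real (\<xi> \<bullet> x)) * of_real (v x) \<partial>lborel) =
      (\<integral>x. exp (- \<i> * of_real (\<xi> \<bullet> x)) * of_real (p x) \<partial>lborel) *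
      (\<integral>x. exp (- \<i> * of_real (\<xi> \<bullet> x)) * of_real (q x) \<partial>lborel)" for \<xi>
  proof -
    let ?e = "\<lambda>x. exp (- \<i> * of_real (\<xi> \<bullet> x))"
    have "(\<integral>x. ?e x * complex_of_real (p (x - y) * q y) \<partial>lborel) = 
       (\<integral>x. ?e x * of_real (p x) \<partial>lborel) * (?e y * of_real (q y))" for y
    proof -
      have "?e x * complex_of_real (p (x - y) * q y) =
          (?e (x - y) * of_real (p (x - y))) * (?e y * of_real (q y))" for x
        by (simp add: exp_add[symmetric] algebra_simps)
      then show ?thesis
        using integral_lborel_translate[of "\<lambda>x. ?e x * of_real (p x)" y] 
        by (simp only: integral_mult_left_zero) simp
    qed
    then show ?thesis
      using Fub[of ?e] by (simp only: eq) simp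
  qed
  have "r x - v x = 0"
  proof (rule fourier_uniqueness[of "\<lambda>x. r x - v x"])
    show "continuous_on UNIV (\<lambda>x. r x - v x)" using r(1) v_cont by (intro continuous_intros)
    show "\<bar>r x - v x\<bar> \<le> C\<^sub>r + C\<^sub>p * (\<integral>y. \<bar>q y\<bar> \<partial>lborel)" for x
      using r(3)[of x] v_bdd[of x] by linarith
    show "integrable lborel (\<lambda>x. r x - v x)" using r(2) v_int by simp
    show "(\<integral>x. exp (- \<i> * of_real (\<xi> \<bullet> x)) * of_real (r x - v x) \<partial>lborel) = 0" for \<xi>
    proof -
      have e: "integrable lborel (\<lambda>x. exp (- \<i> * of_real (\<xi> \<bullet> x)) * complex_of_real (f x))" 
        if "integrable lborel f" for f :: "'a \<Rightarrow> real"
        by (rule Bochner_Integration.integrable_bound[OF that])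
           (use borel_measurable_integrable[OF that] in \<open>auto simp: norm_mult\<close>)
      have "(\<integral>x. exp (- \<i> * of_real (\<xi> \<bullet> x)) * of_real (r x - v x) \<partial>lborel) = 
        (\<integral>x. exp (- \<i> * of_real (\<xi> \<bullet> x)) * of_real (r x) \<partial>lborel) - 
        (\<integral>x. exp (- \<i> * of_real (\<xi> \<bullet> x)) * of_real (v x) \<partial>lborel)"
        using e[OF r(2)] e[OF v_int]
        by (simp only: of_real_diff right_diff_distrib) (rule Bochner_Integration.integral_diff)
      then show ?thesis by (simp only: char v_char) simp
    qed
  qed
  then show ?thesis by (simp add: v_def)
qed

lemma heat_kernel_nonneg: "heat_kernel A \<mu> p \<Longrightarrow> 0 < t \<Longrightarrow> 0 \<le> p t x"
  by (simp add: heat_kernel_def)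

lemma heat_kernel_integral:
  assumes "heat_kernel A \<mu> p" "0 < t"
  shows "integrable lborel (p t)" and "(\<integral>x. p t x \<partial>lborel) = 1"
proof -
  have [measurable]: "p t \<in> borel_measurable borel" and nn: "\<And>x. 0 \<le> p t x"
    and "emeasure (density lborel (\<lambda>x. ennreal (p t x))) UNIV = 1"
    using assms by (auto simp: heat_kernel_def)
  then have 1: "(\<integral>\<^sup>+x. ennreal (p t x) \<partial>lborel) = 1" by (simp add: emeasure_density)
  then show "integrable lborel (p t)"
    by (intro integrableI_nonneg) (auto simp: nn)
  show "(\<integral>x. p t x \<partial>lborel) = 1"
    using 1 nn by (simp add: integral_eq_nn_integral)
qed

text \<open>The Fourier transforms \<open>exp (- t \<psi>)\<close> multiply when times are added.\<close>

lemma heat_kernel_chapman_kolmogorov: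
  assumes hk: "heat_kernel A \<mu> p" and st: "0 < s" "0 < t"
    and cont: "continuous_on UNIV (p s)" "bounded (range (p s))"
      "continuous_on UNIV (p (s + t))" "bounded (range (p (s + t)))"
  shows "p (s + t) x = (\<integral>y. p s (x - y) * p t y \<partial>lborel)"
proof -
  obtain C D where C: "\<And>x. \<bar>p s x\<bar> \<le> C" and D: "\<And>x. \<bar>p (s + t) x\<bar> \<le> D"
    using cont(2,4) by (auto simp: bounded_iff)
  have char: "(\<integral>x. exp (- \<i> * of_real (\<xi> \<bullet> x)) * of_real (p r x) \<partial>lborel)
     = exp (- of_real r * levy_symbol A \<mu> \<xi>)" if "r > 0" for \<xi> r
  proof -
    have [measurable]: "p r \<in> borel_measurable borel" and nn: "\<And>x. 0 \<le> p r x"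
      and "(\<integral>x. exp (- \<i> * of_real (\<xi> \<bullet> x)) \<partial>density lborel (\<lambda>x. ennreal (p r x)))
          = exp (- of_real r * levy_symbol A \<mu> \<xi>)"
      using hk that by (auto simp: heat_kernel_def)
    moreover have "(\<integral>x. exp (- \<i> * of_real (\<xi> \<bullet> x)) \<partial>density lborel (\<lambda>x. ennreal (p r x))) = 
        (\<integral>x. p r x *\<^sub>R exp (- \<i> * of_real (\<xi> \<bullet> x)) \<partial>lborel)"
      by (rule integral_density) (auto simp: nn)
    ultimately show ?thesis by (simp add: scaleR_conv_of_real mult.commute)
  qed
  show ?thesis
  proof (rule convolution_eqI[OF cont(1) _ C _ cont(3) _ D])
    show "integrable lborel (p s)" "integrable lborel (p t)" "integrable lborel (p (s + t))"
      using st by (auto intro!: heat_kernel_integral[OF hk])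
    show "(\<integral>x. exp (- \<i> * of_real (\<xi> \<bullet> x)) * of_real (p (s + t) x) \<partial>lborel) = 
      (\<integral>x. exp (- \<i> * of_real (\<xi> \<bullet> x)) * of_real (p s x) \<partial>lborel) *
      (\<integral>x. exp (- \<i> * of_real (\<xi> \<bullet> x)) * of_real (p t x) \<partial>lborel)" for \<xi>
      using st by (simp only: char add_pos_pos exp_add[symmetric] of_real_add) (simp add: algebra_simps)
  qed
qed

section \<open>Lipschitz approximation of Hoelder continuous functions\<close>

lemma powr_le_1_plus:
  fixes r \<theta> :: real
  assumes "0 \<le> r" "0 \<le> \<theta>" "\<theta> \<le> 1"
  shows "r powr \<theta> \<le> 1 + r"
proof (cases "r \<le> 1")
  case True
  then have "r powr \<theta> \<le> 1" using assms by (simp add: powr_le1)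
  then show ?thesis using assms by simp
next
  case False
  then have "r powr \<theta> \<le> r powr 1" using assms by (intro powr_mono) auto
  then show ?thesis using False by simp
qed

text \<open>The inf-convolution of \<open>f\<close> with a cone of slope \<open>K \<epsilon> powr (\<theta> - 1)\<close> has this slope as
  Lipschitz constant. It lies below \<open>f\<close>, and only points at distances \<open>r < \<epsilon>\<close>, where \<open>K r powr \<theta>\<close>
  exceeds the cone, can pull it down; this they do by at most \<open>K \<epsilon> powr \<theta>\<close>.\<close>

lemma lipschitz_approximation:
  fixes f :: "'a::real_normed_vector \<Rightarrow> real"
  assumes bdd: "\<And>x. \<bar>f x\<bar> \<le> B" and hoelder: "\<And>x y. \<bar>f x - f y\<bar> \<le> K * norm (x - y) powr \<theta>"
    and "0 \<le> K" "0 \<le> \<theta>" "\<theta> \<le> 1" "0 < \<epsilon>"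
  obtains g where "\<And>x y. \<bar>g x - g y\<bar> \<le> K * \<epsilon> powr (\<theta> - 1) * norm (x - y)"
    and "\<And>x. \<bar>f x - g x\<bar> \<le> K * \<epsilon> powr \<theta>"
proof
  define \<Lambda> where "\<Lambda> = K * \<epsilon> powr (\<theta> - 1)"
  define g where "g y = (INF z. f z + \<Lambda> * norm (y - z))" for y
  have \<Lambda>: "0 \<le> \<Lambda>" using assms by (simp add: \<Lambda>_def)
  have bdd_below: "bdd_below (range (\<lambda>z. f z + \<Lambda> * norm (y - z)))" for y
  proof (rule bdd_belowI2)
    show "- B \<le> f z + \<Lambda> * norm (y - z)" for z
      using bdd[of z] mult_nonneg_nonneg[OF \<Lambda> norm_ge_zero, of "y - z"] by linarith
  qed
  have le: "g y \<le> f z + \<Lambda> * norm (y - z)" for y z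
    unfolding g_def by (rule cINF_lower[OF bdd_below]) simp
  have half: "g x \<le> g y + \<Lambda> * norm (x - y)" for x y
  proof -
    have "g x - \<Lambda> * norm (x - y) \<le> g y"
      unfolding g_def[of y]
    proof (rule cINF_greatest)
      fix z
      have "\<Lambda> * norm (x - z) \<le> \<Lambda> * (norm (x - y) + norm (y - z))"
        using norm_triangle_ineq[of "x - y" "y - z"] by (intro mult_left_mono \<Lambda>) simp
      then show "g x - \<Lambda> * norm (x - y) \<le> f z + \<Lambda> * norm (y - z)"
        using le[of x z] by (simp add: algebra_simps)
    qed simp
    then show ?thesis by simp
  qed
  show "\<bar>g x - g y\<bar> \<le> K * \<epsilon> powr (\<theta> - 1) * norm (x - y)" for x y
    using half[of x y] half[of y x] unfolding \<Lambda>_def[symmetric] by (simp add: norm_minus_commute)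
  show "\<bar>f y - g y\<bar> \<le> K * \<epsilon> powr \<theta>" for y
  proof -
    have "f y - K * \<epsilon> powr \<theta> \<le> g y"
      unfolding g_def
    proof (rule cINF_greatest)
      fix z
      let ?r = "norm (y - z)"
      have "?r powr \<theta> = \<epsilon> powr \<theta> * (?r / \<epsilon>) powr \<theta>"
        using \<open>0 < \<epsilon>\<close> by (simp add: powr_divide)
      also have "\<dots> \<le> \<epsilon> powr \<theta> * (1 + ?r / \<epsilon>)"
        using assms by (intro mult_left_mono powr_le_1_plus) auto
      also have "\<dots> = \<epsilon> powr \<theta> + \<epsilon> powr (\<theta> - 1) * ?r"
        using \<open>0 < \<epsilon>\<close> by (simp add: powr_diff field_simps)
      finally have "K * ?r powr \<theta> \<le> K * (\<epsilon> powr \<theta> + \<epsilon> powr (\<theta> - 1) * ?r)"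
        using \<open>0 \<le> K\<close> by (rule mult_left_mono)
      then have "K * ?r powr \<theta> \<le> K * \<epsilon> powr \<theta> + \<Lambda> * ?r"
        by (simp add: \<Lambda>_def algebra_simps)
      then show "f y - K * \<epsilon> powr \<theta> \<le> f z + \<Lambda> * norm (y - z)"
        using hoelder[of y z] by linarith
    qed simp
    moreover have "g y \<le> f y" using le[of y y] by simp
    moreover have "0 \<le> K * \<epsilon> powr \<theta>" using assms by simp
    ultimately show ?thesis by linarith
  qed
qed

section \<open>Smoothing by the heat semigroup\<close>

text \<open>The properties of a heat kernel on \<open>(0, T]\<close> from which all regularity is derived.
  Derivatives of order two and higher are controlled by combining the bound on the gradient with
  the Chapman-Kolmogorov equation.\<close>

locale smoothing_semigroup =
  fixes p :: "real \<Rightarrow> real ^ 'n::finite \<Rightarrow> real" and T \<alpha> c :: real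
  assumes T_pos: "0 < T" and \<alpha>_pos: "0 < \<alpha>" and c_nonneg: "0 \<le> c"
    and nonneg: "\<And>t x. 0 < t \<Longrightarrow> t \<le> T \<Longrightarrow> 0 \<le> p t x"
    and integrable_p: "\<And>t. 0 < t \<Longrightarrow> t \<le> T \<Longrightarrow> integrable lborel (p t)"
    and integral_p: "\<And>t. 0 < t \<Longrightarrow> t \<le> T \<Longrightarrow> (\<integral>x. p t x \<partial>lborel) = 1"
    and differentiable_p: "\<And>t x. 0 < t \<Longrightarrow> t \<le> T \<Longrightarrow> p t differentiable (at x)"
    and bounded_partial_p: "\<And>t i. 0 < t \<Longrightarrow> t \<le> T \<Longrightarrow> bounded (range (partial i (p t)))"
    and grad_p: "\<And>t. 0 < t \<Longrightarrow> t \<le> T \<Longrightarrow>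
      (\<integral>\<^sup>+ y. ennreal (norm (grad (p t) y)) \<partial>lborel) \<le> ennreal (c * t powr (- 1 / \<alpha>))"
    and chapman_kolmogorov: "\<And>s t x. 0 < s \<Longrightarrow> 0 < t \<Longrightarrow> s + t \<le> T \<Longrightarrow>
      p (s + t) x = (\<integral>y. p s (x - y) * p t y \<partial>lborel)"
begin

abbreviation "P \<equiv> semigroup_op p"

lemma measurable_p: "0 < t \<Longrightarrow> t \<le> T \<Longrightarrow> p t \<in> borel_measurable borel"
  using borel_measurable_integrable[OF integrable_p] by simp

lemma
  assumes t: "0 < t" "t \<le> T"
  shows integrable_partial_p: "integrable lborel (partial i (p t))"
    and integral_partial_p: "(\<integral>x. \<bar>partial i (p t) x\<bar> \<partial>lborel) \<le> c * t powr (- 1 / \<alpha>)"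
proof -
  have [measurable]: "partial i (p t) \<in> borel_measurable borel"
    by (rule borel_measurable_partial[OF differentiable_p[OF t]])
  have "(\<integral>\<^sup>+x. ennreal \<bar>partial i (p t) x\<bar> \<partial>lborel) \<le> (\<integral>\<^sup>+ y. ennreal (norm (grad (p t) y)) \<partial>lborel)"
    by (intro nn_integral_mono ennreal_leI abs_partial_le_norm_grad)
  also note grad_p[OF t]
  finally have le: "(\<integral>\<^sup>+x. ennreal \<bar>partial i (p t) x\<bar> \<partial>lborel) \<le> ennreal (c * t powr (- 1 / \<alpha>))" .
  then show int: "integrable lborel (partial i (p t))"
    by (intro integrableI_bounded) (auto simp: le_less_trans[OF _ ennreal_less_top])
  have "ennreal (\<integral>x. \<bar>partial i (p t) x\<bar> \<partial>lborel) \<le> ennreal (c * t powr (- 1 / \<alpha>))"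
    using le int by (subst nn_integral_eq_integral[symmetric]) auto
  then show "(\<integral>x. \<bar>partial i (p t) x\<bar> \<partial>lborel) \<le> c * t powr (- 1 / \<alpha>)"
    using c_nonneg by (subst (asm) ennreal_le_iff) auto
qed

lemma integrable_conv:
  fixes q f :: "real ^ 'n \<Rightarrow> real"
  assumes q: "integrable lborel q" and f[measurable]: "f \<in> borel_measurable borel" and bdd: "\<And>x. \<bar>f x\<bar> \<le>
      K"
  shows "integrable lborel (\<lambda>y. q (x - y) * f y)"
proof (rule Bochner_Integration.integrable_bound[of _ "\<lambda>y. K * q (x - y)"])
  have [measurable]: "q \<in> borel_measurable borel" using borel_measurable_integrable[OF q] by simp
  show "integrable lborel (\<lambda>y. K * q (x - y))" using integrable_lborel_reflect[OF q] by simp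
  show "(\<lambda>y. q (x - y) * f y) \<in> borel_measurable lborel" by measurable
  have "\<bar>f y\<bar> \<le> \<bar>K\<bar>" for y using bdd[of y] by linarith
  then show "AE y in lborel. norm (q (x - y) * f y) \<le> norm (K * q (x - y))"
    by (auto simp: abs_mult mult.commute intro!: mult_right_mono)
qed

lemma abs_conv_le:
  fixes q f :: "real ^ 'n \<Rightarrow> real"
  assumes q: "integrable lborel q" and f[measurable]: "f \<in> borel_measurable borel" and bdd: "\<And>x. \<bar>f x\<bar> \<le>
      K"
  shows "\<bar>\<integral>y. q (x - y) * f y \<partial>lborel\<bar> \<le> (\<integral>y. \<bar>q y\<bar> \<partial>lborel) * K"
proof -
  have [measurable]: "q \<in> borel_measurable borel" using borel_measurable_integrable[OF q] by simp
  have "\<bar>\<integral>y. q (x - y) * f y \<partial>lborel\<bar> \<le> (\<integral>y. \<bar>q (x - y) * f y\<bar> \<partial>lborel)"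
    by (rule integral_abs_bound)
  also have "\<dots> \<le> (\<integral>y. \<bar>q (x - y)\<bar> * K \<partial>lborel)"
    by (rule integral_mono[OF integrable_abs[OF integrable_conv[OF assms]]])
       (use bdd integrable_lborel_reflect[OF integrable_abs[OF q]] in \<open>auto simp: abs_mult intro!:
           mult_left_mono\<close>)
  also have "\<dots> = (\<integral>y. \<bar>q y\<bar> \<partial>lborel) * K"
    using integral_lborel_reflect[of "\<lambda>y. \<bar>q y\<bar>" x] by simp
  finally show ?thesis .
qed

context
  fixes t :: real and f :: "real ^ 'n \<Rightarrow> real" and K :: real
  assumes t: "0 < t" "t \<le> T" and f: "f \<in> borel_measurable borel" and bdd: "\<And>x. \<bar>f x\<bar> \<le> K"
begin

lemma P_abs_le: "\<bar>P t f x\<bar> \<le> K"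
  using abs_conv_le[OF integrable_p[OF t] f bdd, of x] 
  by (simp add: semigroup_op_def nonneg[OF t] integral_p[OF t])

lemma P_flip: "P t f x = (\<integral>y. p t y * f (x - y) \<partial>lborel)"
  unfolding semigroup_op_def
  using integral_lborel_reflect[of "\<lambda>y. p t y * f (x - y)" x] measurable_p[OF t] f by simp

lemma integrable_P_flip: "integrable lborel (\<lambda>y. p t y * f (x - y))"
  using integrable_lborel_reflect[OF integrable_conv[OF integrable_p[OF t] f bdd, of x], of x] by simp

lemma P_translate: "P t (\<lambda>y. f (y + h)) x = P t f (x + h)"
  unfolding semigroup_op_def
  using integral_lborel_translate[of "\<lambda>y. p t (x - y) * f (y + h)" h] measurable_p[OF t] f
  by (simp add: algebra_simps)

lemma P_lipschitz:
  assumes lip: "\<And>x y. \<bar>f x - f y\<bar> \<le> \<Lambda> * norm (x - y)"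
  shows "\<bar>P t f x - P t f y\<bar> \<le> \<Lambda> * norm (x - y)"
proof -
  have "\<bar>P t f x - P t f y\<bar> = \<bar>\<integral>z. p t z * f (x - z) - p t z * f (y - z) \<partial>lborel\<bar>"
    by (simp add: P_flip Bochner_Integration.integral_diff[OF integrable_P_flip integrable_P_flip])
  also have "\<dots> \<le> (\<integral>z. \<bar>p t z * f (x - z) - p t z * f (y - z)\<bar> \<partial>lborel)"
    by (rule integral_abs_bound)
  also have "\<dots> \<le> (\<integral>z. p t z * (\<Lambda> * norm (x - y)) \<partial>lborel)"
  proof (rule integral_mono)
    show "integrable lborel (\<lambda>z. \<bar>p t z * f (x - z) - p t z * f (y - z)\<bar>)"
      by (intro integrable_abs Bochner_Integration.integrable_diff integrable_P_flip)
    show "integrable lborel (\<lambda>z. p t z * (\<Lambda> * norm (x - y)))" using integrable_p[OF t] by simp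
    show "\<bar>p t z * f (x - z) - p t z * f (y - z)\<bar> \<le> p t z * (\<Lambda> * norm (x - y))" for z
      using lip[of "x - z" "y - z"] nonneg[OF t, of z]
      by (simp add: abs_mult mult_left_mono flip: right_diff_distrib)
  qed
  also have "\<dots> = \<Lambda> * norm (x - y)" using integral_p[OF t] by simp
  finally show ?thesis .
qed

text \<open>Without an integrable majorant for \<open>Dp\<^sub>t\<close> near a point, differentiation under the integral
  sign does not apply directly. It does apply when \<open>f\<close> is cut off outside a ball, as \<open>Dp\<^sub>t\<close> is
  bounded. When the ball grows, the derivatives of the truncated integrals converge locally
  uniformly because \<open>Dp\<^sub>t\<close> is integrable.\<close>

lemma P_has_derivative: "((P t f) has_derivative (\<lambda>h. (\<chi> i. \<integral>y. partial i (p t) (x - y) * f y \<partial>lborel) \<bullet>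
    h)) (at x)"
proof -
  define G where "G x = (\<chi> i. \<integral>y. partial i (p t) (x - y) * f y \<partial>lborel)" for x
  define fn where "fn n y = indicator (ball 0 (real n)) y * f y" for n and y :: "real ^ 'n"
  define F where "F n x = (\<integral>y. p t (x - y) * fn n y \<partial>lborel)" for n x
  define Gn where "Gn n x = (\<chi> i. \<integral>y. partial i (p t) (x - y) * fn n y \<partial>lborel)" for n x
  note [measurable] = f measurable_p[OF t] borel_measurable_partial[OF differentiable_p[OF t]]
  have fn_meas [measurable]: "fn n \<in> borel_measurable borel" for n
    unfolding fn_def by (intro borel_measurable_times borel_measurable_indicator f) auto
  have K: "0 \<le> K" using bdd[of 0] by linarith
  have fn_bdd: "\<bar>fn n y\<bar> \<le> K" for n y using bdd[of y] K by (simp add: fn_def indicator_def)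
  have fn_int: "integrable lborel (fn n)" for n
  proof (rule Bochner_Integration.integrable_bound[of _ "\<lambda>y. K * indicator (ball 0 (real n)) y"])
    have "emeasure lborel (ball (0::real^'n) (real n)) < \<infinity>"
      by (rule emeasure_bounded_finite) simp
    then show "integrable lborel (\<lambda>y::real^'n. K * indicator (ball 0 (real n)) y)"
      by (intro integrable_mult_right integrable_real_indicator) auto
    show "AE y in lborel. norm (fn n y) \<le> norm (K * indicator (ball 0 (real n)) y)"
      using bdd by (auto simp: fn_def indicator_def intro!: order_trans[OF bdd abs_ge_self])
  qed measurable
  have bounded: "\<exists>D. \<forall>i x. \<bar>partial i (p t) x\<bar> \<le> D"
  proof -
    have "bounded (\<Union>i. range (partial i (p t)))"
      using bounded_partial_p[OF t] by (intro bounded_UN) auto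
    then show ?thesis by (auto simp: bounded_iff)
  qed
  then obtain D where D: "\<And>i x. \<bar>partial i (p t) x\<bar> \<le> D" by blast
  have shift: "((\<lambda>x. p t (x - y) * fn n y) has_derivative (\<lambda>h. (fn n y *\<^sub>R grad (p t) (x - y)) \<bullet> h)) (at
      x)" for n x y
  proof -
    have "((\<lambda>x. p t (x - y)) has_derivative (\<lambda>h. grad (p t) (x - y) \<bullet> h)) (at x)"
      by (rule has_derivative_compose[where g="p t"])
         (auto intro!: derivative_eq_intros has_derivative_grad differentiable_p t)
    from has_derivative_mult_left[OF this, of "fn n y"] show ?thesis by (simp add: mult.commute)
  qed
  have partial_mult_shift: "partial i (\<lambda>x. p t (x - y) * fn n y) x = partial i (p t) (x - y) * fn n y"
      for i n x y
    using partial_has_derivative[OF shift] by (simp add: partial_eq_grad)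
  have deriv: "(F n has_derivative (\<lambda>h. Gn n x \<bullet> h)) (at x)" for n x
  proof -
    have "((\<lambda>x. \<integral>y. p t (x - y) * fn n y \<partial>lborel) has_derivative
       (\<lambda>h. (\<chi> i. \<integral>y. partial i (\<lambda>x. p t (x - y) * fn n y) x \<partial>lborel) \<bullet> h)) (at x)"
    proof (rule has_derivative_integral)
      show "integrable lborel (\<lambda>y. p t (x - y) * fn n y)" for x
        by (rule integrable_conv[OF integrable_p[OF t] fn_meas fn_bdd])
      show "(\<lambda>x. p t (x - y) * fn n y) differentiable (at x)" for x y
        using shift by (auto simp: differentiable_def)
      show "\<bar>partial i (\<lambda>x. p t (x - y) * fn n y) x\<bar> \<le> D * \<bar>fn n y\<bar>" for i x y
        using D by (simp add: partial_mult_shift abs_mult mult_right_mono)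
      show "integrable lborel (\<lambda>y. D * \<bar>fn n y\<bar>)" using fn_int by simp
    qed
    then show ?thesis by (simp add: partial_mult_shift F_def[abs_def] Gn_def)
  qed
  \<comment> \<open>\<open>|y| \<le> \<rho>\<close> for \<open>y\<close> in the unit ball around \<open>x\<close>, so that \<open>|z| \<ge> n\<close> forces \<open>|y - z| + \<rho> \<ge> n\<close>.\<close>
  define \<rho> where "\<rho> = norm x + 1"
  define tail where "tail n = (\<Sum>i\<in>UNIV. \<integral>z. indicator {z. real n \<le>
      norm z + \<rho>} z * \<bar>partial i (p t) z\<bar> \<partial>lborel)" for n
  have tail_0: "tail \<longlonglongrightarrow> 0"
  proof -
    have "(\<lambda>n. \<integral>z. indicator {z. real n \<le> norm z + \<rho>} z * \<bar>partial i (p t) z\<bar> \<partial>lborel) \<longlonglongrightarrow>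
        (\<integral>z. 0 \<partial>(lborel :: (real^'n) measure))" for i
    proof (rule integral_dominated_convergence[where w = "\<lambda>z. \<bar>partial i (p t) z\<bar>"])
      show "AE z in lborel. (\<lambda>n. indicator {z. real n \<le> norm z + \<rho>} z * \<bar>partial i (p t) z\<bar>) \<longlonglongrightarrow> 0"
      proof (rule AE_I2)
        fix z :: "real ^ 'n"
        have "\<forall>\<^sub>F n in sequentially. norm z + \<rho> < real n"
          using filterlim_real_sequentially by (simp add: filterlim_at_top_dense)
        then show "(\<lambda>n. indicator {z. real n \<le> norm z + \<rho>} z * \<bar>partial i (p t) z\<bar>) \<longlonglongrightarrow> 0"
          by (intro tendsto_eventually, elim eventually_mono) simp
      qed
      show "integrable lborel (\<lambda>z. \<bar>partial i (p t) z\<bar>)" using integrable_partial_p[OF t] by simp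
    qed (auto simp: indicator_def)
    then have "tail \<longlonglongrightarrow> (\<Sum>i\<in>(UNIV::'n set). 0)"
      unfolding tail_def[abs_def] by (intro tendsto_sum) simp
    then show ?thesis by simp
  qed
  have G_near: "norm (Gn n y - G y) \<le> K * tail n" if y: "y \<in> ball x 1" for n y
  proof -
    have "norm y \<le> \<rho>" using y norm_triangle_sub[of y x]
        by (simp add: \<rho>_def dist_norm norm_minus_commute)
    have "\<bar>(Gn n y - G y) $ i\<bar> \<le> K * (\<integral>z. indicator {z. real n \<le>
        norm z + \<rho>} z * \<bar>partial i (p t) z\<bar> \<partial>lborel)" for i
    proof -
      have "(Gn n y - G y) $ i = (\<integral>z. partial i (p t) (y - z) * fn n z - partial i (p t) (y - z) * f z
          \<partial>lborel)"
        unfolding Gn_def G_def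
        by (simp add: Bochner_Integration.integral_diff
            integrable_conv[OF integrable_partial_p[OF t] fn_meas fn_bdd] integrable_conv[OF
                integrable_partial_p[OF t] f bdd])
      then have "\<bar>(Gn n y - G y) $ i\<bar> \<le> (\<integral>z. \<bar>partial i (p t) (y - z) * fn n z - partial i (p t) (y - z)
          * f z\<bar> \<partial>lborel)"
        using integral_abs_bound by metis
      also have "\<dots> \<le> (\<integral>z. K * (indicator {z. real n \<le>
          norm z + \<rho>} (y - z) * \<bar>partial i (p t) (y - z)\<bar>) \<partial>lborel)"
      proof (rule integral_mono)
        show "integrable lborel (\<lambda>z. \<bar>partial i (p t) (y - z) * fn n z - partial i (p t) (y - z) * f
            z\<bar>)"
          by (intro integrable_abs Bochner_Integration.integrable_diff
            integrable_conv[OF integrable_partial_p[OF t] fn_meas fn_bdd] integrable_conv[OF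
                integrable_partial_p[OF t] f bdd])
        have "integrable lborel (\<lambda>z. indicator {z. real n \<le> norm z + \<rho>} z * \<bar>partial i (p t) z\<bar>)"
          by (rule Bochner_Integration.integrable_bound[OF integrable_partial_p[OF t]]) (auto simp:
              indicator_def)
        from integrable_lborel_reflect[OF this, of y]
        show "integrable lborel (\<lambda>z. K * (indicator {z. real n \<le>
            norm z + \<rho>} (y - z) * \<bar>partial i (p t) (y - z)\<bar>))" 
          by simp
        fix z
        show "\<bar>partial i (p t) (y - z) * fn n z - partial i (p t) (y - z) * f z\<bar> \<le> 
          K * (indicator {z. real n \<le> norm z + \<rho>} (y - z) * \<bar>partial i (p t) (y - z)\<bar>)"
        proof (cases "norm z < real n")
          case True
          then show ?thesis using K by (simp add: fn_def)
        next
          case False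
          then have "real n \<le> norm (y - z) + \<rho>"
            using \<open>norm y \<le> \<rho>\<close> norm_triangle_sub[of z y] by (simp add: norm_minus_commute)
          then show ?thesis
            using False bdd[of z] by (simp add: fn_def abs_mult mult.commute mult_right_mono)
        qed
      qed
      also have "\<dots> = K * (\<integral>z. indicator {z. real n \<le> norm z + \<rho>} z * \<bar>partial i (p t) z\<bar> \<partial>lborel)"
        using integral_lborel_reflect[of "\<lambda>z. indicator {z. real n \<le>
            norm z + \<rho>} z * \<bar>partial i (p t) z\<bar>" y] 
        by simp
      finally show ?thesis .
    qed
    then have "(\<Sum>i\<in>UNIV. \<bar>(Gn n y - G y) $ i\<bar>) \<le> K * tail n"
      unfolding tail_def sum_distrib_left by (rule sum_mono)
    then show ?thesis using norm_le_l1_cart[of "Gn n y - G y"] by linarith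
  qed
  have F_lim: "(\<lambda>n. F n y) \<longlonglongrightarrow> P t f y" for y
    unfolding F_def semigroup_op_def
  proof (rule integral_dominated_convergence[where w = "\<lambda>z. p t (y - z) * K"])
    show "integrable lborel (\<lambda>z. p t (y - z) * K)" 
      using integrable_lborel_reflect[OF integrable_p[OF t]] by simp
    show "AE z in lborel. (\<lambda>n. p t (y - z) * fn n z) \<longlonglongrightarrow> p t (y - z) * f z"
    proof (rule AE_I2)
      fix z :: "real ^ 'n"
      have "\<forall>\<^sub>F n in sequentially. norm z < real n"
        using filterlim_real_sequentially by (simp add: filterlim_at_top_dense)
      then show "(\<lambda>n. p t (y - z) * fn n z) \<longlonglongrightarrow> p t (y - z) * f z"
        by (intro tendsto_eventually, elim eventually_mono) (simp add: fn_def)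
    qed
    show "AE z in lborel. norm (p t (y - z) * fn n z) \<le> p t (y - z) * K" for n
      using fn_bdd nonneg[OF t] by (auto simp: abs_mult intro!: mult_left_mono)
  qed measurable
  have "\<exists>g. \<forall>y\<in>ball x 1. (\<lambda>n. F n y) \<longlonglongrightarrow> g y \<and> (g has_derivative (\<lambda>h. G y \<bullet> h)) (at y within ball x 1)"
  proof (rule has_derivative_sequence[where f' = "\<lambda>n y h. Gn n y \<bullet> h"])
    show "convex (ball x 1)" by (rule convex_ball)
    show "(F n has_derivative (\<lambda>h. Gn n y \<bullet> h)) (at y within ball x 1)" for n y
      using deriv by (rule has_derivative_at_withinI)
    show "\<forall>\<^sub>F n in sequentially. \<forall>y\<in>ball x 1. \<forall>h. norm (Gn n y \<bullet> h - G y \<bullet> h) \<le> e * norm h" if "0 < e"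
        for e
    proof -
      have "(\<lambda>n. K * tail n) \<longlonglongrightarrow> K * 0" using tail_0 by (rule tendsto_mult_left)
      then have "\<forall>\<^sub>F n in sequentially. K * tail n < e" using that by (simp add: order_tendstoD)
      then show ?thesis
      proof (rule eventually_mono, intro ballI allI)
        fix n y h assume n: "K * tail n < e" and y: "y \<in> ball x 1"
        have "norm (Gn n y \<bullet> h - G y \<bullet> h) \<le> norm (Gn n y - G y) * norm h"
          using Cauchy_Schwarz_ineq2[of "Gn n y - G y" h] by (simp add: inner_diff_left)
        also have "\<dots> \<le> e * norm h" using G_near[OF y, of n] n by (intro mult_right_mono) auto
        finally show "norm (Gn n y \<bullet> h - G y \<bullet> h) \<le> e * norm h" .
      qed
    qed
    show "x \<in> ball x 1" by simp
    show "(\<lambda>n. F n x) \<longlonglongrightarrow> P t f x" by (rule F_lim)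
  qed
  then obtain g where g: "\<And>y. y \<in> ball x 1 \<Longrightarrow> (\<lambda>n. F n y) \<longlonglongrightarrow> g y"
    and g': "(g has_derivative (\<lambda>h. G x \<bullet> h)) (at x within ball x 1)"
    using centre_in_ball[of x 1] by (meson zero_less_one)
  have eq: "g y = P t f y" if "y \<in> ball x 1" for y
    using LIMSEQ_unique[OF g[OF that] F_lim] .
  have "(P t f has_derivative (\<lambda>h. G x \<bullet> h)) (at x within ball x 1)"
    by (rule has_derivative_transform[OF _ _ g']) (auto simp: eq)
  then show ?thesis by (simp add: G_def at_within_open[of x "ball x 1"])
qed

lemma P_differentiable: "P t f differentiable (at x)"
  using P_has_derivative by (auto simp: differentiable_def)

lemma P_continuous: "continuous_on UNIV (P t f)"
  using P_differentiable by (auto intro!: continuous_at_imp_continuous_on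
      differentiable_imp_continuous_within)

lemma P_measurable: "P t f \<in> borel_measurable borel"
  by (rule borel_measurable_continuous_onI[OF P_continuous])

lemma abs_partial_P_le: "\<bar>partial i (P t f) x\<bar> \<le> c * t powr (- 1 / \<alpha>) * K"
proof -
  have "partial i (P t f) x = (\<integral>y. partial i (p t) (x - y) * f y \<partial>lborel)"
    using partial_has_derivative[OF P_has_derivative] by (simp add: inner_axis)
  then have "\<bar>partial i (P t f) x\<bar> \<le> (\<integral>y. \<bar>partial i (p t) y\<bar> \<partial>lborel) * K"
    using abs_conv_le[OF integrable_partial_p[OF t] f bdd] by simp
  also have "\<dots> \<le> c * t powr (- 1 / \<alpha>) * K"
    using bdd[of 0] by (intro mult_right_mono integral_partial_p t) linarith
  finally show ?thesis .
qed

text \<open>The derivative can be moved onto \<open>f\<close>, where boundedness of \<open>Df\<close> and integrability of \<open>p\<^sub>t\<close>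
  give a majorant.\<close>

lemma partial_P_commute:
  assumes diff: "\<And>x. f differentiable (at x)" and bdd': "\<And>i x. \<bar>partial i f x\<bar> \<le> K'"
  shows "partial i (P t f) = P t (partial i f)"
proof
  fix x
  have shift: "((\<lambda>x. p t y * f (x - y)) has_derivative (\<lambda>h. (p t y *\<^sub>R grad f (x - y)) \<bullet> h)) (at x)"
      for x y
  proof -
    have "((\<lambda>x. f (x - y)) has_derivative (\<lambda>h. grad f (x - y) \<bullet> h)) (at x)"
      by (rule has_derivative_compose[where g=f])
         (auto intro!: derivative_eq_intros has_derivative_grad diff)
    from has_derivative_mult_right[OF this, of "p t y"] show ?thesis by simp
  qed
  have eq: "partial i (\<lambda>x. p t y * f (x - y)) x = p t y * partial i f (x - y)" for i x y
    using partial_has_derivative[OF shift] by (simp add: partial_eq_grad)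
  have "partial i (\<lambda>x. \<integral>y. p t y * f (x - y) \<partial>lborel) x =
      (\<integral>y. partial i (\<lambda>x. p t y * f (x - y)) x \<partial>lborel)"
  proof (rule partial_integral[where B = "\<lambda>y. p t y * K'"])
    show "(\<lambda>x. p t y * f (x - y)) differentiable (at x)" for x y
      using shift by (auto simp: differentiable_def)
    show "\<bar>partial i (\<lambda>x. p t y * f (x - y)) x\<bar> \<le> p t y * K'" for i x y
      using bdd' nonneg[OF t] by (simp add: eq abs_mult mult_left_mono)
  qed (use integrable_P_flip integrable_p[OF t] in auto)
  also have "\<dots> = (\<integral>y. p t y * partial i f (x - y) \<partial>lborel)" by (simp only: eq)
  also have "\<dots> = P t (partial i f) x"
    unfolding semigroup_op_def
    using integral_lborel_reflect[of "\<lambda>y. p t y * partial i f (x - y)" x] measurable_p[OF t]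
      borel_measurable_partial[OF diff] by simp
  finally show "partial i (P t f) x = P t (partial i f) x" by (simp add: P_flip[abs_def])
qed

end

lemma P_add:
  assumes "0 < t" "t \<le> T" "f \<in> borel_measurable borel" "\<And>x. \<bar>f x\<bar> \<le> K"
    and "g \<in> borel_measurable borel" "\<And>x. \<bar>g x\<bar> \<le> K'"
  shows "P t (\<lambda>y. f y + g y) = (\<lambda>x. P t f x + P t g x)"
proof
  fix x
  show "P t (\<lambda>y. f y + g y) x = P t f x + P t g x"
    unfolding semigroup_op_def distrib_left
    by (rule Bochner_Integration.integral_add[OF integrable_conv[OF integrable_p[OF assms(1,2)]
        assms(3,4)]
          integrable_conv[OF integrable_p[OF assms(1,2)] assms(5,6)]])
qed

lemma P_semigroup:
  assumes s: "0 < s" and t: "0 < t" and st: "s + t \<le> T"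
    and f: "f \<in> borel_measurable borel" and bdd: "\<And>x. \<bar>f x\<bar> \<le> K"
  shows "P (s + t) f = P s (P t f)"
proof
  fix x
  have sT: "s \<le> T" and tT: "t \<le> T" using s t st by auto
  note [measurable] = f measurable_p[OF s sT] measurable_p[OF t tT]
  let ?F = "\<lambda>y z. p s (x - y) * (p t (y - z) * f z)"
  have int_z: "integrable lborel (\<lambda>z. p t (y - z) * f z)" for y
    by (rule integrable_conv[OF integrable_p[OF t tT] f bdd])
  have int: "integrable (lborel \<Otimes>\<^sub>M lborel) (\<lambda>(y, z). ?F y z)"
  proof (rule lborel_pair.Fubini_integrable)
    show "(\<lambda>(y, z). ?F y z) \<in> borel_measurable (lborel \<Otimes>\<^sub>M lborel)" by measurable
    have eq: "(\<integral>z. norm (case (y, z) of (y, z) \<Rightarrow> ?F y z) \<partial>lborel) =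
        p s (x - y) * (\<integral>z. \<bar>p t (y - z) * f z\<bar> \<partial>lborel)" for y
      using nonneg[OF s sT] by (simp add: abs_mult[of "p s _"])
    have le: "\<bar>\<integral>z. \<bar>p t (y - z) * f z\<bar> \<partial>lborel\<bar> \<le> K" for y
    proof -
      have "(\<integral>z. \<bar>p t (y - z) * f z\<bar> \<partial>lborel) = P t (\<lambda>z. \<bar>f z\<bar>) y"
        unfolding semigroup_op_def using nonneg[OF t tT] by (simp add: abs_mult)
      then show ?thesis using P_abs_le[OF t tT, of "\<lambda>z. \<bar>f z\<bar>" K y] bdd by simp
    qed
    show "integrable lborel (\<lambda>y. \<integral>z. norm (case (y, z) of (y, z) \<Rightarrow> ?F y z) \<partial>lborel)"
      unfolding eq by (rule integrable_conv[OF integrable_p[OF s sT] _ le]) measurable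
    show "AE y in lborel. integrable lborel (\<lambda>z. case (y, z) of (y, z) \<Rightarrow> ?F y z)"
      using int_z by simp
  qed
  have ck: "(\<integral>y. p s (x - y) * p t (y - z) \<partial>lborel) = p (s + t) (x - z)" for z
    using integral_lborel_translate[of "\<lambda>y. p s (x - z - y) * p t y" z] chapman_kolmogorov[OF s t st, of
        "x - z"]
    by simp
  have "P s (P t f) x = (\<integral>y. \<integral>z. ?F y z \<partial>lborel \<partial>lborel)"
    unfolding semigroup_op_def by simp
  also have "\<dots> = (\<integral>z. \<integral>y. ?F y z \<partial>lborel \<partial>lborel)"
    using lborel_pair.Fubini_integral[OF int] by simp
  also have "\<dots> = (\<integral>z. (\<integral>y. p s (x - y) * p t (y - z) \<partial>lborel) * f z \<partial>lborel)"
    by (simp flip: mult.assoc)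
  also have "\<dots> = P (s + t) f x" unfolding ck semigroup_op_def ..
  finally show "P (s + t) f x = P s (P t f) x" ..
qed

end

context smoothing_semigroup begin

text \<open>Each derivative consumes one time step \<open>\<tau>\<close> of the semigroup: it is taken of \<open>P\<^sub>\<tau>\<close> applied to
  what the previous steps produced and then commutes with the remaining \<open>P\<^sub>\<sigma>\<close>. Keeping \<open>\<sigma>\<close> free,
  with \<open>g\<close> independent of it, is what makes the induction work; \<open>k \<tau> < T\<close> leaves room for it.\<close>

lemma partials_P_representation:
  fixes \<tau> :: real
  assumes \<tau>: "0 < \<tau>" and f: "f \<in> borel_measurable borel" and bdd: "\<And>x. \<bar>f x\<bar> \<le> K"
  shows "real (length ks) * \<tau> < T \<Longrightarrow> \<exists>g\<in>borel_measurable borel.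
    (\<forall>x. \<bar>g x\<bar> \<le> (c * \<tau> powr (- 1 / \<alpha>)) ^ length ks * K) \<and>
    (\<forall>\<sigma>>0. \<sigma> + length ks * \<tau> \<le> T \<longrightarrow> partials ks (P (\<sigma> + length ks * \<tau>) f) = P \<sigma> g)"
proof (induction ks)
  case Nil
  then show ?case using f bdd by auto
next
  case (Cons j ks)
  have k: "real (length (j # ks)) * \<tau> = \<tau> + real (length ks) * \<tau>" by (simp add: algebra_simps)
  have "0 \<le> real (length ks) * \<tau>" using \<tau> by simp
  then have \<tau>T: "\<tau> \<le> T" and kT: "real (length ks) * \<tau> < T" using Cons.prems k \<tau> by linarith+
  let ?K = "(c * \<tau> powr (- 1 / \<alpha>)) ^ length ks * K"
  obtain g where g: "g \<in> borel_measurable borel" "\<And>x. \<bar>g x\<bar> \<le> ?K"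
    and rep: "\<And>\<sigma>. 0 < \<sigma> \<Longrightarrow> \<sigma> + length ks * \<tau> \<le> T \<Longrightarrow> partials ks (P (\<sigma> + length ks * \<tau>) f) = P \<sigma> g"
    using Cons.IH[OF kT] by blast
  have bound: "\<bar>partial i (P \<tau> g) x\<bar> \<le> c * \<tau> powr (- 1 / \<alpha>) * ?K" for i x
    by (rule abs_partial_P_le[OF \<tau> \<tau>T g])
  show ?case
  proof (intro bexI conjI allI impI)
    show "partial j (P \<tau> g) \<in> borel_measurable borel"
      by (rule borel_measurable_partial[OF P_differentiable[OF \<tau> \<tau>T g]])
    show "\<bar>partial j (P \<tau> g) x\<bar> \<le> (c * \<tau> powr (- 1 / \<alpha>)) ^ length (j # ks) * K" for x
      using bound by (simp add: mult.assoc)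
    fix \<sigma> :: real assume \<sigma>: "0 < \<sigma>" "\<sigma> + length (j # ks) * \<tau> \<le> T"
    then have *: "(\<sigma> + \<tau>) + length ks * \<tau> \<le> T" unfolding k by linarith
    have \<sigma>\<tau>: "\<sigma> + \<tau> \<le> T" using * \<open>0 \<le> real (length ks) * \<tau>\<close> by linarith
    have \<sigma>T: "\<sigma> \<le> T" using \<sigma>\<tau> \<tau> by linarith
    have "partials ks (P (\<sigma> + length (j # ks) * \<tau>) f) = P (\<sigma> + \<tau>) g"
      using rep[OF _ *] \<sigma>(1) \<tau> unfolding k by (simp add: add.assoc)
    also have "\<dots> = P \<sigma> (P \<tau> g)" by (rule P_semigroup[OF \<sigma>(1) \<tau> \<sigma>\<tau> g])
    finally have "partials (j # ks) (P (\<sigma> + length (j # ks) * \<tau>) f) = partial j (P \<sigma> (P \<tau> g))" by simp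
    also have "\<dots> = P \<sigma> (partial j (P \<tau> g))"
      by (rule partial_P_commute[OF \<sigma>(1) \<sigma>T P_measurable[OF \<tau> \<tau>T g] P_abs_le[OF \<tau> \<tau>T g]
          P_differentiable[OF \<tau> \<tau>T g] bound])
    finally show "partials (j # ks) (P (\<sigma> + length (j # ks) * \<tau>) f) = P \<sigma> (partial j (P \<tau> g))" .
  qed
qed

text \<open>The constant that results from \<open>k\<close> steps of length \<open>t / (k + 1)\<close>.\<close>

definition kernel_const :: "nat \<Rightarrow> real" where
  "kernel_const k = (c * (real k + 1) powr (1 / \<alpha>)) ^ k"

lemma kernel_const_nonneg: "0 \<le> kernel_const k"
  using c_nonneg by (simp add: kernel_const_def)

context
  fixes t :: real and f :: "real ^ 'n \<Rightarrow> real" and K :: real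
  assumes t: "0 < t" "t \<le> T" and f: "f \<in> borel_measurable borel" and bdd: "\<And>x. \<bar>f x\<bar> \<le> K"
begin

text \<open>The time \<open>t\<close> is divided into one step for each derivative and a last one of the same length,
  which smooths the remaining bounded function.\<close>

lemma
  shows partials_P_differentiable: "partials ks (P t f) differentiable (at x)"
    and abs_partials_P_le: "\<bar>partials ks (P t f) x\<bar> \<le>
        kernel_const (length ks) * t powr (- real (length ks) / \<alpha>) * K"
proof -
  define k where "k = real (length ks)"
  define \<tau> where "\<tau> = t / (k + 1)"
  have k: "0 \<le> k" by (simp add: k_def)
  have \<tau>: "0 < \<tau>" using k t by (auto simp: \<tau>_def)
  have "(k + 1) * \<tau> = t" using k by (simp add: \<tau>_def)
  then have \<tau>t: "\<tau> + k * \<tau> = t" by (simp add: algebra_simps)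
  have k\<tau>: "0 \<le> k * \<tau>" using k \<tau> by simp
  have "\<tau> \<le> T" "k * \<tau> < T" using k\<tau> \<tau>t \<tau> t by linarith+
  obtain g where g: "g \<in> borel_measurable borel" "\<And>x. \<bar>g x\<bar> \<le> (c * \<tau> powr (- 1 / \<alpha>)) ^ length ks * K"
    and rep: "\<And>\<sigma>. 0 < \<sigma> \<Longrightarrow> \<sigma> + k * \<tau> \<le> T \<Longrightarrow> partials ks (P (\<sigma> + k * \<tau>) f) = P \<sigma> g"
    using partials_P_representation[OF \<tau> f bdd, where ks=ks] \<open>k * \<tau> < T\<close> unfolding k_def by blast
  have eq: "partials ks (P t f) = P \<tau> g" using rep[OF \<tau>] \<tau>t t by simp
  show "partials ks (P t f) differentiable (at x)"
    unfolding eq by (rule P_differentiable[OF \<tau> \<open>\<tau> \<le> T\<close> g])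
  have "\<tau> powr (- 1 / \<alpha>) = (k + 1) powr (1 / \<alpha>) * t powr (- 1 / \<alpha>)"
    using k t by (simp add: \<tau>_def powr_divide powr_minus field_simps)
  then have "(c * \<tau> powr (- 1 / \<alpha>)) ^ length ks = kernel_const (length ks) * (t powr (- 1 / \<alpha>)) ^ length
      ks"
    by (simp add: kernel_const_def power_mult_distrib[symmetric] k_def mult.assoc)
  also have "(t powr (- 1 / \<alpha>)) ^ length ks = t powr (- real (length ks) / \<alpha>)"
    using t by (simp add: powr_realpow[symmetric] powr_powr)
  finally show "\<bar>partials ks (P t f) x\<bar> \<le> kernel_const (length ks) * t powr (- real (length ks) / \<alpha>) *
      K"
    using P_abs_le[OF \<tau> \<open>\<tau> \<le> T\<close> g] by (simp add: eq)
qed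

lemma diff_upto_P: "diff_upto n (P t f)"
  by (simp add: diff_upto_def partials_P_differentiable)

end

text \<open>The innermost derivative falls on \<open>P f\<close> at time \<open>t / 2\<close>, which is as Lipschitz as \<open>f\<close>, and
  the others are paid during the remaining time \<open>t / 2\<close>.\<close>

lemma abs_partials_P_lipschitz_le:
  assumes t: "0 < t" "t \<le> T" and f: "f \<in> borel_measurable borel" and bdd: "\<And>x. \<bar>f x\<bar> \<le> B"
    and lip: "\<And>x y. \<bar>f x - f y\<bar> \<le> \<Lambda> * norm (x - y)"
  shows "\<bar>partials (ks @ [j]) (P t f) x\<bar> \<le> kernel_const (length ks) * (t / 2) powr (- real (length ks) /
      \<alpha>) * \<Lambda>"
proof -
  have t2: "0 < t / 2" "t / 2 \<le> T" using t by auto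
  have bound: "\<bar>partial i (P (t / 2) f) x\<bar> \<le> \<Lambda>" for i x
    by (rule abs_partial_le_lipschitz[OF P_differentiable[OF t2 f bdd] P_lipschitz[OF t2 f bdd lip]])
  have "P t f = P (t / 2) (P (t / 2) f)"
    using P_semigroup[OF t2(1) t2(1) _ f bdd] t by simp
  then have "partials (ks @ [j]) (P t f) = partials ks (P (t / 2) (partial j (P (t / 2) f)))"
    using partial_P_commute[OF t2 P_measurable[OF t2 f bdd] P_abs_le[OF t2 f bdd] P_differentiable[OF t2
        f bdd] bound]
    by (simp add: partials_append)
  then show ?thesis
    using abs_partials_P_le[OF t2 borel_measurable_partial[OF P_differentiable[OF t2 f bdd]] bound]
        by simp
qed

definition smoothing_const :: "nat \<Rightarrow> real" where
  "smoothing_const k = kernel_const k + kernel_const (k - 1) * 2 powr (real (k - 1) / \<alpha>)"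

lemma smoothing_const_nonneg: "0 \<le> smoothing_const k"
  by (simp add: smoothing_const_def kernel_const_nonneg)

text \<open>Interpolation between the bounds for bounded and for Lipschitz functions: at the scale \<open>\<epsilon> =
  t powr (1/\<alpha>)\<close> the Lipschitz approximation of \<open>f\<close> and the remainder contribute equally.
  Estimating \<open>\<integral> |D\<^sup>kp\<^sub>t(y)| |y|\<^sup>\<theta> dy\<close> instead would require moments, which a heavy-tailed kernel
  may lack.\<close>

lemma abs_partials_P_hoelder_le:
  assumes t: "0 < t" "t \<le> T" and f: "f \<in> borel_measurable borel" and bdd: "\<And>x. \<bar>f x\<bar> \<le> B"
    and hoelder: "\<And>x y. \<bar>f x - f y\<bar> \<le> K * norm (x - y) powr \<theta>"
    and K: "0 \<le> K" and \<theta>: "0 \<le> \<theta>" "\<theta> \<le> 1" and ks: "1 \<le> length ks"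
  shows "\<bar>partials ks (P t f) x\<bar> \<le> smoothing_const (length ks) * K * t powr (- (real (length ks) - \<theta>) /
      \<alpha>)"
proof -
  define k where "k = length ks - 1"
  obtain js j where js: "ks = js @ [j]" using ks by (cases ks rule: rev_cases) auto
  have len: "length js = k" "length ks = Suc k" by (auto simp: k_def js)
  define \<epsilon> where "\<epsilon> = t powr (1 / \<alpha>)"
  have \<epsilon>: "0 < \<epsilon>" using t by (simp add: \<epsilon>_def)
  have \<epsilon>_powr: "\<epsilon> powr r = t powr (r / \<alpha>)" for r by (simp add: \<epsilon>_def powr_powr)
  obtain g where g_lip: "\<And>x y. \<bar>g x - g y\<bar> \<le> K * \<epsilon> powr (\<theta> - 1) * norm (x - y)"
    and fg: "\<And>x. \<bar>f x - g x\<bar> \<le> K * \<epsilon> powr \<theta>"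
    using lipschitz_approximation[OF bdd hoelder K \<theta> \<epsilon>] by blast
  have g_cont: "continuous_on UNIV g"
  proof -
    have "(K * \<epsilon> powr (\<theta> - 1))-lipschitz_on UNIV g"
      using g_lip K by (intro lipschitz_onI) (auto simp: dist_real_def dist_norm)
    then show ?thesis by (rule lipschitz_on_continuous_on)
  qed
  have g: "g \<in> borel_measurable borel" by (rule borel_measurable_continuous_onI[OF g_cont])
  have g_bdd: "\<bar>g x\<bar> \<le> B + K * \<epsilon> powr \<theta>" for x using fg[of x] bdd[of x] by linarith
  have fg_meas: "(\<lambda>x. f x - g x) \<in> borel_measurable borel" using f g by measurable
  have "P t (\<lambda>y. g y + (f y - g y)) = (\<lambda>x. P t g x + P t (\<lambda>x. f x - g x) x)"
    by (rule P_add[OF t g g_bdd fg_meas fg])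
  then have "P t f = (\<lambda>x. P t g x + P t (\<lambda>x. f x - g x) x)" by simp
  then have eq: "partials ks (P t f) x = partials ks (P t g) x + partials ks (P t (\<lambda>x. f x - g x)) x"
    using partials_add[OF diff_upto_P[OF t g g_bdd] diff_upto_P[OF t fg_meas fg], of ks "length ks"]
        by simp
  let ?t = "t powr (- (real (length ks) - \<theta>) / \<alpha>)"
  have 1: "\<bar>partials ks (P t (\<lambda>x. f x - g x)) x\<bar> \<le> kernel_const (length ks) * K * ?t"
  proof -
    have "t powr (- real (length ks) / \<alpha>) * \<epsilon> powr \<theta> = ?t"
      using t by (simp add: \<epsilon>_powr powr_add[symmetric] diff_divide_distrib)
    then have "kernel_const (length ks) * t powr (- real (length ks) / \<alpha>) * (K * \<epsilon> powr \<theta>) =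
        kernel_const (length ks) * K * ?t"
      by (metis mult.assoc mult.left_commute)
    then show ?thesis using abs_partials_P_le[OF t fg_meas fg, of ks x] by (simp only:)
  qed
  have 2: "\<bar>partials ks (P t g) x\<bar> \<le> kernel_const k * 2 powr (real k / \<alpha>) * K * ?t"
  proof -
    have "(t / 2) powr (- real k / \<alpha>) * \<epsilon> powr (\<theta> - 1) =
        2 powr (real k / \<alpha>) * (t powr (- real k / \<alpha>) * t powr ((\<theta> - 1) / \<alpha>))"
      using t by (simp add: \<epsilon>_powr powr_divide powr_minus field_simps)
    also have "t powr (- real k / \<alpha>) * t powr ((\<theta> - 1) / \<alpha>) = ?t"
      using t by (simp add: powr_add[symmetric] len diff_divide_distrib add_divide_distrib
          algebra_simps)
    finally have *: "(t / 2) powr (- real k / \<alpha>) * \<epsilon> powr (\<theta> - 1) = 2 powr (real k / \<alpha>) * ?t" .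
    have "\<bar>partials ks (P t g) x\<bar> \<le> kernel_const k * (t / 2) powr (- real k / \<alpha>) * (K * \<epsilon> powr (\<theta> - 1))"
      using abs_partials_P_lipschitz_le[OF t g g_bdd g_lip, of js j x] by (simp only: js[symmetric] len)
    also have "\<dots> = kernel_const k * ((t / 2) powr (- real k / \<alpha>) * \<epsilon> powr (\<theta> - 1)) * K"
        by (simp only: mult_ac)
    finally show ?thesis by (simp only: *) (simp add: mult_ac)
  qed
  have "smoothing_const (length ks) * K * ?t = kernel_const k * 2 powr (real k / \<alpha>) * K * ?t +
      kernel_const (length ks) * K * ?t"
    by (simp add: smoothing_const_def k_def algebra_simps)
  with 1 2 eq show ?thesis by linarith
qed

end

section \<open>Integrals of singular powers\<close>

lemma le_powr_interpolate:
  fixes z X Y :: real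
  assumes "0 \<le> z" "z \<le> X" "z \<le> Y" "0 \<le> \<kappa>" "\<kappa> \<le> 1"
  shows "z \<le> X powr (1 - \<kappa>) * Y powr \<kappa>"
proof (cases "z = 0")
  case False
  then have "z = z powr (1 - \<kappa>) * z powr \<kappa>" using assms by (simp flip: powr_add)
  also have "\<dots> \<le> X powr (1 - \<kappa>) * Y powr \<kappa>"
    using assms by (intro mult_mono powr_mono2) auto
  finally show ?thesis .
qed simp

lemma powr_integral_0:
  fixes a t :: real
  assumes "a < 1" "0 \<le> t"
  shows "integrable lborel (\<lambda>s. indicator {0<..<t} s * s powr - a)"
    and "(\<integral>s. indicator {0<..<t} s * s powr - a \<partial>lborel) = t powr (1 - a) / (1 - a)"
proof -
  let ?I = "t powr (1 - a) / (1 - a)"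
  have "((\<lambda>s. s powr - a) has_integral ?I) {0..t}"
    using has_integral_powr_from_0[of "- a" t] assms by (simp add: algebra_simps)
  then have "((\<lambda>s. s powr - a) has_integral ?I) {0<..<t}"
    by (simp add: has_integral_Icc_iff_Ioo)
  moreover have "(\<lambda>s. indicator {0<..<t} s * s powr - a) = (\<lambda>s. if s \<in> {0<..<t} then s powr - a else 0)"
    by (auto simp: indicator_def)
  ultimately have "((\<lambda>s. indicator {0<..<t} s * s powr - a) has_integral ?I) UNIV"
    by (simp only: has_integral_restrict_UNIV)
  then have nn: "(\<integral>\<^sup>+s. ennreal (indicator {0<..<t} s * s powr - a) \<partial>lborel) = ennreal ?I"
    by (intro nn_integral_has_integral_lborel) auto
  then show "integrable lborel (\<lambda>s. indicator {0<..<t} s * s powr - a)"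
    by (intro integrableI_nonneg) auto
  show "(\<integral>s. indicator {0<..<t} s * s powr - a \<partial>lborel) = ?I"
    using nn assms by (subst integral_eq_nn_integral) auto
qed

lemma powr_integral_inf:
  fixes b \<delta> :: real
  assumes "1 < b" "0 < \<delta>"
  shows "integrable lborel (\<lambda>s. indicator {\<delta>..} s * s powr - b)"
    and "(\<integral>s. indicator {\<delta>..} s * s powr - b \<partial>lborel) = \<delta> powr (1 - b) / (b - 1)"
proof -
  let ?I = "\<delta> powr (1 - b) / (b - 1)"
  have "- (\<delta> powr (- b + 1)) / (- b + 1) = ?I"
    using assms by (simp add: divide_simps) (simp add: algebra_simps)
  then have "((\<lambda>s. s powr - b) has_integral ?I) {\<delta>..}"
    using has_integral_powr_to_inf[of "- b" \<delta>] assms by simp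
  moreover have "(\<lambda>s. indicator {\<delta>..} s * s powr - b) = (\<lambda>s. if s \<in> {\<delta>..} then s powr - b else 0)"
    by (auto simp: indicator_def)
  ultimately have "((\<lambda>s. indicator {\<delta>..} s * s powr - b) has_integral ?I) UNIV"
    by (simp only: has_integral_restrict_UNIV)
  then have nn: "(\<integral>\<^sup>+s. ennreal (indicator {\<delta>..} s * s powr - b) \<partial>lborel) = ennreal ?I"
    by (intro nn_integral_has_integral_lborel) auto
  then show "integrable lborel (\<lambda>s. indicator {\<delta>..} s * s powr - b)"
    by (intro integrableI_nonneg) auto
  show "(\<integral>s. indicator {\<delta>..} s * s powr - b \<partial>lborel) = ?I"
    using nn assms by (subst integral_eq_nn_integral) auto
qed

lemma powr_integral_reflect:
  fixes a t :: real
  assumes "a < 1" "0 \<le> t"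
  shows "integrable lborel (\<lambda>s. indicator {0<..<t} s * (t - s) powr - a)"
    and "(\<integral>s. indicator {0<..<t} s * (t - s) powr - a \<partial>lborel) = t powr (1 - a) / (1 - a)"
proof -
  have *: "indicator {0<..<t} (t - s) = (indicator {0<..<t} s :: real)" for s
      by (auto simp: indicator_def)
  show "integrable lborel (\<lambda>s. indicator {0<..<t} s * (t - s) powr - a)"
    using integrable_lborel_reflect[OF powr_integral_0(1)[OF assms], of t] by (simp add: *)
  show "(\<integral>s. indicator {0<..<t} s * (t - s) powr - a \<partial>lborel) = t powr (1 - a) / (1 - a)"
    using integral_lborel_reflect[of "\<lambda>s. indicator {0<..<t} s * s powr - a" t] powr_integral_0(2)[OF
        assms] by (simp add: *)
qed

definition beta_const :: "real \<Rightarrow> real \<Rightarrow> real" where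
  "beta_const a b = 2 powr a / (1 - b) + 2 powr b / (1 - a)"

lemma beta_const_nonneg: "a < 1 \<Longrightarrow> b < 1 \<Longrightarrow> 0 \<le> beta_const a b"
  by (simp add: beta_const_def)

text \<open>An upper bound for the Beta integral, from estimating on each half of the interval the
  factor that is not singular there.\<close>

lemma beta_integral_le:
  fixes a b t :: real
  assumes a: "0 \<le> a" "a < 1" and b: "0 \<le> b" "b < 1" and t: "0 < t"
  shows "set_integrable lborel {0<..<t} (\<lambda>s. s powr - b * (t - s) powr - a)"
    and "(LINT s:{0<..<t}|lborel. s powr - b * (t - s) powr - a) \<le> beta_const a b * t powr (1 - a - b)"
proof -
  let ?D = "\<lambda>s. (t / 2) powr - a * (indicator {0<..<t} s * s powr - b) + (t / 2) powr - b * (indicator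
      {0<..<t} s * (t - s) powr - a)"
  have int: "integrable lborel ?D"
    using powr_integral_0(1)[of b t] powr_integral_reflect(1)[of a t] a b t by simp
  have le: "indicator {0<..<t} s *\<^sub>R (s powr - b * (t - s) powr - a) \<le> ?D s" for s
  proof (cases "s \<in> {0<..<t}")
    case True
    show ?thesis
    proof (cases "s \<le> t / 2")
      case le: True
      then have "(t - s) powr - a \<le> (t / 2) powr - a" using True t a by (intro powr_mono2') auto
      then have "s powr - b * (t - s) powr - a \<le> (t / 2) powr - a * s powr - b"
        by (simp add: mult.commute mult_left_mono)
      then show ?thesis using True by (simp add: add_increasing2)
    next
      case False
      then have "s powr - b \<le> (t / 2) powr - b" using True t b by (intro powr_mono2') auto
      then have "s powr - b * (t - s) powr - a \<le> (t / 2) powr - b * (t - s) powr - a"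
        by (simp add: mult_right_mono)
      then show ?thesis using True by (simp add: add_increasing)
    qed
  qed simp
  show *: "set_integrable lborel {0<..<t} (\<lambda>s. s powr - b * (t - s) powr - a)"
    unfolding set_integrable_def
    by (rule Bochner_Integration.integrable_bound[OF int]) 
       (use le in \<open>auto simp: abs_mult intro!: order_trans[OF _ abs_ge_self]\<close>)
  have "(LINT s:{0<..<t}|lborel. s powr - b * (t - s) powr - a) \<le> (\<integral>s. ?D s \<partial>lborel)"
    unfolding set_lebesgue_integral_def using * int le
        by (intro integral_mono) (auto simp: set_integrable_def)
  also have "\<dots> = (t / 2) powr - a * (t powr (1 - b) / (1 - b)) + (t / 2) powr - b * (t powr (1 - a) / (1
      - a))"
    using powr_integral_0[of b t] powr_integral_reflect[of a t] a b t by simp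
  also have "\<dots> = beta_const a b * t powr (1 - a - b)"
  proof -
    have "(t / 2) powr - a * t powr (1 - b) = 2 powr a * t powr (1 - a - b)"
      using t by (simp add: powr_divide powr_minus field_simps flip: powr_add) 
    moreover have "(t / 2) powr - b * t powr (1 - a) = 2 powr b * t powr (1 - a - b)"
      using t by (simp add: powr_divide powr_minus field_simps flip: powr_add) 
    ultimately show ?thesis by (simp add: beta_const_def algebra_simps)
  qed
  finally show "(LINT s:{0<..<t}|lborel. s powr - b * (t - s) powr - a) \<le>
      beta_const a b * t powr (1 - a - b)" .
qed

lemma abs_set_integral_le:
  fixes g G :: "real \<Rightarrow> real"
  assumes "set_integrable lborel S g" "set_integrable lborel S G" "\<And>s. s \<in> S \<Longrightarrow> \<bar>g s\<bar> \<le> G s"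
  shows "\<bar>LINT s:S|lborel. g s\<bar> \<le> (LINT s:S|lborel. G s)"
  unfolding set_lebesgue_integral_def
  by (rule order_trans[OF integral_abs_bound integral_mono])
     (use assms in \<open>auto simp: set_integrable_def indicator_def\<close>)

definition critical_const :: "real \<Rightarrow> real \<Rightarrow> real \<Rightarrow> real" where
  "critical_const \<theta> a b = 2 powr \<theta> * (1 / (1 - a) + 1 / (b - 1)) + 2 / (1 - \<theta>)"

text \<open>The two bounds on \<open>g\<close> have exponents on either side of the critical value \<open>-1\<close> in \<open>t - s\<close>.
  For \<open>s > t / 2\<close> the weight \<open>s powr -\<theta>\<close> is harmless, and one uses the better bound on each side
  of \<open>t - s = \<delta>\<close>, where they agree. For \<open>s \<le> t / 2\<close> their geometric mean with weight \<open>\<kappa> = (1 -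
  a)/(b - a)\<close> is, up to \<open>A s powr -\<theta>\<close>, equal to \<open>r powr \<kappa> / (t - s)\<close>, which is of size \<open>r powr \<kappa> /
  t\<close>.\<close>

lemma critical_integral_le:
  fixes g :: "real \<Rightarrow> real"
  assumes t: "0 < t" and \<theta>: "0 \<le> \<theta>" "\<theta> < 1" and a: "0 \<le>
      a" "a < 1" and b: "1 < b" and r: "0 < r" and A: "0 \<le> A"
    and g: "set_integrable lborel {0<..<t} g"
    and le_a: "\<And>s. 0 < s \<Longrightarrow> s < t \<Longrightarrow> \<bar>g s\<bar> \<le> A * s powr - \<theta> * (t - s) powr - a"
    and le_b: "\<And>s. 0 < s \<Longrightarrow> s < t \<Longrightarrow> \<bar>g s\<bar> \<le> A * r * s powr - \<theta> * (t - s) powr - b"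
  shows "\<bar>LINT s:{0<..<t}|lborel. g s\<bar> \<le> critical_const \<theta> a b * A * r powr ((1 - a) / (b - a)) * t powr
      - \<theta>"
proof -
  define \<kappa> where "\<kappa> = (1 - a) / (b - a)"
  define \<delta> where "\<delta> = r powr (1 / (b - a))"
  have \<delta>: "0 < \<delta>" using r by (simp add: \<delta>_def)
  have \<kappa>: "0 \<le> \<kappa>" "\<kappa> \<le> 1" "a * (1 - \<kappa>) + b * \<kappa> = 1"
  proof -
    show "0 \<le> \<kappa>" "\<kappa> \<le> 1" using a b by (auto simp: \<kappa>_def)
    have "\<kappa> * (b - a) = 1 - a" using a b by (simp add: \<kappa>_def)
    then show "a * (1 - \<kappa>) + b * \<kappa> = 1" by (simp add: algebra_simps)
  qed
  define \<Phi> where "\<Phi> \<tau> = indicator {0<..<\<delta>} \<tau> * \<tau> powr - a + r * (indicator {\<delta>..} \<tau> * \<tau> powr - b)" for \<tau>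
  have \<Phi>_nonneg: "0 \<le> \<Phi> \<tau>" for \<tau> using r by (simp add: \<Phi>_def)
  have \<Phi>_int: "integrable lborel \<Phi>" 
    unfolding \<Phi>_def[abs_def] using powr_integral_0(1)[of a \<delta>] powr_integral_inf(1)[of b \<delta>] a b \<delta> by simp
  have \<Phi>_integral: "(\<integral>\<tau>. \<Phi> \<tau> \<partial>lborel) = r powr \<kappa> * (1 / (1 - a) + 1 / (b - 1))"
  proof -
    have "\<delta> powr (1 - a) = r powr \<kappa>" by (simp add: \<delta>_def \<kappa>_def powr_powr)
    moreover have "r * \<delta> powr (1 - b) = r powr \<kappa>"
    proof -
      have "r * \<delta> powr (1 - b) = r powr (1 + (1 - b) / (b - a))"
        using r by (simp add: \<delta>_def powr_powr powr_add)
      also have "1 + (1 - b) / (b - a) = \<kappa>" using a b by (simp add: \<kappa>_def field_simps)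
      finally show ?thesis .
    qed
    moreover have "(\<integral>\<tau>. \<Phi> \<tau> \<partial>lborel) = \<delta> powr (1 - a) / (1 - a) + r * (\<delta> powr (1 - b) / (b - 1))"
      unfolding \<Phi>_def using powr_integral_0[of a \<delta>] powr_integral_inf[of b \<delta>] a b \<delta> by simp
    ultimately show ?thesis by (simp add: field_simps)
  qed
  let ?D = "\<lambda>s. A * ((t / 2) powr - \<theta> * \<Phi> (t - s) + r powr \<kappa> * (2 / t) * (indicator {0<..<t} s * s powr
      - \<theta>))"
  have int: "integrable lborel ?D"
    using integrable_lborel_reflect[OF \<Phi>_int, of t] powr_integral_0(1)[of \<theta> t] \<theta> t by simp
  have le: "indicator {0<..<t} s * \<bar>g s\<bar> \<le> ?D s" for s
  proof (cases "s \<in> {0<..<t}")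
    case True
    then have s: "0 < s" "s < t" by auto
    show ?thesis
    proof (cases "s \<le> t / 2")
      case le: True
      have "\<bar>g s\<bar> \<le> (A * s powr - \<theta> * (t - s) powr - a) powr (1 - \<kappa>) * (A * r * s powr - \<theta> * (t - s)
          powr - b) powr \<kappa>"
        by (rule le_powr_interpolate[OF abs_ge_zero le_a[OF s] le_b[OF s] \<kappa>(1,2)])
      also have "\<dots> = (A powr (1 - \<kappa>) * A powr \<kappa>) * r powr \<kappa> * ((s powr - \<theta>) powr (1 - \<kappa>) * (s powr - \<theta>)
          powr \<kappa>) *
         ((t - s) powr (- a * (1 - \<kappa>)) * (t - s) powr (- b * \<kappa>))"
        using A r by (simp add: powr_mult powr_powr mult_ac)
      also have "\<dots> = A * r powr \<kappa> * s powr - \<theta> * (t - s) powr - 1"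
      proof -
        have "- a * (1 - \<kappa>) + - b * \<kappa> = - 1" using \<kappa>(3) by (simp add: algebra_simps)
        then have "(t - s) powr (- a * (1 - \<kappa>)) * (t - s) powr (- b * \<kappa>) = (t - s) powr - 1"
          by (simp only: powr_add[symmetric])
        moreover have "z powr (1 - \<kappa>) * z powr \<kappa> = z" if "0 \<le> z" for z :: real
          using that by (simp add: powr_add[symmetric])
        ultimately show ?thesis using A by simp
      qed
      also have "\<dots> \<le> A * r powr \<kappa> * s powr - \<theta> * (2 / t)"
        using le s t A by (intro mult_left_mono) (auto simp: powr_minus_divide field_simps)
      finally have "\<bar>g s\<bar> \<le> A * (r powr \<kappa> * (2 / t) * s powr - \<theta>)" by (simp add: mult_ac)
      also have "\<dots> \<le> ?D s" using True A \<Phi>_nonneg by (intro mult_left_mono) auto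
      finally show ?thesis using True by simp
    next
      case False
      have "\<bar>g s\<bar> \<le> A * s powr - \<theta> * \<Phi> (t - s)"
        using le_a[OF s] le_b[OF s] s by (auto simp: \<Phi>_def indicator_def mult_ac)
      also have "\<dots> \<le> A * (t / 2) powr - \<theta> * \<Phi> (t - s)"
        using False s t \<theta> A \<Phi>_nonneg by (intro mult_right_mono mult_left_mono powr_mono2') auto
      also have "\<dots> = A * ((t / 2) powr - \<theta> * \<Phi> (t - s))" by simp
      also have "\<dots> \<le> ?D s" using t A by (intro mult_left_mono) (auto simp: indicator_def)
      finally show ?thesis using True by simp
    qed
  next
    case False
    then show ?thesis using A \<Phi>_nonneg by simp
  qed
  have "\<bar>LINT s:{0<..<t}|lborel. g s\<bar> \<le> (\<integral>s. \<bar>indicator {0<..<t} s *\<^sub>R g s\<bar> \<partial>lborel)"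
    unfolding set_lebesgue_integral_def by (rule integral_abs_bound)
  also have "\<dots> \<le> (\<integral>s. ?D s \<partial>lborel)"
  proof (rule integral_mono[OF _ int])
    show "integrable lborel (\<lambda>s. \<bar>indicator {0<..<t} s *\<^sub>R g s\<bar>)"
      using g unfolding set_integrable_def by (rule integrable_abs)
    have "\<bar>indicator {0<..<t} s *\<^sub>R g s\<bar> = indicator {0<..<t} s * \<bar>g s\<bar>" for s
      by (simp add: abs_mult)
    then show "\<bar>indicator {0<..<t} s *\<^sub>R g s\<bar> \<le> ?D s" for s
      using le[of s] by (simp only:)
  qed
  also have "\<dots> = A * ((t / 2) powr - \<theta> * (r powr \<kappa> * (1 / (1 - a) + 1 / (b - 1))) + r powr \<kappa> * (2 / t) *
      (t powr (1 - \<theta>) / (1 - \<theta>)))"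
    using integrable_lborel_reflect[OF \<Phi>_int, of t] powr_integral_0[of \<theta> t] \<theta> t \<Phi>_integral
      integral_lborel_reflect[of \<Phi> t] borel_measurable_integrable[OF \<Phi>_int] by simp
  also have "\<dots> = critical_const \<theta> a b * A * r powr \<kappa> * t powr - \<theta>"
  proof -
    have "(t / 2) powr - \<theta> = 2 powr \<theta> * t powr - \<theta>" using t
        by (simp add: powr_divide powr_minus field_simps)
    moreover have "(2 / t) * (t powr (1 - \<theta>) / (1 - \<theta>)) = 2 / (1 - \<theta>) * t powr - \<theta>"
      using t by (simp add: powr_diff powr_minus field_simps)
    ultimately show ?thesis by (simp only: critical_const_def mult.assoc) (simp add: algebra_simps)
  qed
  finally show ?thesis by (simp add: \<kappa>_def)
qed

section \<open>The Duhamel term\<close>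

context smoothing_semigroup begin

definition diff_const :: "nat \<Rightarrow> real" where
  "diff_const k = 2 * smoothing_const k + CARD('n) * smoothing_const (Suc k)"

lemma diff_const_nonneg: "0 \<le> diff_const k"
  using smoothing_const_nonneg[of k] smoothing_const_nonneg[of "Suc k"] by (simp add: diff_const_def)

text \<open>Two bounds for an increment: by the triangle inequality, and by the mean value inequality at
  the cost of one more derivative. A common constant for both keeps the interpolations between
  them simple.\<close>

lemma partials_P_diff_le:
  assumes t: "0 < t" "t \<le> T" and f: "f \<in> borel_measurable borel" and bdd: "\<And>x. \<bar>f x\<bar> \<le> B"
    and hoelder: "\<And>x y. \<bar>f x - f y\<bar> \<le> K * norm (x - y) powr \<theta>"
    and K: "0 \<le> K" and \<theta>: "0 \<le> \<theta>" "\<theta> \<le> 1" and ks: "1 \<le> length ks"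
  shows "\<bar>partials ks (P t f) (x + h) - partials ks (P t f) x\<bar> \<le>
      diff_const (length ks) * K * t powr (- (real (length ks) - \<theta>) / \<alpha>)"
    and "\<bar>partials ks (P t f) (x + h) - partials ks (P t f) x\<bar> \<le>
      diff_const (length ks) * K * norm h * t powr (- (real (length ks) + 1 - \<theta>) / \<alpha>)"
proof -
  let ?k = "length ks" and ?g = "partials ks (P t f)"
  let ?t = "t powr (- (real ?k - \<theta>) / \<alpha>)" and ?t' = "t powr (- (real ?k + 1 - \<theta>) / \<alpha>)"
  note S = abs_partials_P_hoelder_le[OF t f bdd hoelder K \<theta>]
  have le: "2 * smoothing_const ?k \<le> diff_const ?k" "CARD('n) * smoothing_const (Suc ?k) \<le>
      diff_const ?k"
    using smoothing_const_nonneg[of ?k] smoothing_const_nonneg[of "Suc ?k"]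
        by (simp_all add: diff_const_def)
  have "\<bar>?g (x + h) - ?g x\<bar> \<le> 2 * smoothing_const ?k * K * ?t"
    using S[OF ks, of "x + h"] S[OF ks, of x] by linarith
  also have "\<dots> \<le> diff_const ?k * K * ?t"
    using le(1) K by (intro mult_right_mono) auto
  finally show "\<bar>?g (x + h) - ?g x\<bar> \<le> diff_const ?k * K * ?t" .
  have "\<bar>?g (x + h) - ?g x\<bar> \<le> CARD('n) * (smoothing_const (Suc ?k) * K * ?t') * norm ((x + h) - x)"
  proof (rule abs_diff_le_partial_bound)
    show "?g differentiable (at y)" for y by (rule partials_P_differentiable[OF t f bdd])
    show "\<bar>partial i ?g y\<bar> \<le> smoothing_const (Suc ?k) * K * ?t'" for i y
      using S[of "i # ks" y] by (simp add: add.commute)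
  qed
  also have "\<dots> = CARD('n) * smoothing_const (Suc ?k) * (K * norm h * ?t')" by (simp add: mult_ac)
  also have "\<dots> \<le> diff_const ?k * (K * norm h * ?t')"
    using le(2) K by (intro mult_right_mono) auto
  finally show "\<bar>?g (x + h) - ?g x\<bar> \<le> diff_const ?k * K * norm h * ?t'" by (simp add: mult.assoc)
qed

lemma partials_P_lipschitz_diff_le:
  assumes t: "0 < t" "t \<le> T" and f: "f \<in> borel_measurable borel" and bdd: "\<And>x. \<bar>f x\<bar> \<le> B"
    and lip: "\<And>x y. \<bar>f x - f y\<bar> \<le> \<Lambda> * norm (x - y)" and \<Lambda>: "0 \<le> \<Lambda>"
    and \<kappa>: "0 \<le> \<kappa>" "\<kappa> \<le> 1" and ks: "1 \<le> length ks" and h: "h \<noteq> 0"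
  shows "\<bar>partials ks (P t f) (x + h) - partials ks (P t f) x\<bar> \<le>
    diff_const (length ks) * \<Lambda> * norm h powr \<kappa> * t powr (- (real (length ks) - 1 + \<kappa>) / \<alpha>)"
proof -
  let ?k = "real (length ks)"
  define A where "A = diff_const (length ks) * \<Lambda>"
  have A: "0 \<le> A" using \<Lambda> diff_const_nonneg by (simp add: A_def)
  have hoelder: "\<And>x y. \<bar>f x - f y\<bar> \<le> \<Lambda> * norm (x - y) powr 1" using lip by simp
  have "\<bar>partials ks (P t f) (x + h) - partials ks (P t f) x\<bar> \<le>
    (A * t powr (- (?k - 1) / \<alpha>)) powr (1 - \<kappa>) * (A * norm h * t powr (- (?k + 1 - 1) / \<alpha>)) powr \<kappa>"
    unfolding A_def
    by (rule le_powr_interpolate[OF abs_ge_zero partials_P_diff_le(1)[OF t f bdd hoelder \<Lambda> _ _ ks]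
        partials_P_diff_le(2)[OF t f bdd hoelder \<Lambda> _ _ ks] \<kappa>]) auto
  also have "\<dots> = (A powr (1 - \<kappa>) * A powr \<kappa>) * norm h powr \<kappa> *
     (t powr (- (?k - 1) / \<alpha> * (1 - \<kappa>)) * t powr (- (?k + 1 - 1) / \<alpha> * \<kappa>))"
    using A by (simp add: powr_mult powr_powr mult_ac)
  also have "A powr (1 - \<kappa>) * A powr \<kappa> = A" using A by (simp add: powr_add[symmetric])
  also have "t powr (- (?k - 1) / \<alpha> * (1 - \<kappa>)) * t powr (- (?k + 1 - 1) / \<alpha> * \<kappa>) =
      t powr (- (?k - 1 + \<kappa>) / \<alpha>)"
  proof -
    have "- (?k - 1) / \<alpha> * (1 - \<kappa>) + - (?k + 1 - 1) / \<alpha> * \<kappa> = - (?k - 1 + \<kappa>) / \<alpha>"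
      using \<alpha>_pos by (simp add: field_simps)
    then show ?thesis by (simp only: powr_add[symmetric])
  qed
  finally show ?thesis by (simp add: A_def)
qed

text \<open>The increment of \<open>DP\<^sub>t f\<close> is \<open>DP\<^sub>t\<close> of the increment of \<open>f\<close>.\<close>

lemma partial_P_translation_diff_le:
  assumes t: "0 < t" "t \<le> T" and f: "f \<in> borel_measurable borel" and bdd: "\<And>x. \<bar>f x\<bar> \<le> B"
    and D: "\<And>y. \<bar>f (y + h) - f y\<bar> \<le> D"
  shows "\<bar>partial i (P t f) (x + h) - partial i (P t f) x\<bar> \<le> c * t powr (- 1 / \<alpha>) * D"
proof -
  define d where "d y = f (y + h) - f y" for y
  have d: "d \<in> borel_measurable borel" "\<And>y. \<bar>d y\<bar> \<le> D" 
    using f D unfolding d_def by (auto intro!: borel_measurable_diff measurable_compose[OF _ f])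
  have "partial i (P t f) (x + h) = partial i (\<lambda>y. P t f (y + h)) x"
    by (rule partial_shift[symmetric, OF P_differentiable[OF t f bdd]])
  also have "(\<lambda>y. P t f (y + h)) = P t (\<lambda>y. f y + d y)"
    using P_translate[OF t f bdd] by (simp add: d_def fun_eq_iff)
  also have "\<dots> = (\<lambda>y. P t f y + P t d y)" by (rule P_add[OF t f bdd d])
  also have "partial i \<dots> x = partial i (P t f) x + partial i (P t d) x"
    by (rule partial_add[OF P_differentiable[OF t f bdd] P_differentiable[OF t d]])
  finally show ?thesis using abs_partial_P_le[OF t d] by simp
qed

definition duhamel :: "(real \<Rightarrow> real ^ 'n \<Rightarrow> real) \<Rightarrow> real \<Rightarrow> real ^ 'n \<Rightarrow> real" where
  "duhamel f t x = (LINT s:{0<..<t}|lborel. P (t - s) (f s) x)"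

context
  fixes t F K \<beta> :: real and f :: "real \<Rightarrow> real ^ 'n \<Rightarrow> real"
  assumes t: "0 < t" "t \<le> T" and \<alpha>: "1 < \<alpha>" and \<beta>: "0 \<le> \<beta>" "\<beta> \<le> 1" and K: "0 \<le> K"
    and f_meas: "\<And>s. 0 < s \<Longrightarrow> s < t \<Longrightarrow> f s \<in> borel_measurable borel"
    and f_bdd: "\<And>s x. 0 < s \<Longrightarrow> s < t \<Longrightarrow> \<bar>f s x\<bar> \<le> F"
    and f_hoelder: "\<And>s x y. 0 < s \<Longrightarrow> s < t \<Longrightarrow> \<bar>f s x - f s y\<bar> \<le>
        K * s powr (- \<beta> / \<alpha>) * norm (x - y) powr \<beta>"
    and f_int: "\<And>x. set_integrable lborel {0<..<t} (\<lambda>s. P (t - s) (f s) x)"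
begin

text \<open>The majorant of the derivatives of order \<open>k\<close> of \<open>P\<^sub>t\<^sub>-\<^sub>s f(s)\<close>. It is integrable over \<open>(0,
  t)\<close> when \<open>k - \<beta> < \<alpha>\<close>, as \<open>\<beta> < \<alpha>\<close>.\<close>

definition duhamel_bound :: "nat \<Rightarrow> real \<Rightarrow> real" where
  "duhamel_bound k s = smoothing_const k * K * (s powr - (\<beta> / \<alpha>) * (t - s) powr - ((real k - \<beta>) / \<alpha>))"

lemma abs_partials_P_duhamel_le:
  assumes "0 < s" "s < t" "1 \<le> length ks"
  shows "\<bar>partials ks (P (t - s) (f s)) x\<bar> \<le> duhamel_bound (length ks) s"
proof -
  have "0 < t - s" "t - s \<le> T" "0 \<le> K * s powr (- \<beta> / \<alpha>)" using assms t K by auto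
  from abs_partials_P_hoelder_le[OF this(1,2) f_meas[OF assms(1,2)] f_bdd[OF assms(1,2)] f_hoelder[OF
      assms(1,2)] this(3) \<beta> assms(3), of x]
  show ?thesis by (simp only: duhamel_bound_def minus_divide_left mult_ac)
qed

lemma duhamel_bound_integral:
  assumes k: "1 \<le> k" "real k - \<beta> < \<alpha>"
  shows "set_integrable lborel {0<..<t} (duhamel_bound k)"
    and "(LINT s:{0<..<t}|lborel. duhamel_bound k s) \<le> 
      smoothing_const k * K * beta_const ((real k - \<beta>) / \<alpha>) (\<beta> / \<alpha>) * t powr (1 - real k / \<alpha>)"
proof -
  have a: "0 \<le> (real k - \<beta>) / \<alpha>" "(real k - \<beta>) / \<alpha> < 1" and b: "0 \<le> \<beta> / \<alpha>" "\<beta> / \<alpha> < 1"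
    using k \<beta> \<alpha> by auto
  note bi = beta_integral_le[OF a b t(1)]
  show "set_integrable lborel {0<..<t} (duhamel_bound k)"
    unfolding duhamel_bound_def[abs_def] by (rule set_integrable_mult_right[OF bi(1)])
  have "(LINT s:{0<..<t}|lborel. duhamel_bound k s) \<le> 
     smoothing_const k * K * (beta_const ((real k - \<beta>) / \<alpha>) (\<beta> / \<alpha>) * t powr (1 - (real k - \<beta>) / \<alpha> - \<beta> /
         \<alpha>))"
    unfolding duhamel_bound_def set_integral_mult_right
    using bi(2) K smoothing_const_nonneg by (intro mult_left_mono) auto
  also have "1 - (real k - \<beta>) / \<alpha> - \<beta> / \<alpha> = 1 - real k / \<alpha>" by (simp add: diff_divide_distrib)
  finally show "(LINT s:{0<..<t}|lborel. duhamel_bound k s) \<le> 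
      smoothing_const k * K * beta_const ((real k - \<beta>) / \<alpha>) (\<beta> / \<alpha>) * t powr (1 - real k / \<alpha>)"
    by (simp add: mult.assoc)
qed

context
  fixes m :: nat
  assumes m: "real m - \<beta> < \<alpha>"
begin

lemma
  shows set_integrable_partials_duhamel: 
      "length ks \<le> m \<Longrightarrow> set_integrable lborel {0<..<t} (\<lambda>s. partials ks (P (t - s) (f s)) x)"
    and partials_duhamel: "length ks \<le> m \<Longrightarrow>
      partials ks (duhamel f t) = (\<lambda>x. LINT s:{0<..<t}|lborel. partials ks (P (t - s) (f s)) x)"
    and diff_upto_duhamel: "diff_upto m (duhamel f t)"
proof -
  let ?M = "restrict_space lborel {0<..<t}"
  have int_iff: "integrable ?M g \<longleftrightarrow> set_integrable lborel {0<..<t} g" for g :: "real \<Rightarrow> real"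
    unfolding set_integrable_def by (rule integrable_restrict_space) simp
  have integral_eq: "(\<integral>s. g s \<partial>?M) = (LINT s:{0<..<t}|lborel. g s)" for g :: "real \<Rightarrow> real"
    unfolding set_lebesgue_integral_def by (rule integral_restrict_space) simp
  have space: "space ?M = {0<..<t}" by (simp add: space_restrict_space)
  have duh: "duhamel f t = (\<lambda>x. \<integral>s. P (t - s) (f s) x \<partial>?M)"
    by (simp add: fun_eq_iff duhamel_def integral_eq)
  have diff: "diff_upto m (P (t - s) (f s))" if "s \<in> space ?M" for s
    using that t by (intro diff_upto_P[OF _ _ f_meas f_bdd]) (auto simp: space)
  note main = partials_under_integral[where M="?M" and m=m and g="\<lambda>s. P (t - s) (f s)" and
      B=duhamel_bound]
  have 1: "integrable ?M (\<lambda>s. P (t - s) (f s) x)" for x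
    unfolding int_iff by (rule f_int)
  have 2: "\<bar>partials ks (P (t - s) (f s)) x\<bar> \<le> duhamel_bound (length ks) s"
    if "s \<in> space ?M" "1 \<le> length ks" "length ks \<le> m" for s ks x
    using that by (intro abs_partials_P_duhamel_le) (auto simp: space)
  have 3: "integrable ?M (duhamel_bound k)" if "1 \<le> k" "k \<le> m" for k
    unfolding int_iff using that m by (intro duhamel_bound_integral) auto
  note main = main[OF 1 diff 2 3]
  show "length ks \<le> m \<Longrightarrow> set_integrable lborel {0<..<t} (\<lambda>s. partials ks (P (t - s) (f s)) x)" for ks x
    using main(1)[of ks] by (simp add: int_iff)
  show *: "length ks \<le> m \<Longrightarrow>
      partials ks (duhamel f t) = (\<lambda>x. LINT s:{0<..<t}|lborel. partials ks (P (t - s) (f s)) x)" for ks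
    using main(1)[of ks] by (simp add: integral_eq duh)
  show "diff_upto m (duhamel f t)"
    unfolding diff_upto_def
  proof (intro allI impI)
    fix ks :: "'n list" and x assume "length ks < m"
    then show "partials ks (duhamel f t) differentiable (at x)"
      using main(2)[of ks x] *[of ks] by (simp add: integral_eq)
  qed
qed

lemma abs_partials_duhamel_le:
  assumes ks: "1 \<le> length ks" "length ks \<le> m"
  shows "\<bar>partials ks (duhamel f t) x\<bar> \<le> smoothing_const (length ks) * K *
    beta_const ((real (length ks) - \<beta>) / \<alpha>) (\<beta> / \<alpha>) * t powr (1 - real (length ks) / \<alpha>)"
proof -
  have k: "real (length ks) - \<beta> < \<alpha>" using ks m by linarith
  have "\<bar>partials ks (duhamel f t) x\<bar> \<le> (LINT s:{0<..<t}|lborel. duhamel_bound (length ks) s)"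
    unfolding partials_duhamel[OF ks(2)]
    by (rule abs_set_integral_le[OF set_integrable_partials_duhamel[OF ks(2)]
        duhamel_bound_integral(1)[OF ks(1) k]])
       (auto intro: abs_partials_P_duhamel_le ks)
  also note duhamel_bound_integral(2)[OF ks(1) k]
  finally show ?thesis .
qed

text \<open>The case \<open>r = |h|\<close> of \<open>critical_integral_le\<close>: the exponents \<open>(m - \<beta>)/\<alpha>\<close> and \<open>(m + 1 - \<beta>)/\<alpha>\<close>
  differ by \<open>1/\<alpha>\<close>, so that \<open>\<kappa>\<close> becomes \<open>\<alpha> + \<beta> - m\<close>.\<close>

lemma partials_duhamel_diff_le:
  assumes m1: "1 \<le> m" "\<alpha> + \<beta> < real m + 1" and ks: "length ks = m" and h: "h \<noteq> 0"
  shows "\<bar>partials ks (duhamel f t) (x + h) - partials ks (duhamel f t) x\<bar> \<le>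
    critical_const (\<beta> / \<alpha>) ((real m - \<beta>) / \<alpha>) ((real m + 1 - \<beta>) / \<alpha>) * (diff_const m * K) *
      norm h powr (\<alpha> + \<beta> - real m) * t powr (- \<beta> / \<alpha>)"
proof -
  let ?g = "\<lambda>s. partials ks (P (t - s) (f s))"
  have a: "0 \<le> (real m - \<beta>) / \<alpha>" "(real m - \<beta>) / \<alpha> < 1" and b: "1 < (real m + 1 - \<beta>) / \<alpha>" 
    and \<theta>: "0 \<le> \<beta> / \<alpha>" "\<beta> / \<alpha> < 1"
    using m m1 \<beta> \<alpha> by auto
  note int = set_integrable_partials_duhamel[of ks]
  have "partials ks (duhamel f t) (x + h) - partials ks (duhamel f t) x =
      (LINT s:{0<..<t}|lborel. ?g s (x + h) - ?g s x)"
    using ks int by (simp add: partials_duhamel set_integral_diff)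
  also have "\<bar>\<dots>\<bar> \<le> critical_const (\<beta> / \<alpha>) ((real m - \<beta>) / \<alpha>) ((real m + 1 - \<beta>) / \<alpha>) * (diff_const m * K)
      *
      norm h powr ((1 - (real m - \<beta>) / \<alpha>) / ((real m + 1 - \<beta>) / \<alpha> - (real m - \<beta>) / \<alpha>)) * t powr - (\<beta> /
          \<alpha>)"
  proof (rule critical_integral_le[OF t(1) \<theta> a b])
    show "0 < norm h" using h by simp
    show "0 \<le> diff_const m * K" using K diff_const_nonneg by simp
    show "set_integrable lborel {0<..<t} (\<lambda>s. ?g s (x + h) - ?g s x)"
      using ks int by (intro set_integral_diff) auto
    fix s assume s: "0 < s" "s < t"
    then have s': "0 < t - s" "t - s \<le> T" using t by auto
    have K': "0 \<le> K * s powr (- \<beta> / \<alpha>)" using K by simp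
    have k1: "1 \<le> length ks" using ks m1 by simp
    note d = partials_P_diff_le[OF s' f_meas[OF s] f_bdd[OF s] f_hoelder[OF s] K' \<beta> k1]
    show "\<bar>?g s (x + h) - ?g s x\<bar> \<le> diff_const m * K * s powr - (\<beta> / \<alpha>) * (t - s) powr - ((real m - \<beta>) /
        \<alpha>)"
      using d(1)[of x h] by (simp only: ks minus_divide_left mult_ac)
    show "\<bar>?g s (x + h) - ?g s x\<bar> \<le> diff_const m * K * norm h * s powr - (\<beta> / \<alpha>) * (t - s) powr - ((real
        m + 1 - \<beta>) / \<alpha>)"
      using d(2)[of x h] by (simp only: ks minus_divide_left mult_ac)
  qed
  also have "(1 - (real m - \<beta>) / \<alpha>) / ((real m + 1 - \<beta>) / \<alpha> - (real m - \<beta>) / \<alpha>) = \<alpha> + \<beta> - real m"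
    using \<alpha> by (simp add: field_simps)
  finally show ?thesis by simp
qed

end

end

end

section \<open>Hoelder continuity of the gradient\<close>

lemma exp_minus_le_powr:
  fixes x \<eta> :: real
  assumes "0 < x" "0 \<le> \<eta>" "\<eta> \<le> 1"
  shows "exp (- x) \<le> x powr - \<eta>"
proof -
  have "x powr \<eta> \<le> exp x"
    using powr_le_1_plus[of x \<eta>] exp_ge_add_one_self[of x] assms by linarith
  moreover have "0 < x powr \<eta>" using assms by simp
  ultimately have "inverse (exp x) \<le> inverse (x powr \<eta>)" by (rule le_imp_inverse_le)
  then show ?thesis by (simp add: exp_minus powr_minus)
qed

context smoothing_semigroup begin

text \<open>Gronwall's inequality for the kernel \<open>(t - s) powr (-1/\<alpha>)\<close>. In the weighted norm \<open>N = sup\<^sub>t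
  w(t) / (|h|\<^sup>\<beta> t powr (-\<beta>/\<alpha>) exp (\<omega> t))\<close> the integral operator has small norm for large \<open>\<omega>\<close>,
  since \<open>exp (- \<omega> (t - s))\<close> is at most \<open>(\<omega> (t - s)) powr -\<eta>\<close> and the kernel remains integrable for
  small \<open>\<eta>\<close>. This gives \<open>N \<le> a + N / 2\<close> with \<open>a\<close> independent of \<open>h\<close>, hence \<open>N \<le> 2 a\<close>; that \<open>N\<close> is
  finite follows from the boundedness of \<open>Du\<close>, which also settles the case \<open>|h| \<ge> 1\<close>.\<close>

lemma gradient_hoelder:
  fixes u f :: "real \<Rightarrow> real ^ 'n \<Rightarrow> real" and u\<^sub>0 :: "real ^ 'n \<Rightarrow> real"
  assumes \<alpha>: "1 < \<alpha>" and \<beta>: "0 \<le> \<beta>" "\<beta> \<le> 1" and nn: "0 \<le> \<Lambda>" "0 \<le> M" "0 \<le> L"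
    and u0_meas: "u\<^sub>0 \<in> borel_measurable borel" and u0_bdd: "\<And>x. \<bar>u\<^sub>0 x\<bar> \<le> B\<^sub>0"
    and u0_lip: "\<And>x y. \<bar>u\<^sub>0 x - u\<^sub>0 y\<bar> \<le> \<Lambda> * norm (x - y)"
    and f_meas: "\<And>s. 0 < s \<Longrightarrow> s < T \<Longrightarrow> f s \<in> borel_measurable borel"
    and f_bdd: "\<And>s x. 0 < s \<Longrightarrow> s < T \<Longrightarrow> \<bar>f s x\<bar> \<le> F"
    and f_int: "\<And>t x. 0 < t \<Longrightarrow> t \<le> T \<Longrightarrow> set_integrable lborel {0<..<t} (\<lambda>s. P (t - s) (f s) x)"
    and u: "\<And>t x. 0 < t \<Longrightarrow> t \<le> T \<Longrightarrow> u t x = P t u\<^sub>0 x + duhamel f t x"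
    and Du_bdd: "\<And>t i x. 0 < t \<Longrightarrow> t \<le> T \<Longrightarrow> \<bar>partial i (u t) x\<bar> \<le> B"
    and f_diff: "\<And>s x h. 0 < s \<Longrightarrow> s < T \<Longrightarrow> norm h < 1 \<Longrightarrow>
      \<bar>f s (x + h) - f s x\<bar> \<le> M * norm h powr \<beta> + L * norm (grad (u s) (x + h) - grad (u s) x)"
  obtains C where "0 \<le> C" and "\<And>t x h. 0 < t \<Longrightarrow> t \<le> T \<Longrightarrow>
    norm (grad (u t) (x + h) - grad (u t) x) \<le> C * norm h powr \<beta> * t powr (- \<beta> / \<alpha>)"
proof -
  define \<theta> where "\<theta> = \<beta> / \<alpha>"
  have \<theta>: "0 \<le> \<theta>" "\<theta> < 1" using \<alpha> \<beta> by (auto simp: \<theta>_def)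
  define \<eta> where "\<eta> = (1 - 1 / \<alpha>) / 2"
  have \<eta>: "0 < \<eta>" "\<eta> < 1" "1 / \<alpha> + \<eta> < 1" using \<alpha> by (auto simp: \<eta>_def field_simps)
  define A0 where "A0 = diff_const 1 * \<Lambda>"
  define A1 where "A1 = c * M * beta_const (1 / \<alpha>) 0 * T powr (1 - 1 / \<alpha> + \<theta>)"
  define X where "X = c * L * beta_const (1 / \<alpha> + \<eta>) \<theta> * T powr (1 - 1 / \<alpha> - \<eta>)"
  \<comment> \<open>Chosen such that \<open>n X \<omega> powr -\<eta>\<close> is at most \<open>1 / 2\<close>; the summand \<open>1\<close> keeps \<open>\<omega>\<close> positive when \<open>X\<close>
      vanishes.\<close>
  define \<omega> where "\<omega> = (2 * CARD('n) * (X + 1)) powr (1 / \<eta>)"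
  define a where "a = CARD('n) * (A0 + A1)"
  have A0: "0 \<le> A0" using nn diff_const_nonneg by (simp add: A0_def)
  have A1: "0 \<le> A1" using nn c_nonneg beta_const_nonneg[of "1 / \<alpha>" 0] \<alpha> by (simp add: A1_def)
  have X: "0 \<le> X" using nn c_nonneg beta_const_nonneg[of "1 / \<alpha> + \<eta>" \<theta>] \<theta> \<eta> by (simp add: X_def)
  have a: "0 \<le> a" using A0 A1 by (simp add: a_def)
  have n: "0 < real CARD('n)" by simp
  have \<omega>: "0 < \<omega>" using X n by (simp add: \<omega>_def)
  have \<omega>\<eta>: "CARD('n) * X * \<omega> powr - \<eta> \<le> 1 / 2"
  proof -
    have "\<omega> powr - \<eta> = 1 / (2 * CARD('n) * (X + 1))"
      using X n \<eta> by (simp add: \<omega>_def powr_powr powr_minus_divide)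
    then have "CARD('n) * X * \<omega> powr - \<eta> = X / (2 * (X + 1))" using n by simp
    also have "\<dots> \<le> 1 / 2" using X by (simp add: divide_le_eq)
    finally show ?thesis .
  qed
  let ?w = "\<lambda>t h x. norm (grad (u t) (x + h) - grad (u t) x)"
  have w_bdd: "?w t h x \<le> 2 * (CARD('n) * B)" if "0 < t" "t \<le> T" for t h x
    using norm_triangle_ineq4[of "grad (u t) (x + h)" "grad (u t) x"]
      norm_grad_le[of "u t" _ B, OF Du_bdd[OF that]] by (smt (verit))
  have B: "0 \<le> B" using Du_bdd[of T undefined undefined] T_pos by (smt (verit))
  have F: "0 \<le> F" using f_bdd[of "T / 2" 0] T_pos by (smt (verit) field_sum_of_halves)
  \<comment> \<open>The contraction: a weighted bound \<open>N\<close> at all times improves to \<open>a + N / 2\<close>.\<close>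
  have improve: "?w t h x \<le> (a + N / 2) * (norm h powr \<beta> * t powr - \<theta> * exp (\<omega> * t))"
    if h: "h \<noteq> 0" "norm h < 1" and N: "0 \<le> N"
      and hyp: "\<And>s y. 0 < s \<Longrightarrow> s < T \<Longrightarrow> ?w s h y \<le> N * (norm h powr \<beta> * s powr - \<theta> * exp (\<omega> * s))"
      and t: "0 < t" "t \<le> T" for h N t x
  proof -
    let ?H = "norm h powr \<beta>"
    \<comment> \<open>A bounded source is Hoelder continuous of exponent \<open>0\<close>, which suffices to differentiate once.\<close>
    have f0: "\<bar>f s y - f s z\<bar> \<le> 2 * F * s powr (- 0 / \<alpha>) * norm (y - z) powr 0" if "0 < s" "s < t"
        for s y z
      using f_bdd[of s y] f_bdd[of s z] that t by (cases "y = z") auto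
    have fm: "f s \<in> borel_measurable borel" and fb: "\<bar>f s y\<bar> \<le> F" if "0 < s" "s < t" for s y
      using that t by (auto intro: f_meas f_bdd)
    have m: "real 1 - 0 < \<alpha>" using \<alpha> by simp
    note duh = t \<alpha> order_refl zero_le_one mult_nonneg_nonneg[OF zero_le_numeral F] fm fb f0 f_int[OF t]
        m
    have comp: "\<bar>partial i (u t) (x + h) - partial i (u t) x\<bar> \<le>
        (A0 + A1 + N * X * \<omega> powr - \<eta>) * (?H * t powr - \<theta> * exp (\<omega> * t))" for i
    proof -
      have ut: "partial i (u t) = (\<lambda>x. partial i (P t u\<^sub>0) x + partial i (duhamel f t) x)"
      proof
        fix y
        have "u t = (\<lambda>y. P t u\<^sub>0 y + duhamel f t y)" using u[OF t] by auto
        moreover have "duhamel f t differentiable (at y)"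
          using diff_uptoD[OF diff_upto_duhamel[OF duh], of "[]"] by simp
        ultimately show "partial i (u t) y = partial i (P t u\<^sub>0) y + partial i (duhamel f t) y"
          using partial_add[OF P_differentiable[OF t u0_meas u0_bdd]] by simp
      qed
      have 1: "\<bar>partial i (P t u\<^sub>0) (x + h) - partial i (P t u\<^sub>0) x\<bar> \<le> A0 * ?H * t powr - \<theta>"
        using partials_P_lipschitz_diff_le[OF t u0_meas u0_bdd u0_lip nn(1) \<beta> _ h(1), of "[i]" x]
        by (simp add: A0_def \<theta>_def)
      let ?g = "\<lambda>s y. partial i (P (t - s) (f s)) y"
      have int_g: "set_integrable lborel {0<..<t} (\<lambda>s. ?g s y)" for y
        using set_integrable_partials_duhamel[OF duh, of "[i]" y] by simp
      have duh_i: "partial i (duhamel f t) = (\<lambda>y. LINT s:{0<..<t}|lborel. ?g s y)"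
        using partials_duhamel[OF duh, of "[i]"] by simp
      let ?G1 = "\<lambda>s. c * M * ?H * (s powr - 0 * (t - s) powr - (1 / \<alpha>))"
      let ?G2 = "\<lambda>s. c * L * N * ?H * exp (\<omega> * t) * \<omega> powr - \<eta> * (s powr - \<theta> * (t - s) powr - (1 / \<alpha> +
          \<eta>))"
      have a1: "0 \<le> 1 / \<alpha>" "1 / \<alpha> < 1" and a2: "0 \<le> 1 / \<alpha> + \<eta>" using \<alpha> \<eta> by auto
      note b1 = beta_integral_le[OF a1 order_refl zero_less_one t(1)]
      note b2 = beta_integral_le[OF a2 \<eta>(3) \<theta> t(1)]
      have int1: "set_integrable lborel {0<..<t} ?G1" by (rule set_integrable_mult_right[OF b1(1)])
      have int2: "set_integrable lborel {0<..<t} ?G2" by (rule set_integrable_mult_right[OF b2(1)])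
      have le: "\<bar>?g s (x + h) - ?g s x\<bar> \<le> ?G1 s + ?G2 s" if "s \<in> {0<..<t}" for s
      proof -
        have s: "0 < s" "s < t" using that by auto
        let ?\<tau> = "t - s"
        let ?D = "?H * (M + L * N * (s powr - \<theta> * exp (\<omega> * s)))"
        have D: "\<bar>f s (y + h) - f s y\<bar> \<le> ?D" for y
        proof -
          have "\<bar>f s (y + h) - f s y\<bar> \<le> M * ?H + L * ?w s h y"
            using s t h by (intro f_diff) auto
          also have "\<dots> \<le> M * ?H + L * (N * (?H * s powr - \<theta> * exp (\<omega> * s)))"
            using s t nn by (intro add_left_mono mult_left_mono hyp) auto
          finally show ?thesis by (simp add: algebra_simps)
        qed
        have "\<bar>?g s (x + h) - ?g s x\<bar> \<le> c * ?\<tau> powr (- 1 / \<alpha>) * ?D"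
          using s t by (intro partial_P_translation_diff_le[OF _ _ fm fb D]) auto
        also have "exp (\<omega> * s) \<le> exp (\<omega> * t) * (\<omega> powr - \<eta> * ?\<tau> powr - \<eta>)"
        proof -
          have "exp (\<omega> * s) = exp (\<omega> * t) * exp (- (\<omega> * ?\<tau>))" by (simp add: mult_exp_exp algebra_simps)
          also have "\<dots> \<le> exp (\<omega> * t) * (\<omega> * ?\<tau>) powr - \<eta>"
            using s \<omega> \<eta> by (intro mult_left_mono exp_minus_le_powr) auto
          finally show ?thesis using s \<omega> by (simp add: powr_mult)
        qed
        then have "c * ?\<tau> powr (- 1 / \<alpha>) * ?D \<le> 
           c * ?\<tau> powr (- 1 / \<alpha>) * (?H * (M + L * N * (s powr - \<theta> * (exp (\<omega> * t) * (\<omega> powr - \<eta> * ?\<tau> powr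
               - \<eta>)))))"
          using c_nonneg nn N by (intro mult_left_mono add_left_mono) auto
        also have "\<dots> = ?G1 s + ?G2 s"
        proof -
          have "?\<tau> powr (- (1 / \<alpha> + \<eta>)) = ?\<tau> powr (- 1 / \<alpha>) * ?\<tau> powr - \<eta>"
            by (simp add: powr_add[symmetric])
          then show ?thesis using s by (simp add: algebra_simps)
        qed
        finally show ?thesis .
      qed
      have "\<bar>partial i (duhamel f t) (x + h) - partial i (duhamel f t) x\<bar> =
          \<bar>LINT s:{0<..<t}|lborel. ?g s (x + h) - ?g s x\<bar>"
        using int_g by (simp add: duh_i set_integral_diff)
      also have "\<dots> \<le> (LINT s:{0<..<t}|lborel. ?G1 s + ?G2 s)"
        by (rule abs_set_integral_le[OF set_integral_diff(1)[OF int_g int_g] set_integral_add(1)[OF int1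
            int2] le])
      also have "\<dots> = (LINT s:{0<..<t}|lborel. ?G1 s) + (LINT s:{0<..<t}|lborel. ?G2 s)"
        by (rule set_integral_add(2)[OF int1 int2])
      also have "(LINT s:{0<..<t}|lborel. ?G1 s) \<le> A1 * ?H * t powr - \<theta>"
      proof -
        have "(LINT s:{0<..<t}|lborel. ?G1 s) \<le> c * M * ?H * (beta_const (1 / \<alpha>) 0 * t powr (1 - 1 / \<alpha> -
            0))"
          unfolding set_integral_mult_right using b1(2) c_nonneg nn by (intro mult_left_mono) auto
        also have "t powr (1 - 1 / \<alpha> - 0) = t powr (1 - 1 / \<alpha> + \<theta>) * t powr - \<theta>"
            by (simp add: powr_add[symmetric])
        also have "c * M * ?H * (beta_const (1 / \<alpha>) 0 * (t powr (1 - 1 / \<alpha> + \<theta>) * t powr - \<theta>)) \<le>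
          c * M * ?H * (beta_const (1 / \<alpha>) 0 * (T powr (1 - 1 / \<alpha> + \<theta>) * t powr - \<theta>))"
          using c_nonneg nn beta_const_nonneg[of "1 / \<alpha>" 0] a1 t \<theta>
              by (intro mult_left_mono mult_right_mono powr_mono2) auto
        finally show ?thesis by (simp add: A1_def mult_ac)
      qed
      also have "(LINT s:{0<..<t}|lborel. ?G2 s) \<le> N * X * \<omega> powr - \<eta> * (?H * t powr - \<theta> * exp (\<omega> * t))"
      proof -
        have "(LINT s:{0<..<t}|lborel. ?G2 s) \<le> c * L * N * ?H * exp (\<omega> * t) * \<omega> powr - \<eta> *
           (beta_const (1 / \<alpha> + \<eta>) \<theta> * t powr (1 - (1 / \<alpha> + \<eta>) - \<theta>))"
          unfolding set_integral_mult_right using b2(2) c_nonneg nn N by (intro mult_left_mono) auto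
        also have "t powr (1 - (1 / \<alpha> + \<eta>) - \<theta>) = t powr (1 - 1 / \<alpha> - \<eta>) * t powr - \<theta>"
          by (simp add: powr_add[symmetric] algebra_simps)
        also have "c * L * N * ?H * exp (\<omega> * t) * \<omega> powr - \<eta> * (beta_const (1 / \<alpha> + \<eta>) \<theta> * (t powr (1 -
            1 / \<alpha> - \<eta>) * t powr - \<theta>)) \<le>
          c * L * N * ?H * exp (\<omega> * t) * \<omega> powr - \<eta> * (beta_const (1 / \<alpha> + \<eta>) \<theta> * (T powr (1 - 1 / \<alpha> -
              \<eta>) * t powr - \<theta>))"
          using c_nonneg nn N beta_const_nonneg[of "1 / \<alpha> + \<eta>" \<theta>] \<eta> \<theta> t
              by (intro mult_left_mono mult_right_mono powr_mono2) auto
        finally show ?thesis by (simp add: X_def mult_ac)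
      qed
      finally have "\<bar>partial i (duhamel f t) (x + h) - partial i (duhamel f t) x\<bar> \<le>
        A1 * ?H * t powr - \<theta> + N * X * \<omega> powr - \<eta> * (?H * t powr - \<theta> * exp (\<omega> * t))" by simp
      with 1 have "\<bar>partial i (u t) (x + h) - partial i (u t) x\<bar> \<le>
        (A0 + A1) * (?H * t powr - \<theta>) + N * X * \<omega> powr - \<eta> * (?H * t powr - \<theta> * exp (\<omega> * t))"
        unfolding ut by (simp add: algebra_simps)
      moreover have "(A0 + A1) * (?H * t powr - \<theta>) \<le> (A0 + A1) * (?H * t powr - \<theta> * exp (\<omega> * t))"
      proof (rule mult_left_mono)
        have "1 \<le> exp (\<omega> * t)" using \<omega> t by simp
        then have "?H * t powr - \<theta> * 1 \<le> ?H * t powr - \<theta> * exp (\<omega> * t)" by (rule mult_left_mono) simp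
        then show "?H * t powr - \<theta> \<le> ?H * t powr - \<theta> * exp (\<omega> * t)" by simp
      qed (use A0 A1 in simp)
      ultimately show ?thesis by (simp add: algebra_simps)
    qed
    have "?w t h x \<le> (\<Sum>i\<in>UNIV. \<bar>(grad (u t) (x + h) - grad (u t) x) $ i\<bar>)" by (rule norm_le_l1_cart)
    also have "\<dots> \<le> (\<Sum>i\<in>(UNIV::'n set). (A0 + A1 + N * X * \<omega> powr - \<eta>) * (?H * t powr - \<theta> * exp (\<omega> *
        t)))"
      using comp by (intro sum_mono) (simp add: grad_def)
    also have "\<dots> = (a + N * (CARD('n) * X * \<omega> powr - \<eta>)) * (?H * t powr - \<theta> * exp (\<omega> * t))"
      by (simp add: a_def algebra_simps)
    also have "\<dots> \<le> (a + N * (1 / 2)) * (?H * t powr - \<theta> * exp (\<omega> * t))"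
      using \<omega>\<eta> N by (intro mult_right_mono add_left_mono mult_left_mono) auto
    finally show ?thesis by simp
  qed
  have small: "?w t h x \<le> 2 * a * (norm h powr \<beta> * t powr - \<theta> * exp (\<omega> * t))"
    if h: "h \<noteq> 0" "norm h < 1" and t: "0 < t" "t \<le> T" for h t x
  proof -
    define W where "W t = norm h powr \<beta> * t powr - \<theta> * exp (\<omega> * t)" for t
    define Q where "Q = {?w s h y / W s | s y. 0 < s \<and> s \<le> T}"
    have W: "0 < W t" if "0 < t" for t using h that by (simp add: W_def)
    have W_lower: "norm h powr \<beta> * T powr - \<theta> \<le> W t" if "0 < t" "t \<le> T" for t
    proof -
      have "T powr - \<theta> \<le> t powr - \<theta>" using that \<theta> by (intro powr_mono2') auto
      also have "\<dots> \<le> t powr - \<theta> * exp (\<omega> * t)" 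
        using mult_left_mono[of 1 "exp (\<omega> * t)" "t powr - \<theta>"] \<omega> that by simp
      finally show ?thesis by (simp add: W_def mult_left_mono mult.assoc)
    qed
    have bdd: "bdd_above Q"
      unfolding bdd_above_def
    proof (intro exI ballI)
      fix q assume "q \<in> Q"
      then obtain s y where s: "0 < s" "s \<le> T" and q: "q = ?w s h y / W s"
        unfolding Q_def by blast
      show "q \<le> 2 * (CARD('n) * B) / (norm h powr \<beta> * T powr - \<theta>)"
        unfolding q using w_bdd[OF s, of y h] W_lower[OF s] B h T_pos by (intro frac_le) auto
    qed
    define N where "N = Sup Q"
    have upper: "?w s h y \<le> N * W s" if "0 < s" "s \<le> T" for s y
    proof -
      have "?w s h y / W s \<le> N" unfolding N_def
          by (rule cSup_upper[OF _ bdd]) (unfold Q_def, use that in blast)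
      then show ?thesis using W[OF that(1)] by (simp add: divide_le_eq)
    qed
    have "0 \<le> N * W T" using upper[of T 0] T_pos norm_ge_zero order_trans by blast
    then have N: "0 \<le> N" using W[OF T_pos] by (simp add: zero_le_mult_iff)
    have "N \<le> a + N / 2"
    proof (subst N_def, rule cSup_least)
      show "Q \<noteq> {}" unfolding Q_def using T_pos by blast
      fix q assume "q \<in> Q"
      then obtain s y where s: "0 < s" "s \<le> T" and q: "q = ?w s h y / W s"
        unfolding Q_def by blast
      have "?w s h y \<le> (a + N / 2) * W s"
        unfolding W_def by (rule improve[OF h N _ s]) (use upper in \<open>auto simp: W_def\<close>)
      then show "q \<le> a + N / 2" unfolding q using W[OF s(1)] by (simp add: divide_le_eq)
    qed
    then have "N * W t \<le> 2 * a * W t" using W[OF t(1)] by (intro mult_right_mono) auto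
    then show ?thesis using upper[OF t, of x] by (simp add: W_def)
  qed
  define C where "C = 2 * a * exp (\<omega> * T) + 2 * (CARD('n) * B) * T powr \<theta>"
  have C_nonneg: "0 \<le> C" using a B by (simp add: C_def)
  show ?thesis
  proof (rule that[OF C_nonneg])
    fix t :: real and x h :: "real ^ 'n" assume t: "0 < t" "t \<le> T"
    let ?Ht = "norm h powr \<beta> * t powr - \<theta>"
    consider "h = 0" | "h \<noteq> 0" "norm h < 1" | "1 \<le> norm h" by fastforce
    then have "?w t h x \<le> C * ?Ht"
    proof cases
      case 1
      then show ?thesis by simp
    next
      case 2
      have "?w t h x \<le> 2 * a * (?Ht * exp (\<omega> * t))" by (rule small[OF 2 t])
      also have "\<dots> \<le> 2 * a * (?Ht * exp (\<omega> * T))" using a \<omega> t by (intro mult_left_mono) auto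
      also have "\<dots> = 2 * a * exp (\<omega> * T) * ?Ht" by simp
      also have "\<dots> \<le> C * ?Ht" using B by (intro mult_right_mono) (auto simp: C_def)
      finally show ?thesis .
    next
      case 3
      have "1 \<le> T powr \<theta> * t powr - \<theta>"
      proof -
        have "T powr \<theta> * T powr - \<theta> \<le> T powr \<theta> * t powr - \<theta>"
          using t \<theta> by (intro mult_left_mono powr_mono2') auto
        then show ?thesis using T_pos by (simp add: powr_minus)
      qed
      moreover have "1 \<le> norm h powr \<beta>" using 3 \<beta> by (simp add: ge_one_powr_ge_zero)
      ultimately have "1 * 1 \<le> norm h powr \<beta> * (T powr \<theta> * t powr - \<theta>)" by (intro mult_mono) auto
      then have "2 * (CARD('n) * B) * 1 \<le> 2 * (CARD('n) * B) * (norm h powr \<beta> * (T powr \<theta> * t powr -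
          \<theta>))"
        using B by (intro mult_left_mono) auto
      then have "?w t h x \<le> 2 * (CARD('n) * B) * T powr \<theta> * ?Ht" using w_bdd[OF t, of x h]
          by (simp add: mult_ac)
      also have "\<dots> \<le> C * ?Ht" using a by (intro mult_right_mono) (auto simp: C_def)
      finally show ?thesis .
    qed
    then show "?w t h x \<le> C * norm h powr \<beta> * t powr (- \<beta> / \<alpha>)" by (simp add: \<theta>_def mult.assoc)
  qed
qed

end

section \<open>Higher derivatives of mild solutions\<close>

context smoothing_semigroup begin

context
  fixes t F K \<beta> \<Lambda> B\<^sub>0 :: real and f :: "real \<Rightarrow> real ^ 'n \<Rightarrow> real" and u\<^sub>0 v :: "real ^ 'n \<Rightarrow> real" and m
      :: nat
  assumes t: "0 < t" "t \<le> T" and \<alpha>: "1 < \<alpha>" and \<beta>: "0 \<le> \<beta>" "\<beta> \<le> 1" and K: "0 \<le> K"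
    and f_meas: "\<And>s. 0 < s \<Longrightarrow> s < t \<Longrightarrow> f s \<in> borel_measurable borel"
    and f_bdd: "\<And>s x. 0 < s \<Longrightarrow> s < t \<Longrightarrow> \<bar>f s x\<bar> \<le> F"
    and f_hoelder: "\<And>s x y. 0 < s \<Longrightarrow> s < t \<Longrightarrow> \<bar>f s x - f s y\<bar> \<le>
        K * s powr (- \<beta> / \<alpha>) * norm (x - y) powr \<beta>"
    and f_int: "\<And>x. set_integrable lborel {0<..<t} (\<lambda>s. P (t - s) (f s) x)"
    and u0_meas: "u\<^sub>0 \<in> borel_measurable borel" and u0_bdd: "\<And>x. \<bar>u\<^sub>0 x\<bar> \<le> B\<^sub>0"
    and u0_lip: "\<And>x y. \<bar>u\<^sub>0 x - u\<^sub>0 y\<bar> \<le> \<Lambda> * norm (x - y)" and \<Lambda>: "0 \<le> \<Lambda>"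
    and v: "v = (\<lambda>x. P t u\<^sub>0 x + duhamel f t x)"
    and m: "real m - \<beta> < \<alpha>"
begin

lemmas duhamel_facts = t \<alpha> \<beta> K f_meas f_bdd f_hoelder f_int m

lemma partials_mild: "length ks \<le> m \<Longrightarrow> partials ks v =
    (\<lambda>x. partials ks (P t u\<^sub>0) x + partials ks (duhamel f t) x)"
  unfolding v by (rule partials_add[OF diff_upto_P[OF t u0_meas u0_bdd] diff_upto_duhamel[OF
      duhamel_facts]])

lemma diff_upto_mild: "diff_upto m v"
  unfolding v by (rule diff_upto_add[OF diff_upto_P[OF t u0_meas u0_bdd] diff_upto_duhamel[OF
      duhamel_facts]])

text \<open>The contribution of \<open>u\<^sub>0\<close> is the more singular one: the Duhamel term has the additional
  factor \<open>t powr (1 - 1/\<alpha>)\<close>, which is bounded on \<open>(0, T]\<close>.\<close>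

lemma partials_mild_le:
  assumes ks: "1 \<le> length ks" "length ks \<le> m"
  shows "\<bar>partials ks v x\<bar> \<le> smoothing_const (length ks) *
    (\<Lambda> + K * beta_const ((real (length ks) - \<beta>) / \<alpha>) (\<beta> / \<alpha>) * T powr (1 - 1 / \<alpha>)) *
    t powr (- (real (length ks) - 1) / \<alpha>)"
proof -
  let ?k = "length ks"
  let ?S = "smoothing_const ?k" and ?b = "beta_const ((real ?k - \<beta>) / \<alpha>) (\<beta> / \<alpha>)" and ?t =
      "t powr (- (real ?k - 1) / \<alpha>)"
  have b: "0 \<le> ?b" using ks m \<alpha> \<beta> by (intro beta_const_nonneg) auto
  have lip: "\<And>x y. \<bar>u\<^sub>0 x - u\<^sub>0 y\<bar> \<le> \<Lambda> * norm (x - y) powr 1" using u0_lip by simp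
  have 1: "\<bar>partials ks (P t u\<^sub>0) x\<bar> \<le> ?S * \<Lambda> * ?t"
    using abs_partials_P_hoelder_le[OF t u0_meas u0_bdd lip \<Lambda> zero_le_one order_refl ks(1)] .
  have "1 - real ?k / \<alpha> = (1 - 1 / \<alpha>) + - (real ?k - 1) / \<alpha>" using \<alpha> by (simp add: field_simps)
  then have "t powr (1 - real ?k / \<alpha>) = t powr (1 - 1 / \<alpha>) * ?t" by (simp only: powr_add)
  also have "\<dots> \<le> T powr (1 - 1 / \<alpha>) * ?t"
    using t \<alpha> by (intro mult_right_mono powr_mono2) auto
  finally have "?S * K * ?b * t powr (1 - real ?k / \<alpha>) \<le> ?S * K * ?b * (T powr (1 - 1 / \<alpha>) * ?t)"
    using K b smoothing_const_nonneg by (intro mult_left_mono) auto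
  then have 2: "\<bar>partials ks (duhamel f t) x\<bar> \<le> ?S * K * ?b * (T powr (1 - 1 / \<alpha>) * ?t)"
    using abs_partials_duhamel_le[OF duhamel_facts ks, of x] by linarith
  have "\<bar>partials ks v x\<bar> \<le> ?S * \<Lambda> * ?t + ?S * K * ?b * (T powr (1 - 1 / \<alpha>) * ?t)"
    using 1 2 by (simp add: partials_mild[OF ks(2)])
  then show ?thesis by (simp add: algebra_simps)
qed

lemma partials_mild_diff_le:
  assumes m1: "1 \<le> m" "real m < \<alpha> + \<beta>" "\<alpha> + \<beta> < real m + 1" and ks: "length ks = m" and h: "h \<noteq> 0"
  shows "\<bar>partials ks v (x + h) - partials ks v x\<bar> \<le> diff_const m *
    (\<Lambda> + K * critical_const (\<beta> / \<alpha>) ((real m - \<beta>) / \<alpha>) ((real m + 1 - \<beta>) / \<alpha>) * T powr (1 - 1 / \<alpha>)) *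
    norm h powr (\<alpha> + \<beta> - real m) * t powr (- (\<alpha> + \<beta> - 1) / \<alpha>)"
proof -
  let ?\<kappa> = "\<alpha> + \<beta> - real m" and ?t = "t powr (- (\<alpha> + \<beta> - 1) / \<alpha>)"
  let ?C = "critical_const (\<beta> / \<alpha>) ((real m - \<beta>) / \<alpha>) ((real m + 1 - \<beta>) / \<alpha>)"
  have k1: "1 \<le> length ks" using ks m1 by simp
  have C: "0 \<le> ?C"
    unfolding critical_const_def using m1 m \<alpha> \<beta> by (intro add_nonneg_nonneg mult_nonneg_nonneg) auto
  have \<kappa>: "0 \<le> ?\<kappa>" "?\<kappa> \<le> 1" using m1 by auto
  have 1: "\<bar>partials ks (P t u\<^sub>0) (x + h) - partials ks (P t u\<^sub>0) x\<bar> \<le>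
      diff_const m * \<Lambda> * norm h powr ?\<kappa> * ?t"
    using partials_P_lipschitz_diff_le[OF t u0_meas u0_bdd u0_lip \<Lambda> \<kappa> k1 h, of x] ks
        by (simp add: algebra_simps)
  have "t powr (- \<beta> / \<alpha>) = t powr (1 - 1 / \<alpha>) * ?t"
  proof -
    have "- \<beta> / \<alpha> = (1 - 1 / \<alpha>) + - (\<alpha> + \<beta> - 1) / \<alpha>" using \<alpha> by (simp add: field_simps)
    then show ?thesis by (simp only: powr_add)
  qed
  also have "\<dots> \<le> T powr (1 - 1 / \<alpha>) * ?t"
    using t \<alpha> by (intro mult_right_mono powr_mono2) auto
  finally have "?C * (diff_const m * K) * norm h powr ?\<kappa> * t powr (- \<beta> / \<alpha>) \<le> 
      ?C * (diff_const m * K) * norm h powr ?\<kappa> * (T powr (1 - 1 / \<alpha>) * ?t)"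
    using K C diff_const_nonneg by (intro mult_left_mono) auto
  then have 2: "\<bar>partials ks (duhamel f t) (x + h) - partials ks (duhamel f t) x\<bar> \<le>
      ?C * (diff_const m * K) * norm h powr ?\<kappa> * (T powr (1 - 1 / \<alpha>) * ?t)"
    using partials_duhamel_diff_le[OF duhamel_facts m1(1,3) ks h, of x] by linarith
  have "\<bar>partials ks v (x + h) - partials ks v x\<bar> \<le> diff_const m * \<Lambda> * norm h powr ?\<kappa> * ?t +
     ?C * (diff_const m * K) * norm h powr ?\<kappa> * (T powr (1 - 1 / \<alpha>) * ?t)"
    using 1 2 ks by (simp add: partials_mild)
  then show ?thesis by (simp add: algebra_simps)
qed

end

end

section \<open>Hoelder spaces and seminorms of derivative tensors\<close>

lemma finite_lists_of_length: "finite {ks :: 'n::finite list. length ks = m}"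
  using finite_lists_length_eq[of "UNIV :: 'n set" m] by simp

lemma tensor_sup_norm_le:
  fixes f :: "real ^ 'n::finite \<Rightarrow> real" and B :: real
  assumes "\<And>ks x. length ks = m \<Longrightarrow> \<bar>partials ks f x\<bar> \<le> B"
  shows "\<bar>tensor_sup_norm m f\<bar> \<le> card {ks :: 'n list. length ks = m} * B"
proof -
  let ?I = "{ks :: 'n list. length ks = m}"
  let ?N = "\<lambda>x. L2_set (\<lambda>ks. partials ks f x) ?I"
  have le: "?N x \<le> card ?I * B" for x
  proof -
    have "?N x \<le> (\<Sum>ks\<in>?I. \<bar>partials ks f x\<bar>)" by (rule L2_set_le_sum_abs)
    also have "\<dots> \<le> (\<Sum>ks\<in>?I. B)" using assms by (intro sum_mono) auto
    finally show ?thesis by simp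
  qed
  have "tensor_sup_norm m f \<le> card ?I * B"
    unfolding tensor_sup_norm_def using le by (intro cSUP_least) auto
  moreover have "0 \<le> ?N 0" by simp
  moreover have "?N 0 \<le> tensor_sup_norm m f"
    unfolding tensor_sup_norm_def using le by (intro cSUP_upper bdd_aboveI2) auto
  ultimately show ?thesis by linarith
qed

lemma tensor_holder_seminorm_le:
  fixes f :: "real ^ 'n::finite \<Rightarrow> real" and B :: real
  assumes "\<And>ks x h. length ks = m \<Longrightarrow> h \<noteq> 0 \<Longrightarrow> \<bar>partials ks f (x + h) - partials ks f x\<bar> \<le>
      B * norm h powr \<theta>"
  shows "\<bar>tensor_holder_seminorm m \<theta> f\<bar> \<le> card {ks :: 'n list. length ks = m} * B"
proof -
  let ?I = "{ks :: 'n list. length ks = m}"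
  let ?N = "\<lambda>x h. L2_set (\<lambda>ks. partials ks f (x + h) - partials ks f x) ?I / norm h powr \<theta>"
  have le: "?N x h \<le> card ?I * B" if "h \<noteq> 0" for x h
  proof -
    have "L2_set (\<lambda>ks. partials ks f (x + h) - partials ks f x) ?I \<le>
        (\<Sum>ks\<in>?I. \<bar>partials ks f (x + h) - partials ks f x\<bar>)"
      by (rule L2_set_le_sum_abs)
    also have "\<dots> \<le> (\<Sum>ks\<in>?I. B * norm h powr \<theta>)" using assms that by (intro sum_mono) auto
    finally show ?thesis using that by (simp add: pos_divide_le_eq)
  qed
  have "axis undefined 1 \<in> - {0 :: real ^ 'n}" by simp
  then have ne: "(UNIV :: (real ^ 'n) set) \<times> - {0 :: real ^ 'n} \<noteq> {}" by blast
  have "tensor_holder_seminorm m \<theta> f \<le> card ?I * B"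
    unfolding tensor_holder_seminorm_def by (rule cSUP_least[OF ne]) (use le in auto)
  moreover have "0 \<le> ?N 0 (axis undefined 1)" by simp
  moreover have "?N 0 (axis undefined 1) \<le> tensor_holder_seminorm m \<theta> f"
    unfolding tensor_holder_seminorm_def
    by (rule cSUP_upper2[where x = "(0, axis undefined 1)"]) (use le in \<open>auto intro!: bdd_aboveI2\<close>)
  ultimately show ?thesis by linarith
qed

lemma holder_boundedI:
  assumes "\<And>x h. h \<noteq> 0 \<Longrightarrow> \<bar>f (x + h) - f x\<bar> \<le> B * norm h powr \<theta>"
  shows "holder_bounded \<theta> f"
  unfolding holder_bounded_def
proof (rule bdd_aboveI2)
  fix z :: "(real ^ 'a) \<times> (real ^ 'a)" assume "z \<in> UNIV \<times> - {0}"
  then show "(case z of (x, h) \<Rightarrow> \<bar>f (x + h) - f x\<bar> / norm h powr \<theta>) \<le> B"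
    using assms[of "snd z" "fst z"] by (cases z) (simp add: pos_divide_le_eq)
qed

lemma continuous_on_hoelder:
  fixes f :: "'a::real_normed_vector \<Rightarrow> real"
  assumes le: "\<And>x h. h \<noteq> 0 \<Longrightarrow> \<bar>f (x + h) - f x\<bar> \<le> B * norm h powr \<theta>" and \<theta>: "0 < \<theta>"
  shows "continuous_on UNIV f"
proof -
  have "(f \<longlongrightarrow> f x) (at x)" for x
  proof (rule LIM_zero_cancel, rule tendsto_0_le[where K=1])
    have "((\<lambda>y. norm (y - x) powr \<theta>) \<longlongrightarrow> 0) (at x)"
      by (rule tendsto_zero_powrI[OF _ tendsto_const _ \<theta>]) (auto intro!: tendsto_eq_intros)
    then show "((\<lambda>y. B * norm (y - x) powr \<theta>) \<longlongrightarrow> 0) (at x)" by (rule tendsto_mult_right_zero)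
    show "\<forall>\<^sub>F y in at x. norm (f y - f x) \<le> norm (B * norm (y - x) powr \<theta>) * 1"
      unfolding eventually_at_filter
    proof (rule always_eventually, intro allI impI)
      fix y assume "y \<noteq> x"
      then show "norm (f y - f x) \<le> norm (B * norm (y - x) powr \<theta>) * 1"
        using le[of "y - x" x] by (simp add: order_trans[OF _ abs_ge_self])
    qed
  qed
  then show ?thesis by (simp add: continuous_on_def)
qed

lemma Cb_holderI:
  fixes f :: "real ^ 'n::finite \<Rightarrow> real"
  assumes m: "real m < \<gamma>" "\<gamma> < real m + 1" and diff: "diff_upto m f"
    and bdd: "\<And>ks. length ks \<le> m \<Longrightarrow> bounded (range (partials ks f))"
    and hoelder: "\<And>ks x h. length ks = m \<Longrightarrow> h \<noteq> 0 \<Longrightarrow>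
      \<bar>partials ks f (x + h) - partials ks f x\<bar> \<le> B * norm h powr (\<gamma> - real m)"
  shows "f \<in> Cb_holder \<gamma>"
proof -
  have floor: "\<lfloor>\<gamma>\<rfloor> = int m" using m by (intro floor_unique) auto
  then have frac: "frac \<gamma> = \<gamma> - real m" by (simp add: frac_def)
  have "continuous_on UNIV (partials ks f)" if "length ks \<le> m" for ks
  proof (cases "length ks = m")
    case True
    show ?thesis by (rule continuous_on_hoelder[OF hoelder[OF True]]) (use m in auto)
  next
    case False
    then have "partials ks f differentiable (at x)" for x using that by (intro diff_uptoD[OF diff]) auto
    then show ?thesis by (auto intro!: continuous_at_imp_continuous_on
        differentiable_imp_continuous_within)
  qed
  moreover have "partials ks f differentiable_on UNIV" if "length ks < m" for ks
    using diff_uptoD[OF diff that] by (simp add: differentiable_on_def)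
  ultimately have "f \<in> Cb m" using bdd by (simp add: Cb_def)
  then show ?thesis
    using hoelder by (auto simp: Cb_holder_def floor frac intro!: holder_boundedI)
qed

lemma abs_partial_le_Cb_norm:
  fixes f :: "real ^ 'n::finite \<Rightarrow> real"
  assumes f: "f \<in> Cb 1"
  shows "\<bar>partial i f x\<bar> \<le> Cb_norm 1 f"
proof -
  have bdd: "bounded (range (partials ks f))" if "length ks \<le> 1" for ks
    using f that by (simp add: Cb_def)
  have le_sup: "\<bar>partials ks f x\<bar> \<le> sup_norm (partials ks f)" if ks: "length ks \<le> 1" for ks x
  proof -
    obtain C where "\<And>x. \<bar>partials ks f x\<bar> \<le> C" using bdd[OF ks] by (auto simp: bounded_iff)
    then show ?thesis unfolding sup_norm_def by (intro cSUP_upper bdd_aboveI2) auto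
  qed
  let ?M = "\<lambda>j. Max ((\<lambda>ks. sup_norm (partials ks f)) ` {ks. length ks = j})"
  have le_Max: "sup_norm (partials ks f) \<le> ?M (length ks)" for ks
    by (intro Max_ge finite_imageI finite_lists_of_length) auto
  have "0 \<le> \<bar>partials [] f x\<bar>" by simp
  also have "\<dots> \<le> ?M 0" using le_sup[of "[]" x] le_Max[of "[]"] by simp
  finally have "0 \<le> ?M 0" .
  moreover have "\<bar>partial i f x\<bar> \<le> ?M 1" using le_sup[of "[i]" x] le_Max[of "[i]"] by simp
  moreover have "Cb_norm 1 f = ?M 0 + ?M 1" 
  proof -
    have "{..1::nat} = {0, 1}" by auto
    then show ?thesis by (simp add: Cb_norm_def)
  qed
  ultimately show ?thesis by linarith
qed

section \<open>Regularity of mild solutions\<close>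

lemma heat_kernel_smoothing_semigroup:
  fixes p :: "real \<Rightarrow> real ^ 'n::finite \<Rightarrow> real"
  assumes "0 < T" "0 < \<alpha>" "0 \<le> c" and kernel: "heat_kernel A \<mu> p"
    and smooth: "\<And>t. 0 < t \<Longrightarrow> t \<le> T \<Longrightarrow> p t \<in> Cb 1"
    and grad: "\<And>t. 0 < t \<Longrightarrow> t \<le> T \<Longrightarrow>
      (\<integral>\<^sup>+ y. ennreal (norm (grad (p t) y)) \<partial>lborel) \<le> ennreal (c * t powr (- 1 / \<alpha>))"
  shows "smoothing_semigroup p T \<alpha> c"
proof
  fix t x i assume t: "0 < t" "t \<le> T"
  show "0 \<le> p t x" by (rule heat_kernel_nonneg[OF kernel t(1)])
  show "integrable lborel (p t)" "(\<integral>x. p t x \<partial>lborel) = 1"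
    by (rule heat_kernel_integral[OF kernel t(1)])+
  have "partials [] (p t) differentiable_on UNIV" "bounded (range (partials [i] (p t)))"
    using smooth[OF t] unfolding Cb_def by (auto simp del: partials.simps)
  then show "p t differentiable (at x)" "bounded (range (partial i (p t)))"
    by (auto simp: differentiable_on_def)
next
  fix s t x assume st: "0 < s" "0 < t" "s + t \<le> T"
  have *: "continuous_on UNIV (p r)" "bounded (range (p r))" if "0 < r" "r \<le> T" for r
  proof -
    have "continuous_on UNIV (partials [] (p r))" "bounded (range (partials [] (p r)))"
      using smooth[OF that] unfolding Cb_def by (auto simp del: partials.simps)
    then show "continuous_on UNIV (p r)" "bounded (range (p r))" by simp_all
  qed
  show "p (s + t) x = (\<integral>y. p s (x - y) * p t y \<partial>lborel)"
    by (rule heat_kernel_chapman_kolmogorov[OF kernel st(1,2)]) (use * st in auto)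
qed (use assms in auto)

theorem theorem4p2:
  fixes T \<alpha> \<beta> c\<^sub>0 H\<^sub>0 :: real
    and L :: "(real ^ 'n \<Rightarrow> real) \<Rightarrow> real ^ 'n \<Rightarrow> real"
    and A :: "real ^ 'n ^ 'n"
    and \<mu> :: "(real ^ 'n) measure"
    and p :: "real \<Rightarrow> real ^ 'n \<Rightarrow> real"
    and H :: "real \<Rightarrow> real ^ 'n \<Rightarrow> real ^ 'n \<Rightarrow> real"
    and u\<^sub>0 :: "real ^ 'n \<Rightarrow> real"
    and u :: "real \<Rightarrow> real ^ 'n \<Rightarrow> real"
  assumes "T > 0" and "\<beta> \<in> {0..1}"
    and levy: "has_levy_triplet L A \<mu>" and kernel: "heat_kernel A \<mu> p"
    and p_smooth: "\<forall>t\<in>{0<..T}. p t \<in> Cb_infinity"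
    and "\<alpha> \<in> {1<..2}" and "c\<^sub>0 > 0"
    and Dp_bound: "\<forall>t\<in>{0<..T}.
      (\<integral>\<^sup>+ y. ennreal (norm (grad (p t) y)) \<partial>lborel) \<le> ennreal (c\<^sub>0 * t powr (- 1 / \<alpha>))"
    and "\<alpha> + \<beta> \<notin> \<nat>"
    and H_cont: "continuous_on ({0..T} \<times> UNIV \<times> UNIV) (\<lambda>(t, x, q). H t x q)"
    and "H\<^sub>0 > 0" and H_zero: "\<forall>t\<in>{0<..<T}. \<forall>x. \<bar>H t x 0\<bar> \<le> H\<^sub>0"
    and H_lipschitz: "\<forall>R>0. \<exists>L\<^sub>R>0. \<forall>t\<in>{0<..<T}. \<forall>x. \<forall>q\<in>ball 0 R. \<forall>r\<in>ball 0 R.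
      \<bar>H t x q - H t x r\<bar> \<le> L\<^sub>R * norm (q - r)"
    and H_holder: "\<forall>R>0. \<exists>M\<^sub>R>0. \<forall>t\<in>{0..T}. \<forall>q\<in>ball 0 R. \<forall>x x'. norm (x - x') < 1 \<longrightarrow>
      \<bar>H t x q - H t x' q\<bar> \<le> M\<^sub>R * norm (x - x') powr \<beta>"
    and "bounded (range u\<^sub>0)" and "\<exists>K. K-lipschitz_on UNIV u\<^sub>0"
    and u_bounded: "u \<in> Cb_Cb T 1"
    and u_mild: "mild_solution p H T u\<^sub>0 u"
  shows "(\<forall>t\<in>{0<..T}. u t \<in> Cb_holder (\<alpha> + \<beta>)) \<and>
    (\<lambda>t. tensor_holder_seminorm (nat \<lfloor>\<alpha> + \<beta>\<rfloor>) (frac (\<alpha> + \<beta>)) (u t))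
      \<in> O[at_right 0](\<lambda>t. t powr (- (\<alpha> + \<beta> - 1) / \<alpha>)) \<and>
    (\<alpha> + \<beta> > 2 \<longrightarrow>
      (\<lambda>t. tensor_sup_norm 2 (u t)) \<in> O[at_right 0](\<lambda>t. t powr (- 1 / \<alpha>)))"
proof -
  have \<alpha>: "1 < \<alpha>" "\<alpha> \<le> 2" and \<beta>: "0 \<le> \<beta>" "\<beta> \<le> 1" using assms by auto
  interpret smoothing_semigroup p T \<alpha> c\<^sub>0
    by (rule heat_kernel_smoothing_semigroup[OF \<open>T > 0\<close> _ _ kernel])
       (use \<alpha> \<open>c\<^sub>0 > 0\<close> p_smooth Dp_bound in \<open>auto simp: Cb_infinity_def\<close>)
  define m where "m = nat \<lfloor>\<alpha> + \<beta>\<rfloor>"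
  have m1: "1 \<le> m" using \<alpha> \<beta> unfolding m_def by linarith
  have m_floor: "real m = of_int \<lfloor>\<alpha> + \<beta>\<rfloor>" using \<alpha> \<beta> by (simp add: m_def)
  have m: "real m < \<alpha> + \<beta>" "\<alpha> + \<beta> < real m + 1"
  proof -
    have "real m \<noteq> \<alpha> + \<beta>" using \<open>\<alpha> + \<beta> \<notin> \<nat>\<close> of_nat_in_Nats by metis
    then show "real m < \<alpha> + \<beta>" using m_floor of_int_floor_le[of "\<alpha> + \<beta>"] by linarith
    show "\<alpha> + \<beta> < real m + 1" using m_floor by linarith
  qed
  have frac: "frac (\<alpha> + \<beta>) = \<alpha> + \<beta> - real m" by (simp add: frac_def m_floor)
  have m': "real m - \<beta> < \<alpha>" using m by simp

  obtain B\<^sub>0 where u0_bdd: "\<And>x. \<bar>u\<^sub>0 x\<bar> \<le> B\<^sub>0" using \<open>bounded (range u\<^sub>0)\<close> by (auto simp: bounded_iff)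
  obtain \<Lambda> where \<Lambda>: "\<Lambda>-lipschitz_on UNIV u\<^sub>0" using assms by auto
  have \<Lambda>0: "0 \<le> \<Lambda>" using \<Lambda> by (rule lipschitz_on_nonneg)
  have u0_lip: "\<bar>u\<^sub>0 x - u\<^sub>0 y\<bar> \<le> \<Lambda> * norm (x - y)" for x y
    using lipschitz_onD[OF \<Lambda>, of x y] by (simp add: dist_real_def dist_norm)
  have u0_meas: "u\<^sub>0 \<in> borel_measurable borel"
    by (rule borel_measurable_continuous_onI[OF lipschitz_on_continuous_on[OF \<Lambda>]])

  have u_Cb: "u t \<in> Cb 1" if "0 < t" "t \<le> T" for t
    using u_bounded that by (simp add: Cb_Cb_def C_Cb_def)
  obtain B where B: "\<And>t. 0 < t \<Longrightarrow> t \<le> T \<Longrightarrow> Cb_norm 1 (u t) \<le> B"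
  proof -
    obtain B where "\<forall>z\<in>(\<lambda>t. Cb_norm 1 (u t)) ` {0<..T}. norm z \<le> B"
      using u_bounded by (auto simp: Cb_Cb_def bounded_iff)
    then have "\<bar>Cb_norm 1 (u t)\<bar> \<le> B" if "0 < t" "t \<le> T" for t using that by auto
    then show ?thesis using that[of B] abs_le_D1 by blast
  qed
  have Du_bdd: "\<bar>partial i (u t) x\<bar> \<le> B" if "0 < t" "t \<le> T" for t i x
    using abs_partial_le_Cb_norm[OF u_Cb[OF that]] B[OF that] order_trans by blast
  have B_nonneg: "0 \<le> B" using Du_bdd[of T undefined 0] \<open>T > 0\<close> by linarith
  \<comment> \<open>The local constants of \<open>H\<close> are needed on one ball that contains all values of \<open>Du\<close>.\<close>
  define R where "R = CARD('n) * B + 1"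
  have R: "0 < R" using B_nonneg by (simp add: R_def add_nonneg_pos)
  have grad_R: "grad (u t) x \<in> ball 0 R" if "0 < t" "t \<le> T" for t x
    using norm_grad_le[of "u t" x B, OF Du_bdd[OF that]] by (simp add: R_def)
  have "\<exists>L\<^sub>R>0. \<forall>t\<in>{0<..<T}. \<forall>x. \<forall>q\<in>ball 0 R. \<forall>r\<in>ball 0 R. \<bar>H t x q - H t x r\<bar> \<le> L\<^sub>R * norm (q - r)"
    using H_lipschitz R by blast
  then obtain L\<^sub>R where L\<^sub>R: "0 < L\<^sub>R" and H_lip: "\<And>t x q r. 0 < t \<Longrightarrow> t < T \<Longrightarrow> q \<in> ball 0 R \<Longrightarrow>
      r \<in> ball 0 R \<Longrightarrow>
      \<bar>H t x q - H t x r\<bar> \<le> L\<^sub>R * norm (q - r)"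
    by auto
  have "\<exists>M\<^sub>R>0. \<forall>t\<in>{0..T}. \<forall>q\<in>ball 0 R. \<forall>x x'. norm (x - x') < 1 \<longrightarrow> \<bar>H t x q - H t x' q\<bar> \<le>
      M\<^sub>R * norm (x - x') powr \<beta>"
    using H_holder R by blast
  then obtain M\<^sub>R where M\<^sub>R: "0 < M\<^sub>R" and H_hld: "\<And>t x x' q. 0 < t \<Longrightarrow> t < T \<Longrightarrow> q \<in> ball 0 R \<Longrightarrow>
      norm (x - x') < 1 \<Longrightarrow>
      \<bar>H t x q - H t x' q\<bar> \<le> M\<^sub>R * norm (x - x') powr \<beta>"
    by auto

  define f where "f s y = H s y (grad (u s) y)" for s y
  define F where "F = H\<^sub>0 + L\<^sub>R * R"
  have F: "0 \<le> F" using \<open>H\<^sub>0 > 0\<close> L\<^sub>R R by (simp add: F_def)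
  have f_bdd: "\<bar>f s x\<bar> \<le> F" if s: "0 < s" "s < T" for s x
  proof -
    have g: "grad (u s) x \<in> ball 0 R" using s by (intro grad_R) auto
    have "\<bar>H s x (grad (u s) x) - H s x 0\<bar> \<le> L\<^sub>R * norm (grad (u s) x - 0)"
      by (rule H_lip[OF s g]) (use R in simp)
    also have "\<dots> \<le> L\<^sub>R * R" using g L\<^sub>R by (intro mult_left_mono) auto
    finally have "\<bar>H s x (grad (u s) x) - H s x 0\<bar> \<le> L\<^sub>R * R" .
    moreover have "\<bar>H s x 0\<bar> \<le> H\<^sub>0" using H_zero s by auto
    ultimately show ?thesis unfolding f_def F_def by linarith
  qed
  have f_meas: "f s \<in> borel_measurable borel" if s: "0 < s" "s < T" for s
  proof -
    have "continuous_on UNIV (partials [i] (u s))" for i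
      using u_Cb[of s] s unfolding Cb_def by (auto simp del: partials.simps)
    then have "continuous_on UNIV (grad (u s))"
      unfolding grad_def[abs_def] by (intro continuous_on_vec_lambda) simp
    then have "continuous_on UNIV (\<lambda>y. (s, y, grad (u s) y))" by (intro continuous_intros)
    then have "continuous_on UNIV (\<lambda>y. case (s, y, grad (u s) y) of (t, x, q) \<Rightarrow> H t x q)"
      by (rule continuous_on_compose2[OF H_cont]) (use s in auto)
    then have "continuous_on UNIV (f s)" by (simp add: f_def[abs_def])
    then show ?thesis by (rule borel_measurable_continuous_onI)
  qed
  have f_int: "set_integrable lborel {0<..<t} (\<lambda>s. P (t - s) (f s) x)"
    and u_eq: "u t x = P t u\<^sub>0 x + duhamel f t x" if "0 < t" "t \<le> T" for t x
    using u_mild that unfolding mild_solution_def f_def[abs_def] duhamel_def by auto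
  have f_diff: "\<bar>f s (x + h) - f s x\<bar> \<le> M\<^sub>R * norm h powr \<beta> + L\<^sub>R * norm (grad (u s) (x + h) - grad (u
      s) x)"
    if s: "0 < s" "s < T" and h: "norm h < 1" for s x h
  proof -
    have g: "grad (u s) y \<in> ball 0 R" for y using s by (intro grad_R) auto
    have "\<bar>H s (x + h) (grad (u s) (x + h)) - H s x (grad (u s) (x + h))\<bar> \<le> M\<^sub>R * norm h powr \<beta>"
      using H_hld[OF s g, of "x + h" x "x + h"] h by simp
    then show ?thesis using H_lip[OF s g g, of x "x + h" x] unfolding f_def by linarith
  qed

  obtain C where C: "0 \<le> C" and Du_hoelder: "\<And>t x h. 0 < t \<Longrightarrow> t \<le> T \<Longrightarrow>
    norm (grad (u t) (x + h) - grad (u t) x) \<le> C * norm h powr \<beta> * t powr (- \<beta> / \<alpha>)"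
    using gradient_hoelder[OF \<alpha>(1) \<beta> \<Lambda>0 less_imp_le[OF M\<^sub>R] less_imp_le[OF L\<^sub>R] u0_meas u0_bdd u0_lip
      f_meas f_bdd f_int u_eq Du_bdd f_diff] by blast

  \<comment> \<open>The summand \<open>2 F\<close> covers increments over distances at least \<open>1\<close>, where \<open>H\<close> need not be Hoelder
    continuous in \<open>x\<close>; the power of \<open>T\<close> converts constants into multiples of \<open>s powr (-\<beta>/\<alpha>)\<close>.\<close>
  define K where "K = (M\<^sub>R + 2 * F) * T powr (\<beta> / \<alpha>) + L\<^sub>R * C"
  have K: "0 \<le> K" using M\<^sub>R F L\<^sub>R C by (simp add: K_def)
  have f_hoelder: "\<bar>f s x - f s y\<bar> \<le> K * s powr (- \<beta> / \<alpha>) * norm (x - y) powr \<beta>"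
    if s: "0 < s" "s < T" for s x y
  proof -
    let ?h = "norm (x - y) powr \<beta>" and ?s = "s powr (- \<beta> / \<alpha>)"
    have one: "1 \<le> T powr (\<beta> / \<alpha>) * ?s"
    proof -
      have "T powr (\<beta> / \<alpha>) * T powr (- \<beta> / \<alpha>) \<le> T powr (\<beta> / \<alpha>) * ?s"
        using s \<alpha> \<beta> by (intro mult_left_mono powr_mono2') auto
      then show ?thesis using \<open>T > 0\<close> by (simp add: powr_minus)
    qed
    have "\<bar>f s x - f s y\<bar> \<le> (M\<^sub>R + 2 * F) * ?h + L\<^sub>R * (C * ?h * ?s)"
    proof (cases "norm (x - y) < 1")
      case True
      have "\<bar>f s x - f s y\<bar> \<le> M\<^sub>R * ?h + L\<^sub>R * norm (grad (u s) x - grad (u s) y)"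
        using f_diff[OF s True, of y] by simp
      also have "\<dots> \<le> M\<^sub>R * ?h + L\<^sub>R * (C * ?h * ?s)"
        using Du_hoelder[of s y "x - y"] s L\<^sub>R by (intro add_left_mono mult_left_mono) auto
      also have "\<dots> \<le> (M\<^sub>R + 2 * F) * ?h + L\<^sub>R * (C * ?h * ?s)"
        using F by (intro add_right_mono mult_right_mono) auto
      finally show ?thesis .
    next
      case False
      then have "1 \<le> ?h" using \<beta> by (simp add: ge_one_powr_ge_zero)
      then have "2 * F * 1 \<le> 2 * F * ?h" using F by (intro mult_left_mono) auto
      moreover have "\<bar>f s x - f s y\<bar> \<le> 2 * F" using f_bdd[OF s, of x] f_bdd[OF s, of y] by linarith
      moreover have "0 \<le> M\<^sub>R * ?h" "0 \<le> L\<^sub>R * (C * ?h * ?s)" using M\<^sub>R L\<^sub>R C by auto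
      ultimately show ?thesis unfolding distrib_right by linarith
    qed
    also have "(M\<^sub>R + 2 * F) * ?h \<le> (M\<^sub>R + 2 * F) * ?h * (T powr (\<beta> / \<alpha>) * ?s)"
      using mult_left_mono[OF one, of "(M\<^sub>R + 2 * F) * ?h"] M\<^sub>R F by simp
    also have "(M\<^sub>R + 2 * F) * ?h * (T powr (\<beta> / \<alpha>) * ?s) + L\<^sub>R * (C * ?h * ?s) = K * ?s * ?h"
      by (simp add: K_def algebra_simps)
    finally show ?thesis by simp
  qed

  have mild: "u t = (\<lambda>x. P t u\<^sub>0 x + duhamel f t x)" if "0 < t" "t \<le> T" for t
    using u_eq[OF that] by auto
  have fm: "f s \<in> borel_measurable borel" and fb: "\<bar>f s x\<bar> \<le> F"
    and fh: "\<bar>f s x - f s y\<bar> \<le> K * s powr (- \<beta> / \<alpha>) * norm (x - y) powr \<beta>"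
    if "t \<le> T" "0 < s" "s < t" for s t x y
    using that f_meas[of s] f_bdd[of s x] f_hoelder[of s x y] by auto
  define C\<^sub>1 where "C\<^sub>1 k = smoothing_const k * (\<Lambda> + K * beta_const ((real k - \<beta>) / \<alpha>) (\<beta> / \<alpha>) * T powr
      (1 - 1 / \<alpha>))" for k
  define C\<^sub>2 where "C\<^sub>2 = diff_const m * (\<Lambda> + K * critical_const (\<beta> / \<alpha>) ((real m - \<beta>) / \<alpha>) ((real m + 1
      - \<beta>) / \<alpha>) * T powr (1 - 1 / \<alpha>))"
  have le1: "\<bar>partials ks (u t) x\<bar> \<le> C\<^sub>1 (length ks) * t powr (- (real (length ks) - 1) / \<alpha>)"
    if t: "0 < t" "t \<le> T" and "1 \<le> length ks" "length ks \<le> m" for t ks x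
    unfolding C\<^sub>1_def
    by (rule partials_mild_le[OF t \<alpha>(1) \<beta> K fm[OF t(2)] fb[OF t(2)] fh[OF t(2)] f_int[OF t] u0_meas
        u0_bdd u0_lip \<Lambda>0 mild[OF t] m' that(3,4)])
  have le2: "\<bar>partials ks (u t) (x + h) - partials ks (u t) x\<bar> \<le>
      C\<^sub>2 * t powr (- (\<alpha> + \<beta> - 1) / \<alpha>) * norm h powr (\<alpha> + \<beta> - real m)"
    if t: "0 < t" "t \<le> T" and "length ks = m" "h \<noteq> 0" for t ks x h
    using partials_mild_diff_le[OF t \<alpha>(1) \<beta> K fm[OF t(2)] fb[OF t(2)] fh[OF t(2)] f_int[OF t] u0_meas
        u0_bdd u0_lip \<Lambda>0 mild[OF t] m' m1 m that(3,4)]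
    by (simp add: C\<^sub>2_def mult_ac)
  have "u t \<in> Cb_holder (\<alpha> + \<beta>)" if t: "0 < t" "t \<le> T" for t
  proof (rule Cb_holderI[OF m])
    show "diff_upto m (u t)"
      by (rule diff_upto_mild[OF t \<alpha>(1) \<beta> K fm[OF t(2)] fb[OF t(2)] fh[OF t(2)] f_int[OF t] u0_meas
          u0_bdd u0_lip \<Lambda>0 mild[OF t] m'])
    show "bounded (range (partials ks (u t)))" if "length ks \<le> m" for ks
    proof (cases "ks = []")
      case True
      have "bounded (range (partials [] (u t)))" using u_Cb[OF t] unfolding Cb_def
          by (auto simp del: partials.simps)
      then show ?thesis using True by simp
    next
      case False
      then have "1 \<le> length ks" by (cases ks) auto
      from le1[OF t this that] show ?thesis by (auto simp: bounded_iff)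
    qed
    show "\<bar>partials ks (u t) (x + h) - partials ks (u t) x\<bar> \<le>
        C\<^sub>2 * t powr (- (\<alpha> + \<beta> - 1) / \<alpha>) * norm h powr (\<alpha> + \<beta> - real m)" if "length ks =
            m" "h \<noteq> 0" for ks x h
      by (rule le2[OF t that])
  qed
  moreover have "(\<lambda>t. tensor_holder_seminorm m (\<alpha> + \<beta> - real m) (u t)) \<in> O[at_right 0](\<lambda>t. t powr (- (\<alpha>
      + \<beta> - 1) / \<alpha>))"
  proof (rule bigoI)
    show "\<forall>\<^sub>F t in at_right 0. norm (tensor_holder_seminorm m (\<alpha> + \<beta> - real m) (u t)) \<le>
        (card {ks :: 'n list. length ks = m} * C\<^sub>2) * norm (t powr (- (\<alpha> + \<beta> - 1) / \<alpha>))"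
      using eventually_at_right_real[OF \<open>T > 0\<close>]
    proof (rule eventually_mono)
      fix t assume "t \<in> {0<..<T}"
      then have t: "0 < t" "t \<le> T" by auto
      from tensor_holder_seminorm_le[OF le2[OF t]]
      show "norm (tensor_holder_seminorm m (\<alpha> + \<beta> - real m) (u t)) \<le>
        (card {ks :: 'n list. length ks = m} * C\<^sub>2) * norm (t powr (- (\<alpha> + \<beta> - 1) / \<alpha>))"
        by (simp add: mult.assoc)
    qed
  qed
  moreover have "(\<lambda>t. tensor_sup_norm 2 (u t)) \<in> O[at_right 0](\<lambda>t. t powr (- 1 / \<alpha>))" if "\<alpha> + \<beta> > 2"
  proof (rule bigoI)
    have "2 \<le> m" using that m by linarith
    show "\<forall>\<^sub>F t in at_right 0. norm (tensor_sup_norm 2 (u t)) \<le>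
        (card {ks :: 'n list. length ks = 2} * C\<^sub>1 2) * norm (t powr (- 1 / \<alpha>))"
      using eventually_at_right_real[OF \<open>T > 0\<close>]
    proof (rule eventually_mono)
      fix t assume "t \<in> {0<..<T}"
      then have t: "0 < t" "t \<le> T" by auto
      have "\<bar>partials ks (u t) x\<bar> \<le> C\<^sub>1 2 * t powr (- 1 / \<alpha>)" if "length ks = 2" for ks x
        using le1[OF t, of ks x] that \<open>2 \<le> m\<close> by simp
      from tensor_sup_norm_le[OF this]
      show "norm (tensor_sup_norm 2 (u t)) \<le>
        (card {ks :: 'n list. length ks = 2} * C\<^sub>1 2) * norm (t powr (- 1 / \<alpha>))"
        by (simp add: mult.assoc)
    qed
  qed
  ultimately show ?thesis unfolding frac m_def[symmetric] by auto
qed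

end
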